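(* Let $B$ be a unital Banach algebra over $\mathbb K$ with $\|1_B\|=1$. The following assertions are equivalent. (i) There is a countable inverse system $(A_r,\pi_r^s)_{r\le s}$ of finite-dimensional unital Banach algebras with unital metric-quotient bonding homomorphisms such that $B$ is isometrically isomorphic, as a unital Banach algebra, to the bounded inverse limit of $(A_r,\pi_r^s)$. (ii) There are a Banach space $E$, an isometric identification $B=E^*$, and weak-star-to-norm continuous unital homomorphisms $\rho_n:B\to F_n$, $n\in\mathbb N$, where every $F_n$ is finite dimensional, such that $\bigcap_{n=0}^\infty\ker\rho_n=\{0\}$. (iii) There are a Banach space $E$, an isometric identification $B=E^*$, and increasing nonzero finite-dimensional subspaces $E_0\subseteq E_1\subseteq\cdots\subseteq E$ with $\overline{\bigcup_rE_r}=E$, such that every annihilator $$E_r^\perp=\{b\in B:\langle b,e\rangle=0\text{ for every }e\in E_r\}$$ is a proper two-sided ideal of $B$. Whenever these assertions hold, the predual $E$ may be chosen separable.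
   Context: $\mathbb K=\mathbb R$ or $\mathbb C$; $\mathbb N=\{0,1,\dots\}$. A countable inverse system as in (i) is indexed by $r\in\mathbb N$, with unital algebra homomorphisms $\pi_r^s:A_s\to A_r$ $(r\le s)$ satisfying $\|1_{A_r}\|=1$, $\pi_r^s\pi_s^t=\pi_r^t$ and the metric-quotient condition $\|x_r\|=\inf\{\|x_s\|:\pi_r^sx_s=x_r\}$ for $x_r\in A_r$. Its bounded inverse limit is the algebra of compatible sequences $(a_r)_r$ ($\pi_r^sa_s=a_r$ for $r\le s$) with $\sup_r\|a_r\|<\infty$, coordinatewise multiplication and norm $\sup_r\|a_r\|$. In (ii) each $F_n$ is a finite-dimensional unital algebra (with any norm), and weak-star refers to $\sigma(E^*,E)$. *)

theory Defs
  imports "HOL-Analysis.Analysis" "HOL-Algebra.Module" "HOL-Algebra.RingHom"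
begin

text \<open>
  The scalar field is a subset \<open>K\<close> of the complex numbers; the theorem assumes
  \<open>K = \<real> \<or> K = UNIV\<close>, i.e. that it is the field of real or of complex numbers.
  Since the statement quantifies existentially over spaces and algebras, these are records with
  an explicit carrier.  The multiplicative fields of the record are meaningless for
  spaces that are not algebras.
\<close>

record ('k, 'a) normed_module = "('k, 'a) module" +
  mnorm :: "'a \<Rightarrow> real" (\<open>\<parallel>_\<parallel>\<index>\<close>)

definition scalars :: "complex set \<Rightarrow> (complex, complex) normed_module" where
  "scalars K = \<lparr>carrier = K, mult = (*), one = 1, zero = 0, add = (+), smult = (*), mnorm = cmod\<rparr>"

subsection \<open>Normed and Banach spaces\<close>

locale normed_space = Module.module "scalars K" V
  for K :: "complex set" and V :: "(complex, 'a) normed_module" (structure) +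
  assumes mnorm_eq_zero_iff: "x \<in> carrier V \<Longrightarrow> \<parallel>x\<parallel> = 0 \<longleftrightarrow> x = \<zero>"
    and mnorm_triangle:
      "\<lbrakk>x \<in> carrier V; y \<in> carrier V\<rbrakk> \<Longrightarrow> \<parallel>x \<oplus> y\<parallel> \<le> \<parallel>x\<parallel> + \<parallel>y\<parallel>"
    and mnorm_smult: "\<lbrakk>c \<in> K; x \<in> carrier V\<rbrakk> \<Longrightarrow> \<parallel>c \<odot> x\<parallel> = cmod c * \<parallel>x\<parallel>"

text \<open>The library locale \<^locale>\<open>Metric_space\<close> requires nonnegativity and symmetry of the distance
  also off the carrier, hence the default value \<open>0\<close> there.\<close>

definition ndist :: "(complex, 'a) normed_module \<Rightarrow> 'a \<Rightarrow> 'a \<Rightarrow> real" where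
  "ndist V x y = (if x \<in> carrier V \<and> y \<in> carrier V then \<parallel>x \<ominus>\<^bsub>V\<^esub> y\<parallel>\<^bsub>V\<^esub> else 0)"

abbreviation norm_topology :: "(complex, 'a) normed_module \<Rightarrow> 'a topology" where
  "norm_topology V \<equiv> Metric_space.mtopology (carrier V) (ndist V)"

locale banach_space = normed_space +
  assumes complete: "Metric_space.mcomplete (carrier V) (ndist V)"

definition fin_dim :: "complex set \<Rightarrow> (complex, 'a) normed_module \<Rightarrow> bool" where
  "fin_dim K V \<longleftrightarrow> (\<exists>S. finite S \<and> S \<subseteq> carrier V \<and>
     (\<forall>v \<in> carrier V. \<exists>c \<in> S \<rightarrow> K. v = (\<Oplus>\<^bsub>V\<^esub>s\<in>S. c s \<odot>\<^bsub>V\<^esub> s)))"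

definition linear_maps ::
  "complex set \<Rightarrow> (complex, 'a) normed_module \<Rightarrow> (complex, 'b) normed_module \<Rightarrow> ('a \<Rightarrow> 'b) set" where
  "linear_maps K V W = {f \<in> hom (add_monoid V) (add_monoid W).
     \<forall>c \<in> K. \<forall>x \<in> carrier V. f (c \<odot>\<^bsub>V\<^esub> x) = c \<odot>\<^bsub>W\<^esub> f x}"

definition bij_isometry ::
  "(complex, 'a) normed_module \<Rightarrow> (complex, 'b) normed_module \<Rightarrow> ('a \<Rightarrow> 'b) \<Rightarrow> bool" where
  "bij_isometry V W f \<longleftrightarrow> bij_betw f (carrier V) (carrier W) \<and>
     (\<forall>x \<in> carrier V. \<parallel>f x\<parallel>\<^bsub>W\<^esub> = \<parallel>x\<parallel>\<^bsub>V\<^esub>)"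

subsection \<open>Unital algebras\<close>

locale unital_algebra = Module.module "scalars K" A + ring A
  for K :: "complex set" and A :: "(complex, 'a) normed_module" (structure) +
  assumes smult_mult_left: "\<lbrakk>c \<in> K; x \<in> carrier A; y \<in> carrier A\<rbrakk> \<Longrightarrow> (c \<odot> x) \<otimes> y = c \<odot> (x \<otimes> y)"
    and smult_mult_right: "\<lbrakk>c \<in> K; x \<in> carrier A; y \<in> carrier A\<rbrakk> \<Longrightarrow> x \<otimes> (c \<odot> y) = c \<odot> (x \<otimes> y)"

locale unital_banach_algebra = unital_algebra K A + banach_space K A
  for K and A (structure) +
  assumes mnorm_mult: "\<lbrakk>x \<in> carrier A; y \<in> carrier A\<rbrakk> \<Longrightarrow> \<parallel>x \<otimes> y\<parallel> \<le> \<parallel>x\<parallel> * \<parallel>y\<parallel>"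
    and mnorm_one: "\<parallel>\<one>\<parallel> = 1"

text \<open>Members of \<^const>\<open>ring_hom\<close> preserve the unit.\<close>

definition alg_hom ::
  "complex set \<Rightarrow> (complex, 'a) normed_module \<Rightarrow> (complex, 'b) normed_module \<Rightarrow> ('a \<Rightarrow> 'b) set" where
  "alg_hom K A B = ring_hom A B \<inter> linear_maps K A B"

subsection \<open>Dual spaces and the weak-star topology\<close>

definition dual_space ::
  "complex set \<Rightarrow> (complex, 'e) normed_module \<Rightarrow> (complex, 'e \<Rightarrow> complex) normed_module" where
  "dual_space K E = \<lparr>
     carrier = {f \<in> linear_maps K E (scalars K) \<inter> extensional (carrier E).
                  bdd_above ((\<lambda>e. cmod (f e)) ` {e \<in> carrier E. \<parallel>e\<parallel>\<^bsub>E\<^esub> \<le> 1})},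
     mult = undefined, one = undefined,
     zero = (\<lambda>e \<in> carrier E. 0),
     add = (\<lambda>f g. \<lambda>e \<in> carrier E. f e + g e),
     smult = (\<lambda>c f. \<lambda>e \<in> carrier E. c * f e),
     mnorm = (\<lambda>f. SUP e \<in> {e \<in> carrier E. \<parallel>e\<parallel>\<^bsub>E\<^esub> \<le> 1}. cmod (f e))\<rparr>"

definition weak_star_topology ::
  "complex set \<Rightarrow> (complex, 'e) normed_module \<Rightarrow> ('e \<Rightarrow> complex) topology" where
  "weak_star_topology K E = topology_generated_by
     {{f \<in> carrier (dual_space K E). f e \<in> U} |e U. e \<in> carrier E \<and> open U}"

text \<open>An isometric identification of \<open>B\<close> with the dual of a Banach space \<open>E\<close> is a linear
  bijective isometry \<open>\<Phi>\<close>, and the pairing of \<open>b\<close> with \<open>e\<close> is \<open>\<Phi> b e\<close>.\<close>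

definition predual ::
  "complex set \<Rightarrow> (complex, 'b) normed_module \<Rightarrow> (complex, 'e) normed_module \<Rightarrow>
     ('b \<Rightarrow> 'e \<Rightarrow> complex) \<Rightarrow> bool" where
  "predual K B E \<Phi> \<longleftrightarrow> banach_space K E \<and>
     \<Phi> \<in> linear_maps K B (dual_space K E) \<and> bij_isometry B (dual_space K E) \<Phi>"

definition annihilator ::
  "(complex, 'b) normed_module \<Rightarrow> ('b \<Rightarrow> 'e \<Rightarrow> complex) \<Rightarrow> 'e set \<Rightarrow> 'b set" where
  "annihilator B \<Phi> S = {b \<in> carrier B. \<forall>e \<in> S. \<Phi> b e = 0}"

subsection \<open>Inverse systems and bounded inverse limits\<close>

text \<open>The argument \<open>\<pi> r s\<close> is the bonding map from \<open>A s\<close> to \<open>A r\<close>.  With the convention that the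
  infimum of the empty set is infinite, the metric-quotient condition entails surjectivity; as
  \<^const>\<open>Inf\<close> on the reals does not follow that convention, surjectivity is spelled out.
  In particular \<open>\<pi> r r\<close>, being idempotent and onto, is the identity.\<close>

locale metric_inverse_system =
  fixes K :: "complex set" and A :: "nat \<Rightarrow> (complex, 'a) normed_module"
    and \<pi> :: "nat \<Rightarrow> nat \<Rightarrow> 'a \<Rightarrow> 'a"
  assumes unital_banach_algebra: "unital_banach_algebra K (A r)"
    and fin_dim: "fin_dim K (A r)"
    and alg_hom: "r \<le> s \<Longrightarrow> \<pi> r s \<in> alg_hom K (A s) (A r)"
    and compose: "\<lbrakk>r \<le> s; s \<le> t; x \<in> carrier (A t)\<rbrakk> \<Longrightarrow> \<pi> r s (\<pi> s t x) = \<pi> r t x"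
    and surj: "r \<le> s \<Longrightarrow> \<pi> r s ` carrier (A s) = carrier (A r)"
    and metric_quotient: "\<lbrakk>r \<le> s; x \<in> carrier (A r)\<rbrakk> \<Longrightarrow>
      \<parallel>x\<parallel>\<^bsub>A r\<^esub> = (INF y \<in> {y \<in> carrier (A s). \<pi> r s y = x}. \<parallel>y\<parallel>\<^bsub>A s\<^esub>)"

definition bounded_inverse_limit ::
  "(nat \<Rightarrow> (complex, 'a) normed_module) \<Rightarrow> (nat \<Rightarrow> nat \<Rightarrow> 'a \<Rightarrow> 'a) \<Rightarrow>
     (complex, nat \<Rightarrow> 'a) normed_module" where
  "bounded_inverse_limit A \<pi> = \<lparr>
     carrier = {a. (\<forall>r. a r \<in> carrier (A r)) \<and> (\<forall>r s. r \<le> s \<longrightarrow> \<pi> r s (a s) = a r) \<and>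
                   bdd_above (range (\<lambda>r. \<parallel>a r\<parallel>\<^bsub>A r\<^esub>))},
     mult = (\<lambda>a b r. a r \<otimes>\<^bsub>A r\<^esub> b r), one = (\<lambda>r. \<one>\<^bsub>A r\<^esub>),
     zero = (\<lambda>r. \<zero>\<^bsub>A r\<^esub>), add = (\<lambda>a b r. a r \<oplus>\<^bsub>A r\<^esub> b r),
     smult = (\<lambda>c a r. c \<odot>\<^bsub>A r\<^esub> a r),
     mnorm = (\<lambda>a. SUP r. \<parallel>a r\<parallel>\<^bsub>A r\<^esub>)\<rparr>"

subsection \<open>The three conditions\<close>

text \<open>HOL cannot quantify over types inside a formula, so the type in which the carriers of the
  algebras \<open>A r\<close>, respectively \<open>E\<close> and \<open>F n\<close>, live is a parameter of each condition.
  A finite-dimensional space can always be realised inside \<^typ>\<open>nat \<Rightarrow> complex\<close> (coordinates), and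
  a predual of \<open>B\<close> inside \<^typ>\<open>'b \<Rightarrow> complex\<close> (evaluation functionals on \<open>B\<close>); these are the types
  used in the theorem, whose last three conjuncts say that a condition realised in any other types
  is also realised in these.\<close>

definition is_bounded_inverse_limit ::
  "'a itself \<Rightarrow> complex set \<Rightarrow> (complex, 'b) normed_module \<Rightarrow> bool" where
  "is_bounded_inverse_limit (_ :: 'a itself) K B \<longleftrightarrow>
     (\<exists>(A :: nat \<Rightarrow> (complex, 'a) normed_module) \<pi>. metric_inverse_system K A \<pi> \<and>
        (\<exists>\<Psi> \<in> alg_hom K B (bounded_inverse_limit A \<pi>). bij_isometry B (bounded_inverse_limit A \<pi>) \<Psi>))"

definition separating_homs ::
  "'f itself \<Rightarrow> complex set \<Rightarrow> (complex, 'b) normed_module \<Rightarrow> (complex, 'e) normed_module \<Rightarrow>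
     ('b \<Rightarrow> 'e \<Rightarrow> complex) \<Rightarrow> bool" where
  "separating_homs (_ :: 'f itself) K B E \<Phi> \<longleftrightarrow>
     (\<exists>(F :: nat \<Rightarrow> (complex, 'f) normed_module) \<rho>.
        (\<forall>n. unital_algebra K (F n) \<and> normed_space K (F n) \<and> fin_dim K (F n) \<and>
             \<rho> n \<in> alg_hom K B (F n) \<and>
             continuous_map (pullback_topology (carrier B) \<Phi> (weak_star_topology K E))
               (norm_topology (F n)) (\<rho> n)) \<and>
        (\<Inter>n. a_kernel B (F n) (\<rho> n)) = {\<zero>\<^bsub>B\<^esub>})"

definition ideal_exhaustion ::
  "complex set \<Rightarrow> (complex, 'b) normed_module \<Rightarrow> (complex, 'e) normed_module \<Rightarrow>
     ('b \<Rightarrow> 'e \<Rightarrow> complex) \<Rightarrow> bool" where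
  "ideal_exhaustion K B E \<Phi> \<longleftrightarrow>
     (\<exists>S :: nat \<Rightarrow> 'e set.
        (\<forall>r. submodule (S r) (scalars K) E \<and> fin_dim K (E\<lparr>carrier := S r\<rparr>) \<and> S r \<noteq> {\<zero>\<^bsub>E\<^esub>} \<and>
             S r \<subseteq> S (Suc r)) \<and>
        norm_topology E closure_of (\<Union>r. S r) = carrier E \<and>
        (\<forall>r. ideal (annihilator B \<Phi> (S r)) B \<and> annihilator B \<Phi> (S r) \<noteq> carrier B))"

definition has_separating_homs ::
  "'e itself \<Rightarrow> 'f itself \<Rightarrow> complex set \<Rightarrow> (complex, 'b) normed_module \<Rightarrow> bool" where
  "has_separating_homs (_ :: 'e itself) F K B \<longleftrightarrow>
     (\<exists>(E :: (complex, 'e) normed_module) \<Phi>. predual K B E \<Phi> \<and> separating_homs F K B E \<Phi>)"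

definition has_ideal_exhaustion ::
  "'e itself \<Rightarrow> complex set \<Rightarrow> (complex, 'b) normed_module \<Rightarrow> bool" where
  "has_ideal_exhaustion (_ :: 'e itself) K B \<longleftrightarrow>
     (\<exists>(E :: (complex, 'e) normed_module) \<Phi>. predual K B E \<Phi> \<and> ideal_exhaustion K B E \<Phi>)"

end

theory Submission
  imports Defs
begin

text \<open>
  (iii) implies (i) and (ii): \<open>B\<close> modulo the annihilator of \<open>E\<^sub>r\<close>, with the quotient norm, is a
  finite-dimensional Banach algebra whose points have the coordinates \<open>\<langle>b, e\<^sub>i\<rangle>\<close>, where the \<open>e\<^sub>i\<close> span
  \<open>E\<^sub>r\<close>; this also makes the quotient map weak-star continuous.  A bounded thread of these quotients lifts
  to a bounded sequence in \<open>B\<close> that converges weak-star.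

  (ii) implies (iii): by weak-star continuity, the kernel of \<open>\<rho>\<^sub>n\<close> contains the annihilator of
  finitely many elements of \<open>E\<close>, hence is itself the annihilator of a finite-dimensional subspace.
  By the Hahn--Banach theorem, the union of these subspaces is dense because the homomorphisms
  separate points.

  (i) implies (iii): the functionals on \<open>B\<close> that factor through a coordinate \<open>A\<^sub>r\<close> form an increasing
  sequence of finite-dimensional spaces, and the predual is the closure of their union.  Since
  every \<open>A\<^sub>r\<close> is reflexive, a functional on the predual is a bounded thread.

  The predual constructed in the last step lives in the dual of \<open>B\<close>, and the algebras in the first step
  in coordinate space, whatever the types of the given data; this reduces all types to those of
  the theorem.
\<close>

section \<open>Scalars and functionals\<close>

text \<open>Everything finite-dimensional rests on one device: finitely many separating functionals
  \<open>\<rho> j\<close> admit a reproducing formula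
  \<open>x = \<Sum>s (\<Sum>j. \<gamma> s j * \<rho> j x) g s\<close> with a fixed matrix
  \<open>\<gamma>\<close>. Norm bounds, completeness, reflexivity and weak-star continuity of the
  quotient maps are read off from it, in place of bases and compactness. The lifts of a bounded
  thread converge without an appeal to Banach-Alaoglu: on each \<open>S s\<close> their pairings are
  constant from index \<open>s\<close> on, and the union of the \<open>S s\<close> is dense. Since a
  quotient norm need not be attained, every lift carries a slack that tends to 0; the limit then
  obeys the sharp bound that makes the map to the inverse limit isometric. A single
  \<open>F n\<close> may be the zero algebra, with kernel all of \<open>B\<close>. The ideals are
  therefore intersections of kernels up to an index \<open>r + m\<close>, where \<open>m\<close> is
  chosen such that the unit survives in \<open>F m\<close>; intersecting also makes the subspaces of
  \<open>E\<close> increase. Properness of the ideals is what gives the unit of a quotient the norm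
  1.\<close>

lemma scalars_simps [simp]:
  "carrier (scalars K) = K" "mult (scalars K) = (*)" "one (scalars K) = 1"
  "zero (scalars K) = 0" "add (scalars K) = (+)" "smult (scalars K) = (*)"
  "mnorm (scalars K) = cmod"
  by (simp_all add: scalars_def)

locale scalar_field =
  fixes K :: "complex set"
  assumes real_or_complex: "K = \<real> \<or> K = UNIV"
begin

lemma scalar_closed [simp, intro]:
  "0 \<in> K" "1 \<in> K" "a \<in> K \<Longrightarrow> - a \<in> K" "of_real t \<in> K"
  "\<lbrakk>a \<in> K; b \<in> K\<rbrakk> \<Longrightarrow> a + b \<in> K" "\<lbrakk>a \<in> K; b \<in> K\<rbrakk> \<Longrightarrow> a - b \<in> K"
  "\<lbrakk>a \<in> K; b \<in> K\<rbrakk> \<Longrightarrow> a * b \<in> K" "\<lbrakk>a \<in> K; b \<in> K\<rbrakk> \<Longrightarrow> a / b \<in> K"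
  using real_or_complex by auto

lemma sum_closed [simp, intro]: "(\<And>i. i \<in> I \<Longrightarrow> f i \<in> K) \<Longrightarrow> sum f I \<in> K"
  by (induction I rule: infinite_finite_induct) auto

lemma closed_scalars: "closed K"
  using real_or_complex closed_complex_Reals by auto

lemma lim_closed:
  assumes "\<And>n. f n \<in> K" "f \<longlonglongrightarrow> l" shows "l \<in> K"
  using closed_sequentially[OF closed_scalars] assms by blast

lemma cring_scalars: "cring (scalars K)"
proof (rule cringI)
  show "abelian_group (scalars K)"
    by (rule abelian_groupI) (auto simp: add.assoc add.commute intro!: bexI[of _ "- _"])
  show "Group.comm_monoid (scalars K)"
    by (rule comm_monoidI) (auto simp: mult.assoc mult.commute)
qed (auto simp: algebra_simps)

end

lemma linear_functional_iff:
  "f \<in> linear_maps K V (scalars K) \<longleftrightarrow>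
     (\<forall>x \<in> carrier V. f x \<in> K) \<and>
     (\<forall>x \<in> carrier V. \<forall>y \<in> carrier V. f (x \<oplus>\<^bsub>V\<^esub> y) = f x + f y) \<and>
     (\<forall>c \<in> K. \<forall>x \<in> carrier V. f (c \<odot>\<^bsub>V\<^esub> x) = c * f x)"
  by (auto simp: linear_maps_def hom_def Pi_def)

lemma linear_functionalI:
  assumes "\<And>x. x \<in> carrier V \<Longrightarrow> f x \<in> K"
    "\<And>x y. \<lbrakk>x \<in> carrier V; y \<in> carrier V\<rbrakk> \<Longrightarrow> f (x \<oplus>\<^bsub>V\<^esub> y) = f x + f y"
    "\<And>c x. \<lbrakk>c \<in> K; x \<in> carrier V\<rbrakk> \<Longrightarrow> f (c \<odot>\<^bsub>V\<^esub> x) = c * f x"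
  shows "f \<in> linear_maps K V (scalars K)"
  using assms by (simp add: linear_functional_iff)

lemma linear_functionalD:
  assumes "f \<in> linear_maps K V (scalars K)"
  shows "x \<in> carrier V \<Longrightarrow> f x \<in> K"
    "\<lbrakk>x \<in> carrier V; y \<in> carrier V\<rbrakk> \<Longrightarrow> f (x \<oplus>\<^bsub>V\<^esub> y) = f x + f y"
    "\<lbrakk>c \<in> K; x \<in> carrier V\<rbrakk> \<Longrightarrow> f (c \<odot>\<^bsub>V\<^esub> x) = c * f x"
  using assms by (auto simp: linear_functional_iff)

section \<open>Subspaces of coordinate space\<close>

text \<open>Linear subspaces of the space of \<open>K\<close>-valued sequences. Infinite sequences
  replace \<open>k\<close>-tuples so that the inductions on \<open>k\<close> below can pass to fewer
  coordinates without changing the ambient space.\<close>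

definition coord_space :: "complex set \<Rightarrow> (nat \<Rightarrow> complex) set \<Rightarrow> bool" where
  "coord_space K W \<longleftrightarrow> (\<forall>w \<in> W. \<forall>i. w i \<in> K) \<and> (\<lambda>i. 0) \<in> W \<and>
     (\<forall>w \<in> W. \<forall>z \<in> W. (\<lambda>i. w i + z i) \<in> W) \<and> (\<forall>c \<in> K. \<forall>w \<in> W. (\<lambda>i. c * w i) \<in> W)"

lemma coord_spaceD:
  assumes "coord_space K W"
  shows "w \<in> W \<Longrightarrow> w i \<in> K" "(\<lambda>i. 0) \<in> W" "\<lbrakk>w \<in> W; z \<in> W\<rbrakk> \<Longrightarrow> (\<lambda>i. w i + z i) \<in> W"
    "\<lbrakk>c \<in> K; w \<in> W\<rbrakk> \<Longrightarrow> (\<lambda>i. c * w i) \<in> W"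
  using assms by (auto simp: coord_space_def)

context scalar_field
begin

lemma coord_space_diff:
  assumes "coord_space K W" "w \<in> W" "u \<in> W" "c \<in> K"
  shows "(\<lambda>i. w i - c * u i) \<in> W"
proof -
  have "(\<lambda>i. - c * u i) \<in> W" using assms by (intro coord_spaceD(4)) auto
  from coord_spaceD(3)[OF assms(1,2) this] show ?thesis by simp
qed

lemma coord_space_hyperplane:
  "coord_space K W \<Longrightarrow> coord_space K {w \<in> W. w k = 0}"
  by (auto simp: coord_space_def)

lemma coord_space_pivot:
  assumes "coord_space K W" "\<not> (\<forall>w \<in> W. w k = 0)"
  obtains u where "u \<in> W" "u k = 1"
proof -
  obtain w where w: "w \<in> W" "w k \<noteq> 0" using assms(2) by blast
  have "(\<lambda>i. (1 / w k) * w i) \<in> W"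
    using assms(1) w by (intro coord_spaceD(4)) (auto simp: coord_spaceD)
  then show thesis using that[of "\<lambda>i. (1 / w k) * w i"] w(2) by simp
qed

text \<open>The bipolar theorem in finite dimension, by induction on the number of coordinates:
  either the last coordinate vanishes on \<open>W\<close>, hence at \<open>v\<close>, or a pivot
  \<open>u\<close> with \<open>u k = 1\<close> reduces \<open>W\<close> and \<open>v\<close> to the
  hyperplane where that coordinate is 0.\<close>

lemma coord_bipolar:
  assumes "coord_space K W" "\<And>i. v i \<in> K"
    and "\<And>c. \<lbrakk>\<And>i. c i \<in> K; \<And>w. w \<in> W \<Longrightarrow> (\<Sum>i<k. c i * w i) = 0\<rbrakk> \<Longrightarrow> (\<Sum>i<k. c i * v i) = 0"
  shows "\<exists>w \<in> W. \<forall>i<k. w i = v i"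
  using assms
proof (induction k arbitrary: W v)
  case 0
  then show ?case by (auto simp: coord_space_def)
next
  case (Suc k)
  note W = Suc.prems(1) and vK = Suc.prems(2)
  show ?case
  proof (cases "\<forall>w \<in> W. w k = 0")
    case True
    \<comment> \<open>Reading off coordinate \<open>k\<close> is a functional that annihilates
      \<open>W\<close>.\<close>
    have "(\<Sum>i<Suc k. (if i = k then 1 else 0) * v i) = 0"
      by (rule Suc.prems(3)) (auto simp: True)
    then have vk: "v k = 0" by simp
    have "\<exists>w \<in> W. \<forall>i<k. w i = v i"
    proof (rule Suc.IH[OF W vK])
      fix c :: "nat \<Rightarrow> complex"
      assume c: "\<And>i. c i \<in> K" "\<And>w. w \<in> W \<Longrightarrow> (\<Sum>i<k. c i * w i) = 0"
      have "(\<Sum>i<Suc k. c i * v i) = 0"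
        by (rule Suc.prems(3)) (auto simp: c True)
      then show "(\<Sum>i<k. c i * v i) = 0" using vk by simp
    qed
    then show ?thesis using True vk by (metis less_Suc_eq)
  next
    case False
    then obtain u where u: "u \<in> W" "u k = 1" by (rule coord_space_pivot[OF W])
    define W0 where "W0 = {w \<in> W. w k = 0}"
    have W0: "coord_space K W0" unfolding W0_def by (rule coord_space_hyperplane[OF W])
    have uK: "u i \<in> K" for i using W u by (simp add: coord_spaceD)
    have "\<exists>w \<in> W0. \<forall>i<k. w i = v i - v k * u i"
    proof (rule Suc.IH[OF W0])
      show "v i - v k * u i \<in> K" for i using vK uK by auto
      fix c :: "nat \<Rightarrow> complex"
      assume c: "\<And>i. c i \<in> K" "\<And>w. w \<in> W0 \<Longrightarrow> (\<Sum>i<k. c i * w i) = 0"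
      \<comment> \<open>This value makes the extended functional vanish at the pivot, so that it
        sees \<open>w\<close> only through \<open>w - w k * u\<close>, which lies in
        \<open>W0\<close> when \<open>w\<close> lies in \<open>W\<close>.\<close>
      define ck where "ck = - (\<Sum>i<k. c i * u i)"
      have expand: "(\<Sum>i<Suc k. (c(k := ck)) i * w i) = (\<Sum>i<k. c i * (w i - w k * u i))" for w
        by (simp add: ck_def algebra_simps sum_subtractf sum_distrib_left)
      have "(\<Sum>i<Suc k. (c(k := ck)) i * v i) = 0"
      proof (rule Suc.prems(3))
        show "(c(k := ck)) i \<in> K" for i using c(1) uK by (auto simp: ck_def)
        fix w assume w: "w \<in> W"
        have "(\<lambda>i. w i - w k * u i) \<in> W0"
          using coord_space_diff[OF W w u(1)] W w u(2) by (simp add: W0_def coord_spaceD)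
        from c(2)[OF this] show "(\<Sum>i<Suc k. (c(k := ck)) i * w i) = 0" by (simp only: expand)
      qed
      then show "(\<Sum>i<k. c i * (v i - v k * u i)) = 0" by (simp only: expand)
    qed
    then obtain w where w: "w \<in> W" "w k = 0" "\<forall>i<k. w i = v i - v k * u i"
      by (auto simp: W0_def)
    have "(\<lambda>i. w i - (- v k) * u i) \<in> W" by (rule coord_space_diff[OF W w(1) u(1)]) (use vK in auto)
    moreover have "\<forall>i<Suc k. w i - (- v k) * u i = v i" using w u by (auto simp: less_Suc_eq)
    ultimately show ?thesis 
      by (intro bexI[of _ "\<lambda>i. w i - (- v k) * u i"])
  qed
qed

text \<open>Gaussian elimination. The coefficients are required to depend on the coordinates of
  \<open>w\<close> through a fixed matrix \<open>\<gamma>\<close>, because the later norm estimates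
  and limits need this uniformity.\<close>

lemma coord_spanning:
  assumes "coord_space K W"
  shows "\<exists>S \<gamma>. finite S \<and> S \<subseteq> W \<and> (\<forall>s j. \<gamma> s j \<in> K) \<and>
    (\<forall>w \<in> W. \<forall>i<k. w i = (\<Sum>s\<in>S. (\<Sum>j<k. \<gamma> s j * w j) * s i))"
  using assms
proof (induction k arbitrary: W)
  case 0
  show ?case by (intro exI[of _ "{}"] exI[of _ "\<lambda>_ _. 0"]) auto
next
  case (Suc k)
  note W = Suc.prems(1)
  define W0 where "W0 = {w \<in> W. w k = 0}"
  have W0: "coord_space K W0" unfolding W0_def by (rule coord_space_hyperplane[OF W])
  from Suc.IH[OF W0] obtain S \<gamma> where S: "finite S" "S \<subseteq> W0" "\<forall>s j. \<gamma> s j \<in> K"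
    and exp0: "\<forall>w \<in> W0. \<forall>i<k. w i = (\<Sum>s\<in>S. (\<Sum>j<k. \<gamma> s j * w j) * s i)" by (elim exE conjE)
  have exp: "w i = (\<Sum>s\<in>S. (\<Sum>j<k. \<gamma> s j * w j) * s i)" if "w \<in> W0" "i < k" for w i
    using exp0 that by blast
  show ?case
  proof (cases "\<forall>w \<in> W. w k = 0")
    case True
    then have sub: "S \<subseteq> W" "\<forall>s\<in>S. s k = 0" using S(2) by (auto simp: W0_def)
    have rep: "w i = (\<Sum>s\<in>S. (\<Sum>j<Suc k. \<gamma> s j * w j) * s i)"
      if w: "w \<in> W" and i: "i < Suc k" for w i
    proof (cases "i = k")
      case True
      then show ?thesis using w sub(2) \<open>\<forall>w\<in>W. w k = 0\<close> by (simp add: sum.neutral)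
    next
      case False
      moreover have "w k = 0" using w True by blast
      ultimately show ?thesis using exp[of w i] w i by (simp add: W0_def)
    qed
    show ?thesis
      by (intro exI[of _ S] exI[of _ \<gamma>] conjI ballI allI impI)
        (simp only: S(1), rule sub(1), rule S(3)[rule_format], rule rep)
  next
    case False
    then obtain u where u: "u \<in> W" "u k = 1" by (rule coord_space_pivot[OF W])
    have uK: "u i \<in> K" for i using W u by (simp add: coord_spaceD)
    have S0: "s k = 0" if "s \<in> S" for s using that S(2) by (auto simp: W0_def)
    have uS: "u \<notin> S" using S0[of u] u(2) by auto
    \<comment> \<open>From \<open>w = w k * u + z\<close> with \<open>z = w - w k * u\<close> in
      \<open>W0\<close>: the row of \<open>u\<close> reads off \<open>w k\<close>, and expanding
      \<open>z\<close> with the old matrix contributes the entry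
      \<open>- (\<Sum>l<k. \<gamma> s l * u l)\<close> in the new column \<open>k\<close>.\<close>
    define \<gamma>' where "\<gamma>' = (\<lambda>s j. if s = u then (if j = k then 1 else 0)
      else if j = k then - (\<Sum>l<k. \<gamma> s l * u l) else \<gamma> s j)"
    show ?thesis
    proof (intro exI[of _ "insert u S"] exI[of _ \<gamma>'] conjI ballI allI impI)
      show "\<gamma>' s j \<in> K" for s j using S(3) uK by (auto simp: \<gamma>'_def)
      fix w i assume w: "w \<in> W" and i: "i < Suc k"
      define z where "z = (\<lambda>i. w i - w k * u i)"
      have z: "z \<in> W0"
        using coord_space_diff[OF W w u(1)] W w u(2) by (simp add: W0_def coord_spaceD z_def)
      have u': "(\<Sum>j<Suc k. \<gamma>' u j * w j) = w k" by (simp add: \<gamma>'_def)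
      have s': "(\<Sum>j<Suc k. \<gamma>' s j * w j) = (\<Sum>j<k. \<gamma> s j * z j)" if "s \<in> S" for s
      proof -
        have "s \<noteq> u" using that uS by auto
        then show ?thesis
          by (simp add: \<gamma>'_def z_def algebra_simps sum_subtractf sum_distrib_left)
      qed
      have "(\<Sum>s\<in>insert u S. (\<Sum>j<Suc k. \<gamma>' s j * w j) * s i)
          = w k * u i + (\<Sum>s\<in>S. (\<Sum>j<k. \<gamma> s j * z j) * s i)"
        unfolding sum.insert[OF S(1) uS] u' by (rule arg_cong2[where f = "(+)", OF refl], rule sum.cong[OF refl], simp only: s')
      also have "(\<Sum>s\<in>S. (\<Sum>j<k. \<gamma> s j * z j) * s i) = z i"
      proof (cases "i = k")
        case True
        then show ?thesis using S0 z by (simp add: W0_def sum.neutral)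
      next
        case False
        then show ?thesis using exp[OF z, of i] i by simp
      qed
      finally show "w i = (\<Sum>s\<in>insert u S. (\<Sum>j<Suc k. \<gamma>' s j * w j) * s i)"
        by (simp add: z_def)
    next
      show "finite (insert u S)" using S(1) by simp
      show "insert u S \<subseteq> W" using S(2) u(1) by (auto simp: W0_def)
    qed
  qed
qed

end

section \<open>The Hahn--Banach theorem\<close>

locale kspace = scalar_field K + Module.module "scalars K" V
  for K :: "complex set" and V :: "(complex, 'a) normed_module" (structure)
begin

lemma smult_in [simp, intro]: "\<lbrakk>c \<in> K; x \<in> carrier V\<rbrakk> \<Longrightarrow> c \<odot> x \<in> carrier V"
  using smult_closed by simp

lemma smult_add_left: "\<lbrakk>a \<in> K; b \<in> K; x \<in> carrier V\<rbrakk> \<Longrightarrow> (a + b) \<odot> x = a \<odot> x \<oplus> b \<odot> x"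
  using smult_l_distr by simp

lemma smult_add_right:
  "\<lbrakk>a \<in> K; x \<in> carrier V; y \<in> carrier V\<rbrakk> \<Longrightarrow> a \<odot> (x \<oplus> y) = a \<odot> x \<oplus> a \<odot> y"
  using smult_r_distr by simp

lemma smult_smult: "\<lbrakk>a \<in> K; b \<in> K; x \<in> carrier V\<rbrakk> \<Longrightarrow> a \<odot> (b \<odot> x) = (a * b) \<odot> x"
  using smult_assoc1 by simp

lemma smult_1 [simp]: "x \<in> carrier V \<Longrightarrow> 1 \<odot> x = x"
  using smult_one by simp

lemma smult_0 [simp]: "x \<in> carrier V \<Longrightarrow> 0 \<odot> x = \<zero>"
  using smult_l_null by simp

lemma smult_zero [simp]: "c \<in> K \<Longrightarrow> c \<odot> \<zero> = \<zero>"
  using smult_r_null by simp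

lemma minus_eq_smult: "x \<in> carrier V \<Longrightarrow> \<ominus> x = (- 1) \<odot> x"
proof (rule M.minus_equality)
  assume x: "x \<in> carrier V"
  have "(- 1) \<odot> x \<oplus> x = (- 1 + 1) \<odot> x" using x smult_add_left[of "- 1" 1 x] by simp
  then show "(- 1) \<odot> x \<oplus> x = \<zero>" using x by simp
qed auto

lemma submoduleI':
  assumes "H \<subseteq> carrier V" "\<zero> \<in> H" "\<And>x y. \<lbrakk>x \<in> H; y \<in> H\<rbrakk> \<Longrightarrow> x \<oplus> y \<in> H"
    "\<And>c x. \<lbrakk>c \<in> K; x \<in> H\<rbrakk> \<Longrightarrow> c \<odot> x \<in> H"
  shows "submodule H (scalars K) V"
proof (rule submoduleI)
  fix a assume "a \<in> H"
  then have "\<ominus> a = (- 1) \<odot> a" using assms(1) minus_eq_smult by blast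
  then show "\<ominus> a \<in> H" using assms(4)[of "- 1" a] \<open>a \<in> H\<close> by simp
qed (use assms in auto)

lemma zero_in_submodule:
  assumes "submodule H (scalars K) V" shows "\<zero> \<in> H"
proof -
  obtain x where x: "x \<in> H" using submoduleE(2)[OF assms] by blast
  then have "x \<in> carrier V" using submoduleE(1)[OF assms] by blast
  then show ?thesis using submoduleE(4)[OF assms, of 0 x] x by simp
qed

lemma submodule_chain_Union:
  fixes S :: "nat \<Rightarrow> 'a set"
  assumes S: "\<And>r. submodule (S r) (scalars K) V" and mono: "\<And>r s. r \<le> s \<Longrightarrow> S r \<subseteq> S s"
  shows "submodule (\<Union>r. S r) (scalars K) V"
proof (rule submoduleI')
  fix x y assume "x \<in> (\<Union>r. S r)" "y \<in> (\<Union>r. S r)"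
  then obtain r s where "x \<in> S r" "y \<in> S s" by blast
  then have "x \<in> S (max r s)" "y \<in> S (max r s)" using mono[of r "max r s"] mono[of s "max r s"] by auto
  then show "x \<oplus> y \<in> (\<Union>r. S r)" using submoduleE(5)[OF S] by blast
next
  fix c x assume "c \<in> K" "x \<in> (\<Union>r. S r)"
  then show "c \<odot> x \<in> (\<Union>r. S r)" using submoduleE(4)[OF S] by auto
qed (use submoduleE(1)[OF S] zero_in_submodule[OF S] in auto)

lemma functional_zero: "f \<in> linear_maps K V (scalars K) \<Longrightarrow> f \<zero> = 0"
  using linear_functionalD(3)[of f K V 0 \<zero>] by simp

lemma linear_functional_limit:
  assumes f: "\<And>n. f n \<in> linear_maps K V (scalars K)"
    and l: "\<And>x. x \<in> carrier V \<Longrightarrow> (\<lambda>n. f n x) \<longlonglongrightarrow> l x"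
  shows "l \<in> linear_maps K V (scalars K)"
proof (rule linear_functionalI)
  note lin = linear_functionalD[OF f]
  fix x assume x: "x \<in> carrier V"
  show "l x \<in> K" using lim_closed[OF _ l[OF x]] lin(1)[OF x] by blast
  show "l (x \<oplus> y) = l x + l y" if y: "y \<in> carrier V" for y
  proof (rule LIMSEQ_unique[OF l])
    show "(\<lambda>n. f n (x \<oplus> y)) \<longlonglongrightarrow> l x + l y"
      unfolding lin(2)[OF x y] by (intro tendsto_intros l x y)
  qed (use x y in auto)
  show "l (c \<odot> x) = c * l x" if c: "c \<in> K" for c
  proof (rule LIMSEQ_unique[OF l])
    show "(\<lambda>n. f n (c \<odot> x)) \<longlonglongrightarrow> c * l x"
      unfolding lin(3)[OF c x] by (intro tendsto_intros l x)
  qed (use x c in auto)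
qed

lemma functional_minus:
  assumes "f \<in> linear_maps K V (scalars K)" "x \<in> carrier V" "y \<in> carrier V"
  shows "f (x \<ominus> y) = f x - f y"
  using assms by (simp add: a_minus_def minus_eq_smult linear_functionalD[OF assms(1)])

lemma functional_finsum:
  assumes "f \<in> linear_maps K V (scalars K)" "finite I" "g \<in> I \<rightarrow> carrier V"
  shows "f (\<Oplus>i\<in>I. g i) = (\<Sum>i\<in>I. f (g i))"
  using assms(2,3)
proof (induction I)
  case empty
  then show ?case using functional_zero[OF assms(1)] by simp
next
  case (insert i I)
  then show ?case using linear_functionalD(2)[OF assms(1)] by (simp add: Pi_def)
qed

text \<open>Only real scalars occur, also over the complex field: a real linear functional is built
  first and complexified at the end. Homogeneity is asked for as one inequality, since applying it
  to \<open>1 / t\<close> gives the other.\<close>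

definition sublinear :: "('a \<Rightarrow> real) \<Rightarrow> bool" where
  "sublinear q \<longleftrightarrow> (\<forall>x \<in> carrier V. \<forall>y \<in> carrier V. q (x \<oplus> y) \<le> q x + q y) \<and>
     (\<forall>t > 0. \<forall>x \<in> carrier V. q (complex_of_real t \<odot> x) \<le> t * q x)"

lemma sublinear_zero:
  assumes "sublinear q" shows "q \<zero> = 0"
proof -
  have "q (complex_of_real (1 / 2) \<odot> \<zero>) \<le> 1 / 2 * q \<zero>" "q (\<zero> \<oplus> \<zero>) \<le> q \<zero> + q \<zero>"
    using assms unfolding sublinear_def by (meson M.zero_closed half_gt_zero zero_less_one)+
  moreover have "complex_of_real (1 / 2) \<odot> \<zero> = \<zero>" by (intro smult_zero scalar_closed)
  ultimately show ?thesis by (simp only: M.l_zero M.zero_closed)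
qed

lemma sublinearD:
  assumes q: "sublinear q"
  shows "\<lbrakk>x \<in> carrier V; y \<in> carrier V\<rbrakk> \<Longrightarrow> q (x \<oplus> y) \<le> q x + q y"
    "\<lbrakk>0 \<le> t; x \<in> carrier V\<rbrakk> \<Longrightarrow> q (complex_of_real t \<odot> x) = t * q x"
proof -
  assume t: "0 \<le> t" and x: "x \<in> carrier V"
  have le: "q (complex_of_real r \<odot> y) \<le> r * q y" if "0 < r" "y \<in> carrier V" for r y
    using q that by (simp add: sublinear_def)
  show "q (complex_of_real t \<odot> x) = t * q x"
  proof (cases "t = 0")
    case False
    then have t: "0 < t" using t by simp
    have "complex_of_real (1 / t) \<odot> (complex_of_real t \<odot> x) = x"
      using t x smult_smult[of "complex_of_real (1 / t)" "complex_of_real t" x]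
      by (simp flip: of_real_mult)
    then have "q x \<le> 1 / t * q (complex_of_real t \<odot> x)"
      using le[of "1 / t" "complex_of_real t \<odot> x"] t x by simp
    then show ?thesis using le[OF t x] t by (simp add: field_simps)
  qed (use sublinear_zero[OF q] x in simp)
qed (use q in \<open>simp add: sublinear_def\<close>)

lemma sublinear_minus_ge: "\<lbrakk>sublinear q; x \<in> carrier V\<rbrakk> \<Longrightarrow> - q (\<ominus> x) \<le> q x"
  using sublinearD(1)[of q x "\<ominus> x"] sublinear_zero[of q] by (simp add: M.r_neg)

text \<open>A sublinear functional that is minimal among its sublinear minorants agrees with all its tilts,
  which forces it to be odd and hence real linear.\<close>

definition tilt :: "('a \<Rightarrow> real) \<Rightarrow> 'a \<Rightarrow> 'a \<Rightarrow> real" where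
  "tilt q y x = (INF t\<in>{0..}. q (x \<oplus> complex_of_real t \<odot> y) - t * q y)"

text \<open>Subadditivity on \<open>t y = (x + t y) + (- x)\<close> gives the lower bound
  \<open>- q (\<ominus> x)\<close>, independent of \<open>t\<close> and \<open>y\<close>.\<close>

lemma tilt_bdd:
  assumes q: "sublinear q" and x: "x \<in> carrier V" and y: "y \<in> carrier V"
  shows "bdd_below ((\<lambda>t. q (x \<oplus> complex_of_real t \<odot> y) - t * q y) ` {0..})"
proof (rule bdd_belowI2[where m = "- q (\<ominus> x)"])
  fix t :: real assume "t \<in> {0..}"
  then have t: "0 \<le> t" by simp
  let ?y = "complex_of_real t \<odot> y"
  have y': "?y \<in> carrier V" using y by simp
  have "?y = (x \<oplus> ?y) \<oplus> \<ominus> x" using x y' by (simp add: M.a_ac M.r_neg2)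
  then have "t * q y \<le> q (x \<oplus> ?y) + q (\<ominus> x)"
    using sublinearD(1)[OF q, of "x \<oplus> ?y" "\<ominus> x"] sublinearD(2)[OF q t y] x y' by simp
  then show "- q (\<ominus> x) \<le> q (x \<oplus> ?y) - t * q y" by simp
qed

lemma tilt_le:
  assumes "sublinear q" "x \<in> carrier V" "y \<in> carrier V" "0 \<le> t"
  shows "tilt q y x \<le> q (x \<oplus> complex_of_real t \<odot> y) - t * q y"
  unfolding tilt_def using assms by (intro cINF_lower tilt_bdd) auto

lemma tilt_le_self: "\<lbrakk>sublinear q; x \<in> carrier V; y \<in> carrier V\<rbrakk> \<Longrightarrow> tilt q y x \<le> q x"
  using tilt_le[of q x y 0] by simp

text \<open>The parameter \<open>t = 1\<close> reduces the first term to
  \<open>q \<zero> = 0\<close>. For a functional that equals its tilts this is one half of oddness;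
  for the tilt of a seminorm it will prescribe the value at \<open>y\<close>.\<close>

lemma tilt_minus: "\<lbrakk>sublinear q; y \<in> carrier V\<rbrakk> \<Longrightarrow> tilt q y (\<ominus> y) \<le> - q y"
  using tilt_le[of q "\<ominus> y" y 1] sublinear_zero[of q] by (simp add: M.l_neg)

lemma tilt_greatest:
  assumes "\<And>t. 0 \<le> t \<Longrightarrow> m \<le> q (x \<oplus> complex_of_real t \<odot> y) - t * q y"
  shows "m \<le> tilt q y x"
  unfolding tilt_def using assms by (intro cINF_greatest) auto

text \<open>Parameters \<open>t\<close> at \<open>x\<close> and \<open>s\<close> at \<open>z\<close>
  combine to \<open>t + s\<close> at \<open>x \<oplus> z\<close>; scaling by \<open>r\<close>
  replaces \<open>t\<close> by \<open>r * t\<close>.\<close>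

lemma sublinear_tilt:
  assumes q: "sublinear q" and y: "y \<in> carrier V"
  shows "sublinear (tilt q y)"
proof -
  have add: "tilt q y (x \<oplus> z) \<le> tilt q y x + tilt q y z" if x: "x \<in> carrier V" and z: "z \<in> carrier V" for x z
  proof -
    have *: "tilt q y (x \<oplus> z) \<le> (q (x \<oplus> complex_of_real t \<odot> y) - t * q y)
        + (q (z \<oplus> complex_of_real s \<odot> y) - s * q y)" if t: "0 \<le> t" and s: "0 \<le> s" for t s
    proof -
      have y': "complex_of_real t \<odot> y \<in> carrier V" "complex_of_real s \<odot> y \<in> carrier V" using y by auto
      have "(x \<oplus> complex_of_real t \<odot> y) \<oplus> (z \<oplus> complex_of_real s \<odot> y)
          = (x \<oplus> z) \<oplus> complex_of_real (t + s) \<odot> y"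
        using x z y y' by (simp add: smult_add_left M.a_ac)
      then have "q ((x \<oplus> z) \<oplus> complex_of_real (t + s) \<odot> y)
          \<le> q (x \<oplus> complex_of_real t \<odot> y) + q (z \<oplus> complex_of_real s \<odot> y)"
        using sublinearD(1)[OF q, of "x \<oplus> complex_of_real t \<odot> y" "z \<oplus> complex_of_real s \<odot> y"] x z y'
        by simp
      then show ?thesis
        using tilt_le[OF q _ y, of "x \<oplus> z" "t + s"] x z t s by (simp add: algebra_simps)
    qed
    have "tilt q y (x \<oplus> z) - (q (x \<oplus> complex_of_real t \<odot> y) - t * q y) \<le> tilt q y z"
      if "0 \<le> t" for t
      by (rule tilt_greatest) (use *[OF that] in \<open>simp add: algebra_simps\<close>)
    then have "tilt q y (x \<oplus> z) - tilt q y z \<le> tilt q y x"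
      by (intro tilt_greatest) (simp add: algebra_simps)
    then show ?thesis by simp
  qed
  have scale: "tilt q y (complex_of_real r \<odot> x) \<le> r * tilt q y x" if r: "0 < r" and x: "x \<in> carrier V" for r x
  proof -
    have "(1 / r) * tilt q y (complex_of_real r \<odot> x) \<le> tilt q y x"
    proof (rule tilt_greatest)
      fix t :: real assume t: "0 \<le> t"
      have "complex_of_real r \<odot> (x \<oplus> complex_of_real t \<odot> y)
          = complex_of_real r \<odot> x \<oplus> complex_of_real (r * t) \<odot> y"
        using x y by (simp add: smult_add_right smult_smult)
      then have "q (complex_of_real r \<odot> x \<oplus> complex_of_real (r * t) \<odot> y)
          = r * q (x \<oplus> complex_of_real t \<odot> y)"
        using sublinearD(2)[OF q, of r "x \<oplus> complex_of_real t \<odot> y"] r x y by simp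
      then have "tilt q y (complex_of_real r \<odot> x) \<le> r * (q (x \<oplus> complex_of_real t \<odot> y) - t * q y)"
        using tilt_le[OF q _ y, of "complex_of_real r \<odot> x" "r * t"] r t x by (simp add: algebra_simps)
      then show "(1 / r) * tilt q y (complex_of_real r \<odot> x) \<le> q (x \<oplus> complex_of_real t \<odot> y) - t * q y"
        using r by (simp add: field_simps)
    qed
    then show ?thesis using r by (simp add: field_simps)
  qed
  then show ?thesis using add unfolding sublinear_def by blast
qed

text \<open>Zorn's lemma, with pointwise infima as bounds of chains. They are finite because a
  sublinear \<open>q\<close> below \<open>p\<close> satisfies
  \<open>- p (\<ominus> x) \<le> q x\<close>, and subadditive because of two members of a chain one
  lies below the other.\<close>

lemma sublinear_minorant:
  assumes p: "sublinear p"
  obtains q where "sublinear q" "\<And>x. x \<in> carrier V \<Longrightarrow> q x \<le> p x"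
    "\<And>x y. \<lbrakk>x \<in> carrier V; y \<in> carrier V\<rbrakk> \<Longrightarrow> q (x \<oplus> y) = q x + q y"
    "\<And>t x. x \<in> carrier V \<Longrightarrow> q (complex_of_real t \<odot> x) = t * q x"
proof -
  \<comment> \<open>Sublinearity says nothing off the carrier. Fixing the value 0 there lets
    candidates be compared on the whole type, so that minimality yields an equality of
    functions.\<close>
  define cut where "cut f x = (if x \<in> carrier V then f x else (0::real))" for f x
  have cut_sub: "sublinear (cut f)" if "sublinear f" for f
    using that by (simp add: sublinear_def cut_def)
  define A where "A = {q. sublinear q \<and> (\<forall>x. x \<notin> carrier V \<longrightarrow> q x = 0) \<and> (\<forall>x \<in> carrier V. q x \<le> p x)}"
  \<comment> \<open>The order is reversed, so that the maximal element given by Zorn's lemma is a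
    minimal functional.\<close>
  define P where "P q q' \<longleftrightarrow> (\<forall>x. q' x \<le> q x)" for q q' :: "'a \<Rightarrow> real"
  have "\<exists>m \<in> A. \<forall>a \<in> A. P m a \<longrightarrow> a = m"
  proof (rule predicate_Zorn)
    show "partial_order_on A (relation_of P A)"
      by (rule partial_order_on_relation_ofI) (auto simp: P_def fun_eq_iff intro: order_trans antisym)
    fix C assume C: "C \<in> Chains (relation_of P A)"
    then have CA: "C \<subseteq> A" by (auto simp: Chains_def relation_of_def)
    have Clin: "P a b \<or> P b a" if "a \<in> C" "b \<in> C" for a b
      using C that by (auto simp: Chains_def relation_of_def)
    have Cs: "sublinear a" if "a \<in> C" for a using CA that by (auto simp: A_def)
    show "\<exists>u \<in> A. \<forall>a \<in> C. P a u"
    proof (cases "C = {}")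
      case True
      have "cut p \<in> A" using cut_sub[OF p] by (simp add: A_def cut_def)
      then show ?thesis using True by blast
    next
      case False
      define u where "u = cut (\<lambda>x. INF q\<in>C. q x)"
      have bdd: "bdd_below ((\<lambda>q. q x) ` C)" if x: "x \<in> carrier V" for x
      proof (rule bdd_belowI2[where m = "- p (\<ominus> x)"])
        fix q assume q: "q \<in> C"
        have "q (\<ominus> x) \<le> p (\<ominus> x)" using q CA x by (auto simp: A_def)
        then show "- p (\<ominus> x) \<le> q x" using sublinear_minus_ge[OF Cs[OF q] x] by linarith
      qed
      have u_le: "u x \<le> q x" if "q \<in> C" for q x
        using that CA bdd by (auto simp: u_def cut_def A_def intro!: cINF_lower)
      have u_ge: "m \<le> u x" if "x \<in> carrier V" "\<And>q. q \<in> C \<Longrightarrow> m \<le> q x" for m x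
        using that False by (auto simp: u_def cut_def intro!: cINF_greatest)
      have u_add: "u (x \<oplus> z) \<le> u x + u z" if x: "x \<in> carrier V" and z: "z \<in> carrier V" for x z
      proof -
        have *: "u (x \<oplus> z) \<le> a x + b z" if ab: "a \<in> C" "b \<in> C" for a b
        proof -
          obtain c where c: "c \<in> C" "c x \<le> a x" "c z \<le> b z"
            using Clin[OF ab] ab unfolding P_def by blast
          have "u (x \<oplus> z) \<le> c (x \<oplus> z)" by (rule u_le[OF c(1)])
          also have "\<dots> \<le> c x + c z" by (rule sublinearD(1)[OF Cs[OF c(1)] x z])
          finally show ?thesis using c by linarith
        qed
        have "u (x \<oplus> z) - a x \<le> u z" if "a \<in> C" for a
          by (rule u_ge[OF z]) (use *[OF that] in \<open>simp add: algebra_simps\<close>)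
        then have "u (x \<oplus> z) - u z \<le> u x" by (intro u_ge[OF x]) (simp add: algebra_simps)
        then show ?thesis by simp
      qed
      have u_scale: "u (complex_of_real t \<odot> x) \<le> t * u x" if t: "0 < t" and x: "x \<in> carrier V" for t x
      proof -
        have "u (complex_of_real t \<odot> x) / t \<le> u x"
        proof (rule u_ge[OF x])
          fix a assume a: "a \<in> C"
          show "u (complex_of_real t \<odot> x) / t \<le> a x"
            using u_le[OF a, of "complex_of_real t \<odot> x"] sublinearD(2)[OF Cs[OF a] _ x, of t] t
            by (simp add: field_simps)
        qed
        then show ?thesis using t by (simp add: field_simps)
      qed
      have "u \<in> A"
      proof -
        obtain a0 where a0: "a0 \<in> C" using False by blast
        have "u x \<le> p x" if "x \<in> carrier V" for x
          using u_le[OF a0, of x] a0 CA that by (fastforce simp: A_def)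
        then show ?thesis using u_add u_scale by (simp add: A_def sublinear_def) (simp add: u_def cut_def)
      qed
      then show ?thesis using u_le by (auto simp: P_def)
    qed
  qed
  then obtain q where qA: "q \<in> A" and qmin: "\<And>a. \<lbrakk>a \<in> A; P q a\<rbrakk> \<Longrightarrow> a = q" by blast
  have q: "sublinear q" and qp: "\<And>x. x \<in> carrier V \<Longrightarrow> q x \<le> p x" using qA by (auto simp: A_def)
  have neg: "q (\<ominus> y) = - q y" if y: "y \<in> carrier V" for y
  proof -
    have le: "cut (tilt q y) x \<le> q x" for x
      using tilt_le_self[OF q _ y] qA by (simp add: cut_def A_def)
    have "cut (tilt q y) x \<le> p x" if "x \<in> carrier V" for x
      using le[of x] qp[OF that] by linarith
    then have "cut (tilt q y) \<in> A"
      using cut_sub[OF sublinear_tilt[OF q y]] by (simp add: A_def) (simp add: cut_def)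
    then have "cut (tilt q y) = q" using le by (intro qmin) (simp_all add: P_def)
    then have "q (\<ominus> y) = tilt q y (\<ominus> y)" using y by (metis cut_def M.a_inv_closed)
    then show ?thesis using tilt_minus[OF q y] sublinear_minus_ge[OF q y] by linarith
  qed
  have add: "q (x \<oplus> y) = q x + q y" if x: "x \<in> carrier V" and y: "y \<in> carrier V" for x y
  proof -
    have "q x \<le> q (x \<oplus> y) + q (\<ominus> y)"
      using sublinearD(1)[OF q, of "x \<oplus> y" "\<ominus> y"] x y by (simp add: M.a_assoc M.r_neg)
    then show ?thesis using sublinearD(1)[OF q x y] neg[OF y] by linarith
  qed
  have scale: "q (complex_of_real t \<odot> x) = t * q x" if x: "x \<in> carrier V" for t x
  proof (cases "0 \<le> t")
    case True
    then show ?thesis using sublinearD(2)[OF q _ x] by simp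
  next
    case False
    have "\<ominus> (complex_of_real (- t) \<odot> x) = complex_of_real t \<odot> x"
      using x minus_eq_smult[of "complex_of_real (- t) \<odot> x"] smult_smult[of "- 1" "complex_of_real (- t)" x]
      by simp
    then show ?thesis
      using neg[of "complex_of_real (- t) \<odot> x"] sublinearD(2)[OF q, of "- t" x] x False by simp
  qed
  show thesis using that[OF q qp add scale] by blast
qed

text \<open>The minorant is taken below \<open>tilt p a\<close> instead of \<open>p\<close>: this
  forces \<open>q (\<ominus> a) \<le> - p a\<close>, hence \<open>q a = p a\<close>, and no
  functional has to be extended from the line through \<open>a\<close>. Over the complex field
  \<open>F x = q x - i q (i x)\<close>, and a rotation restores the bound by
  \<open>p\<close>.\<close>

theorem hahn_banach:
  assumes a: "a \<in> carrier V"
    and p_add: "\<And>x y. \<lbrakk>x \<in> carrier V; y \<in> carrier V\<rbrakk> \<Longrightarrow> p (x \<oplus> y) \<le> p x + p y"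
    and p_scale: "\<And>c x. \<lbrakk>c \<in> K; x \<in> carrier V\<rbrakk> \<Longrightarrow> p (c \<odot> x) = cmod c * p x"
  obtains F where "F \<in> linear_maps K V (scalars K)" "F a = complex_of_real (p a)"
    "\<And>x. x \<in> carrier V \<Longrightarrow> cmod (F x) \<le> p x"
proof -
  have p: "sublinear p" using p_add p_scale by (simp add: sublinear_def)
  obtain q where q: "sublinear q" and qt: "\<And>x. x \<in> carrier V \<Longrightarrow> q x \<le> tilt p a x"
    and qadd: "\<And>x y. \<lbrakk>x \<in> carrier V; y \<in> carrier V\<rbrakk> \<Longrightarrow> q (x \<oplus> y) = q x + q y"
    and qscale: "\<And>t x. x \<in> carrier V \<Longrightarrow> q (complex_of_real t \<odot> x) = t * q x"
    using sublinear_minorant[OF sublinear_tilt[OF p a]] by metis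
  have qp: "q x \<le> p x" if "x \<in> carrier V" for x
    using qt[OF that] tilt_le_self[OF p that a] by linarith
  have qm: "q (\<ominus> x) = - q x" if "x \<in> carrier V" for x
    using qscale[OF that, of "- 1"] that by (simp add: minus_eq_smult)
  have pm: "p (\<ominus> x) = p x" if "x \<in> carrier V" for x
    using p_scale[of "- 1" x] that by (simp add: minus_eq_smult)
  have qa: "q a = p a"
    using qt[of "\<ominus> a"] tilt_minus[OF p a] qm[OF a] qp[OF a] a by simp
  from real_or_complex show thesis
  proof
    assume K: "K = \<real>"
    show thesis
    proof (rule that)
      show "(\<lambda>x. complex_of_real (q x)) \<in> linear_maps K V (scalars K)"
        by (rule linear_functionalI) (auto simp: qadd qscale K elim!: Reals_cases)
      show "cmod (complex_of_real (q x)) \<le> p x" if "x \<in> carrier V" for x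
        using qp[OF that] qp[of "\<ominus> x"] qm[OF that] pm[OF that] that by (simp add: abs_le_iff)
    qed (simp add: qa)
  next
    assume K: "K = UNIV"
    define F where "F x = Complex (q x) (- q (\<i> \<odot> x))" for x
    have Fadd: "F (x \<oplus> y) = F x + F y" if "x \<in> carrier V" "y \<in> carrier V" for x y
      using that by (simp add: F_def qadd smult_add_right K complex_eq_iff)
    have Freal: "F (complex_of_real t \<odot> x) = complex_of_real t * F x" if x: "x \<in> carrier V" for t x
    proof -
      have "\<i> \<odot> (complex_of_real t \<odot> x) = complex_of_real t \<odot> (\<i> \<odot> x)"
        using x by (simp add: smult_smult K mult.commute)
      then show ?thesis using x by (simp add: F_def qscale K complex_eq_iff)
    qed
    have Fi: "F (\<i> \<odot> x) = \<i> * F x" if x: "x \<in> carrier V" for x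
    proof -
      have "\<i> \<odot> (\<i> \<odot> x) = complex_of_real (- 1) \<odot> x" using x by (simp add: smult_smult K)
      then show ?thesis using x qscale[OF x, of "- 1"] by (simp add: F_def complex_eq_iff)
    qed
    have Fscale: "F (c \<odot> x) = c * F x" if x: "x \<in> carrier V" for c x
    proof -
      have c: "c = complex_of_real (Re c) + complex_of_real (Im c) * \<i>"
        by (simp add: complex_eq_iff)
      have "c \<odot> x = complex_of_real (Re c) \<odot> x \<oplus> complex_of_real (Im c) \<odot> (\<i> \<odot> x)"
        using x by (subst c) (simp add: smult_add_left smult_smult K)
      then have "F (c \<odot> x) = complex_of_real (Re c) * F x + complex_of_real (Im c) * (\<i> * F x)"
        using x by (simp add: Fadd Freal Fi K)
      also have "\<dots> = c * F x" by (subst (3) c) (simp add: algebra_simps)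
      finally show ?thesis .
    qed
    have Fp: "cmod (F x) \<le> p x" if x: "x \<in> carrier V" for x
    proof (cases "F x = 0")
      case True
      then show ?thesis using qp[OF x] by (simp add: F_def complex_eq_iff complex_norm)
    next
      case False
      \<comment> \<open>A scalar of modulus 1 that turns \<open>F x\<close> into its absolute value,
        so that the bound on the real part applies.\<close>
      define c where "c = cnj (F x) / cmod (F x)"
      have c1: "cmod c = 1" using False by (simp add: c_def norm_divide)
      have "c * F x = complex_of_real (cmod (F x))"
        using False by (simp add: c_def complex_norm_square[symmetric] mult.commute power2_eq_square)
      then have "cmod (F x) = Re (F (c \<odot> x))" using Fscale[OF x, of c] by simp
      also have "\<dots> \<le> p (c \<odot> x)" using qp[of "c \<odot> x"] x by (simp add: F_def K)
      finally show ?thesis using p_scale[of c x] x c1 K by simp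
    qed
    have "F a = complex_of_real (p a)"
    proof -
      have re: "Re (F a) = p a" by (simp add: F_def qa)
      \<comment> \<open>The real part already exhausts the bound \<open>p a\<close> on the modulus,
        which leaves nothing for the imaginary part.\<close>
      have "(Re (F a))\<^sup>2 + (Im (F a))\<^sup>2 \<le> (p a)\<^sup>2"
        using power_mono[OF Fp[OF a], of 2] by (simp add: cmod_power2)
      then have "Im (F a) = 0" using re by simp
      then show ?thesis using re by (simp add: complex_eq_iff)
    qed
    then show thesis
      using that[of F] Fp Fadd Fscale linear_functionalI[of V F K] by (simp add: K)
  qed
qed

end

section \<open>Finite-dimensional spaces\<close>

context kspace
begin

lemma minus_eq_zero_iff:
  assumes "x \<in> carrier V" "y \<in> carrier V" shows "x \<ominus> y = \<zero> \<longleftrightarrow> x = y"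
proof
  assume "x \<ominus> y = \<zero>"
  moreover have "(x \<ominus> y) \<oplus> y = x" using assms by (simp add: a_minus_def M.a_assoc M.l_neg)
  ultimately show "x = y" using assms by simp
qed (use assms in \<open>simp add: a_minus_def M.r_neg\<close>)

lemma kspace_submodule: "submodule H (scalars K) V \<Longrightarrow> kspace K (V\<lparr>carrier := H\<rparr>)"
  by (intro kspace.intro scalar_field_axioms submodule.submodule_is_module) (auto intro: module_axioms)

text \<open>\<open>finsum\<close> depends on the record that it is applied to, so sums formed in a
  subspace have to be identified with sums in \<open>V\<close>.\<close>

lemma finsum_submodule:
  assumes H: "submodule H (scalars K) V" and "finite I" "g \<in> I \<rightarrow> H"
  shows "finsum (V\<lparr>carrier := H\<rparr>) g I = finsum V g I \<and> finsum V g I \<in> H"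
proof -
  interpret H: kspace K "V\<lparr>carrier := H\<rparr>" by (rule kspace_submodule[OF H])
  note sub = submoduleE[OF H]
  from assms(2,3) show ?thesis
  proof (induction I)
    case empty
    have "\<zero> \<in> H" using H.M.zero_closed by simp
    then show ?case by simp
  next
    case (insert i I)
    then have "g i \<in> H" "g \<in> I \<rightarrow> H" by auto
    moreover have "g \<in> I \<rightarrow> carrier V" "g i \<in> carrier V" using calculation sub(1) by auto
    moreover have "finsum (V\<lparr>carrier := H\<rparr>) g (insert i I)
        = g i \<oplus> finsum (V\<lparr>carrier := H\<rparr>) g I"
      using H.finsum_insert[of I i g] insert.hyps calculation by simp
    ultimately show ?case using insert sub(5) by simp
  qed
qed

lemma finsum_smult_add:
  assumes "finite I" "g \<in> I \<rightarrow> carrier V" "\<And>i. i \<in> I \<Longrightarrow> a i \<in> K" "\<And>i. i \<in> I \<Longrightarrow> b i \<in> K"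
  shows "(\<Oplus>i\<in>I. (a i + b i) \<odot> g i) = (\<Oplus>i\<in>I. a i \<odot> g i) \<oplus> (\<Oplus>i\<in>I. b i \<odot> g i)"
proof -
  have "(\<Oplus>i\<in>I. (a i + b i) \<odot> g i) = (\<Oplus>i\<in>I. a i \<odot> g i \<oplus> b i \<odot> g i)"
    using assms by (intro M.finsum_cong') (auto simp: smult_add_left Pi_def)
  also have "\<dots> = (\<Oplus>i\<in>I. a i \<odot> g i) \<oplus> (\<Oplus>i\<in>I. b i \<odot> g i)"
    using assms by (intro M.finsum_addf) auto
  finally show ?thesis .
qed

lemma finsum_smult_smult:
  assumes "finite I" "g \<in> I \<rightarrow> carrier V" "\<And>i. i \<in> I \<Longrightarrow> a i \<in> K" "c \<in> K"
  shows "(\<Oplus>i\<in>I. (c * a i) \<odot> g i) = c \<odot> (\<Oplus>i\<in>I. a i \<odot> g i)"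
proof -
  have "c \<odot> (\<Oplus>i\<in>I. a i \<odot> g i) = (\<Oplus>i\<in>I. c \<odot> (a i \<odot> g i))"
    using assms by (intro finsum_smult_ldistr) auto
  also have "\<dots> = (\<Oplus>i\<in>I. (c * a i) \<odot> g i)"
    using assms by (intro M.finsum_cong') (auto simp: smult_smult Pi_def)
  finally show ?thesis by simp
qed

lemma finsum_smult_diff:
  assumes "finite I" "g \<in> I \<rightarrow> carrier V" "\<And>i. i \<in> I \<Longrightarrow> a i \<in> K" "\<And>i. i \<in> I \<Longrightarrow> b i \<in> K"
  shows "(\<Oplus>i\<in>I. a i \<odot> g i) \<ominus> (\<Oplus>i\<in>I. b i \<odot> g i) = (\<Oplus>i\<in>I. (a i - b i) \<odot> g i)"
proof -
  have *: "(\<Oplus>i\<in>I. b i \<odot> g i) \<in> carrier V" using assms by (intro M.finsum_closed) auto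
  have "(\<Oplus>i\<in>I. (a i + (- 1) * b i) \<odot> g i) = (\<Oplus>i\<in>I. a i \<odot> g i) \<oplus> (\<Oplus>i\<in>I. ((- 1) * b i) \<odot> g i)"
    using assms by (intro finsum_smult_add) auto
  also have "(\<Oplus>i\<in>I. ((- 1) * b i) \<odot> g i) = (- 1) \<odot> (\<Oplus>i\<in>I. b i \<odot> g i)"
    using assms by (intro finsum_smult_smult) auto
  finally show ?thesis using * by (simp add: a_minus_def minus_eq_smult)
qed

lemma submodule_span:
  assumes "finite I" "g \<in> I \<rightarrow> carrier V"
  shows "submodule {v. \<exists>c \<in> I \<rightarrow> K. v = (\<Oplus>i\<in>I. c i \<odot> g i)} (scalars K) V"
proof (rule submoduleI')
  show "{v. \<exists>c\<in>I \<rightarrow> K. v = (\<Oplus>i\<in>I. c i \<odot> g i)} \<subseteq> carrier V"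
    using assms by (auto intro!: M.finsum_closed)
  have "(\<Oplus>i\<in>I. (0 * 0) \<odot> g i) = 0 \<odot> (\<Oplus>i\<in>I. 0 \<odot> g i)"
    using assms by (intro finsum_smult_smult) auto
  moreover have "(\<Oplus>i\<in>I. 0 \<odot> g i) \<in> carrier V" using assms by (intro M.finsum_closed) auto
  ultimately have "\<zero> = (\<Oplus>i\<in>I. (\<lambda>_. 0) i \<odot> g i)" by simp
  then show "\<zero> \<in> {v. \<exists>c\<in>I \<rightarrow> K. v = (\<Oplus>i\<in>I. c i \<odot> g i)}"
    by (auto intro!: bexI[of _ "\<lambda>_. 0"])
next
  fix x y assume "x \<in> {v. \<exists>c\<in>I \<rightarrow> K. v = (\<Oplus>i\<in>I. c i \<odot> g i)}"
    "y \<in> {v. \<exists>c\<in>I \<rightarrow> K. v = (\<Oplus>i\<in>I. c i \<odot> g i)}"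
  then obtain a b where "a \<in> I \<rightarrow> K" "b \<in> I \<rightarrow> K"
    "x = (\<Oplus>i\<in>I. a i \<odot> g i)" "y = (\<Oplus>i\<in>I. b i \<odot> g i)" by blast
  then show "x \<oplus> y \<in> {v. \<exists>c\<in>I \<rightarrow> K. v = (\<Oplus>i\<in>I. c i \<odot> g i)}"
    using finsum_smult_add[OF assms, of a b]
    by (intro CollectI bexI[of _ "\<lambda>i. a i + b i"]) (auto simp: Pi_iff)
next
  fix c x assume "c \<in> K" "x \<in> {v. \<exists>c\<in>I \<rightarrow> K. v = (\<Oplus>i\<in>I. c i \<odot> g i)}"
  then obtain a where "a \<in> I \<rightarrow> K" "x = (\<Oplus>i\<in>I. a i \<odot> g i)" by blast
  then show "c \<odot> x \<in> {v. \<exists>c\<in>I \<rightarrow> K. v = (\<Oplus>i\<in>I. c i \<odot> g i)}"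
    using finsum_smult_smult[OF assms, of a c] \<open>c \<in> K\<close>
    by (intro CollectI bexI[of _ "\<lambda>i. c * a i"]) (auto simp: Pi_iff)
qed

lemma finsum_delta:
  assumes "finite I" "g \<in> I \<rightarrow> carrier V" "j \<in> I"
  shows "(\<Oplus>i\<in>I. (if i = j then 1 else 0) \<odot> g i) = g j"
proof -
  have "(\<Oplus>i\<in>I. (if i = j then 1 else 0) \<odot> g i) = (\<Oplus>i\<in>I. if j = i then g i else \<zero>)"
    using assms by (intro M.finsum_cong') (auto simp: Pi_def)
  then show ?thesis using M.finsum_singleton[OF assms(3,1,2)] by simp
qed

text \<open>The family \<open>g\<close> may repeat vectors, whereas \<^const>\<open>fin_dim\<close> sums over a set.\<close>

lemma fin_dimI:
  assumes I: "finite I" "g \<in> I \<rightarrow> carrier V"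
    and span: "\<And>v. v \<in> carrier V \<Longrightarrow> \<exists>c \<in> I \<rightarrow> K. v = (\<Oplus>i\<in>I. c i \<odot> g i)"
  shows "fin_dim K V"
proof -
  let ?L = "{v. \<exists>c \<in> g ` I \<rightarrow> K. v = (\<Oplus>s\<in>g ` I. c s \<odot> s)}"
  have gI: "finite (g ` I)" "(\<lambda>s. s) \<in> g ` I \<rightarrow> carrier V" using I by auto
  have L: "submodule ?L (scalars K) V" by (rule submodule_span[OF gI])
  have "g i \<in> ?L" if "i \<in> I" for i
    using finsum_delta[OF gI, of "g i"] that
    by (auto intro!: bexI[of _ "\<lambda>s. if s = g i then 1 else 0"])
  then have "(\<Oplus>i\<in>I. c i \<odot> g i) \<in> ?L" if "c \<in> I \<rightarrow> K" for c
    using finsum_submodule[OF L I(1), of "\<lambda>i. c i \<odot> g i"] submoduleE(4)[OF L] that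
    by (auto simp: Pi_def)
  then have "v \<in> ?L" if "v \<in> carrier V" for v using span[OF that] by blast
  then show ?thesis unfolding fin_dim_def using gI
    by (intro exI[of _ "g ` I"]) auto
qed

lemma fin_dimE:
  assumes "fin_dim K V"
  obtains k :: nat and e where "\<And>i. i < k \<Longrightarrow> e i \<in> carrier V"
    "\<And>v. v \<in> carrier V \<Longrightarrow> \<exists>c. (\<forall>i. c i \<in> K) \<and> v = (\<Oplus>i\<in>{..<k}. c i \<odot> e i)"
proof -
  obtain S where S: "finite S" "S \<subseteq> carrier V"
    and span: "\<And>v. v \<in> carrier V \<Longrightarrow> \<exists>c \<in> S \<rightarrow> K. v = (\<Oplus>s\<in>S. c s \<odot> s)"
    using assms unfolding fin_dim_def by blast
  obtain h where h: "bij_betw h {0..<card S} S" using ex_bij_betw_nat_finite[OF S(1)] by blast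
  have hS: "h ` {..<card S} = S" "inj_on h {..<card S}"
    using h by (auto simp: bij_betw_def lessThan_atLeast0)
  show thesis
  proof (rule that[of "card S" h])
    show "h i \<in> carrier V" if "i < card S" for i using hS S(2) that by auto
    fix v assume "v \<in> carrier V"
    then obtain c where c: "c \<in> S \<rightarrow> K" "v = (\<Oplus>s\<in>S. c s \<odot> s)" using span by blast
    have "v = (\<Oplus>i\<in>{..<card S}. c (h i) \<odot> h i)"
      using M.finsum_reindex[of "\<lambda>s. c s \<odot> s" h "{..<card S}"] hS c S(2)
      by (auto simp: Pi_def)
    also have "\<dots> = (\<Oplus>i\<in>{..<card S}. (if i < card S then c (h i) else 0) \<odot> h i)"
      using hS c S(2) by (intro M.finsum_cong') (auto simp: Pi_def)
    finally show "\<exists>c. (\<forall>i. c i \<in> K) \<and> v = (\<Oplus>i\<in>{..<card S}. c i \<odot> h i)"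
      using c(1) hS by (intro exI[of _ "\<lambda>i. if i < card S then c (h i) else 0"]) auto
  qed
qed

lemma fin_dim_submoduleI:
  assumes H: "submodule H (scalars K) V" and I: "finite I" "g \<in> I \<rightarrow> H"
    and span: "\<And>v. v \<in> H \<Longrightarrow> \<exists>c \<in> I \<rightarrow> K. v = (\<Oplus>i\<in>I. c i \<odot> g i)"
  shows "fin_dim K (V\<lparr>carrier := H\<rparr>)"
proof -
  interpret H: kspace K "V\<lparr>carrier := H\<rparr>" by (rule kspace_submodule[OF H])
  show ?thesis
  proof (rule H.fin_dimI[OF I(1)])
    show "g \<in> I \<rightarrow> carrier (V\<lparr>carrier := H\<rparr>)" using I(2) by simp
    fix v assume "v \<in> carrier (V\<lparr>carrier := H\<rparr>)"
    then obtain c where c: "c \<in> I \<rightarrow> K" "v = (\<Oplus>i\<in>I. c i \<odot> g i)" using span by auto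
    have "(\<lambda>i. c i \<odot> g i) \<in> I \<rightarrow> H" using c I(2) submoduleE(4)[OF H] by (auto simp: Pi_def)
    from finsum_submodule[OF H I(1) this] c
    show "\<exists>c\<in>I \<rightarrow> K. v = finsum (V\<lparr>carrier := H\<rparr>) (\<lambda>i. c i \<odot>\<^bsub>V\<lparr>carrier := H\<rparr>\<^esub> g i) I"
      by (intro bexI[of _ c]) auto
  qed
qed

lemma fin_dim_submoduleE:
  assumes H: "submodule H (scalars K) V" and "fin_dim K (V\<lparr>carrier := H\<rparr>)"
  obtains k :: nat and e where "\<And>i. i < k \<Longrightarrow> e i \<in> H"
    "\<And>v. v \<in> H \<Longrightarrow> \<exists>c. (\<forall>i. c i \<in> K) \<and> v = (\<Oplus>i\<in>{..<k}. c i \<odot> e i)"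
proof -
  interpret H: kspace K "V\<lparr>carrier := H\<rparr>" by (rule kspace_submodule[OF H])
  obtain k :: nat and e where e: "\<And>i. i < k \<Longrightarrow> e i \<in> carrier (V\<lparr>carrier := H\<rparr>)"
    and span: "\<And>v. v \<in> carrier (V\<lparr>carrier := H\<rparr>) \<Longrightarrow> \<exists>c. (\<forall>i. c i \<in> K) \<and>
      v = finsum (V\<lparr>carrier := H\<rparr>) (\<lambda>i. c i \<odot>\<^bsub>V\<lparr>carrier := H\<rparr>\<^esub> e i) {..<k}"
    using H.fin_dimE[OF assms(2)] by blast
  show thesis
  proof (rule that[of k e])
    show "e i \<in> H" if "i < k" for i using e that by simp
    fix v assume "v \<in> H"
    then obtain c where c: "\<forall>i. c i \<in> K"
      "v = finsum (V\<lparr>carrier := H\<rparr>) (\<lambda>i. c i \<odot> e i) {..<k}" using span[of v] by auto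
    have "(\<lambda>i. c i \<odot> e i) \<in> {..<k} \<rightarrow> H" using c e submoduleE(4)[OF H] by (auto simp: Pi_def)
    from finsum_submodule[OF H _ this] c
    show "\<exists>c. (\<forall>i. c i \<in> K) \<and> v = (\<Oplus>i\<in>{..<k}. c i \<odot> e i)" by auto
  qed
qed

lemma coord_space_image:
  fixes k :: nat and \<rho> :: "nat \<Rightarrow> 'a \<Rightarrow> complex"
  assumes H: "submodule H (scalars K) V" and \<rho>: "\<forall>i<k. \<rho> i \<in> linear_maps K V (scalars K)"
  shows "coord_space K ((\<lambda>x i. if i < k then \<rho> i x else 0) ` H)" (is "coord_space K (?r ` H)")
  unfolding coord_space_def
proof (intro conjI ballI allI)
  note lin = linear_functionalD[OF \<rho>[rule_format]] and sub = submoduleE[OF H]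
  have HV: "x \<in> carrier V" if "x \<in> H" for x using sub(1) that by blast
  show "w i \<in> K" if "w \<in> ?r ` H" for w i using that lin(1) HV by auto
  show "(\<lambda>i. 0) \<in> ?r ` H"
    using functional_zero[OF \<rho>[rule_format]] zero_in_submodule[OF H]
    by (intro image_eqI[of _ _ \<zero>]) auto
  show "(\<lambda>i. w i + z i) \<in> ?r ` H" if "w \<in> ?r ` H" "z \<in> ?r ` H" for w z
  proof -
    from that obtain x y where "x \<in> H" "y \<in> H" "w = ?r x" "z = ?r y" by blast
    then show ?thesis using sub(5) by (intro image_eqI[of _ _ "x \<oplus> y"]) (auto simp: lin HV)
  qed
  show "(\<lambda>i. c * w i) \<in> ?r ` H" if c: "c \<in> K" and "w \<in> ?r ` H" for c w
  proof -
    from that obtain x where "x \<in> H" "w = ?r x" by blast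
    then show ?thesis using c sub(4)[of c x]
      by (intro image_eqI[of _ _ "c \<odot> x"]) (auto simp: lin HV)
  qed
qed

text \<open>The separating functionals embed \<open>V\<close> into coordinate space; preimages
  \<open>g s\<close> of a spanning set of the image, with the matrix of that set, give the formula.
  It recovers \<open>x\<close> from the numbers \<open>\<rho> j x\<close> by means of finitely many
  constants.\<close>

lemma functional_coordinates:
  fixes k :: nat and \<rho> :: "nat \<Rightarrow> 'a \<Rightarrow> complex"
  assumes \<rho>': "\<forall>i<k. \<rho> i \<in> linear_maps K V (scalars K)"
    and inj': "\<forall>x \<in> carrier V. (\<forall>i<k. \<rho> i x = 0) \<longrightarrow> x = \<zero>"
  obtains I :: "(nat \<Rightarrow> complex) set" and g \<gamma> where "finite I" "g \<in> I \<rightarrow> carrier V"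
    "\<And>s j. \<gamma> s j \<in> K"
    "\<And>x. x \<in> carrier V \<Longrightarrow> x = (\<Oplus>s\<in>I. (\<Sum>j<k. \<gamma> s j * \<rho> j x) \<odot> g s)"
proof -
  note \<rho> = \<rho>'[rule_format]
  define r where "r x = (\<lambda>i. if i < k then \<rho> i x else 0)" for x
  note lin = linear_functionalD[OF \<rho>]
  have "coord_space K (r ` carrier V)"
    unfolding r_def by (rule coord_space_image[OF carrier_is_submodule \<rho>'])
  from coord_spanning[OF this, of k] obtain I \<gamma> where I: "finite I" "I \<subseteq> r ` carrier V"
    and \<gamma>: "\<forall>s j. \<gamma> s j \<in> K"
    and rep: "\<forall>w \<in> r ` carrier V. \<forall>i<k. w i = (\<Sum>s\<in>I. (\<Sum>j<k. \<gamma> s j * w j) * s i)"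
    by (elim exE conjE)
  define g where "g = inv_into (carrier V) r"
  have g: "g s \<in> carrier V" "r (g s) = s" if "s \<in> I" for s
    using that I(2) by (auto simp: g_def inv_into_into f_inv_into_f)
  show thesis
  proof (rule that[of I g \<gamma>])
    fix x assume x: "x \<in> carrier V"
    define c where "c s = (\<Sum>j<k. \<gamma> s j * \<rho> j x)" for s
    define y where "y = (\<Oplus>s\<in>I. c s \<odot> g s)"
    have c: "c s \<in> K" for s using \<gamma> lin(1) x by (auto simp: c_def)
    have cg: "(\<lambda>s. c s \<odot> g s) \<in> I \<rightarrow> carrier V" using c g by auto
    then have y: "y \<in> carrier V" unfolding y_def by (rule M.finsum_closed)
    have "\<rho> i x = \<rho> i y" if i: "i < k" for i
    proof -
      have s: "\<rho> i (g s) = s i" if "s \<in> I" for s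
        using fun_cong[OF g(2)[OF that], of i] i by (simp add: r_def)
      have "\<rho> i y = (\<Sum>s\<in>I. \<rho> i (c s \<odot> g s))"
        unfolding y_def by (rule functional_finsum[OF \<rho>[OF i] I(1) cg])
      also have "\<dots> = (\<Sum>s\<in>I. c s * s i)" using lin(3)[OF i] c g(1) s by simp
      also have "\<dots> = r x i"
        using rep[rule_format, of "r x" i] x i by (simp add: c_def r_def)
      finally show ?thesis using i by (simp add: r_def)
    qed
    then have "x \<ominus> y = \<zero>" using x y inj' by (simp add: functional_minus[OF \<rho>])
    then show "x = (\<Oplus>s\<in>I. (\<Sum>j<k. \<gamma> s j * \<rho> j x) \<odot> g s)"
      using x y by (simp add: minus_eq_zero_iff y_def c_def)
  qed (use I(1) g(1) \<gamma> in auto)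
qed

lemma fin_dim_functionals:
  fixes k :: nat and \<rho> :: "nat \<Rightarrow> 'a \<Rightarrow> complex"
  assumes \<rho>': "\<forall>i<k. \<rho> i \<in> linear_maps K V (scalars K)"
    and inj': "\<forall>x \<in> carrier V. (\<forall>i<k. \<rho> i x = 0) \<longrightarrow> x = \<zero>"
  shows "fin_dim K V"
proof -
  note \<rho> = \<rho>'[rule_format]
  obtain I :: "(nat \<Rightarrow> complex) set" and g \<gamma> where I: "finite I" "g \<in> I \<rightarrow> carrier V"
    "\<And>s j. \<gamma> s j \<in> K"
    "\<And>x. x \<in> carrier V \<Longrightarrow> x = (\<Oplus>s\<in>I. (\<Sum>j<k. \<gamma> s j * \<rho> j x) \<odot> g s)"
    by (rule functional_coordinates[OF \<rho>' inj']) (rule that)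
  show ?thesis
  proof (rule fin_dimI[OF I(1,2)])
    fix v assume v: "v \<in> carrier V"
    have "(\<lambda>s. \<Sum>j<k. \<gamma> s j * \<rho> j v) \<in> I \<rightarrow> K"
      using I(3) linear_functionalD(1)[OF \<rho>] v by auto
    then show "\<exists>c\<in>I \<rightarrow> K. v = (\<Oplus>s\<in>I. c s \<odot> g s)" by (rule bexI[rotated]) (rule I(4)[OF v])
  qed
qed

end

section \<open>Normed spaces\<close>

locale nspace = scalar_field K + normed_space K V
  for K :: "complex set" and V :: "(complex, 'a) normed_module" (structure)

sublocale nspace \<subseteq> kspace ..

context nspace
begin

lemma norm_zero [simp]: "\<parallel>\<zero>\<parallel> = 0"
  using mnorm_eq_zero_iff by simp

lemma norm_uminus [simp]: "x \<in> carrier V \<Longrightarrow> \<parallel>\<ominus> x\<parallel> = \<parallel>x\<parallel>"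
  using mnorm_smult[of "- 1" x] by (simp add: minus_eq_smult)

lemma norm_nonneg [simp]: "x \<in> carrier V \<Longrightarrow> 0 \<le> \<parallel>x\<parallel>"
  using mnorm_triangle[of x "\<ominus> x"] by (simp add: M.r_neg)

lemma norm_minus_commute: "\<lbrakk>x \<in> carrier V; y \<in> carrier V\<rbrakk> \<Longrightarrow> \<parallel>x \<ominus> y\<parallel> = \<parallel>y \<ominus> x\<parallel>"
  using norm_uminus[of "x \<ominus> y"] by (simp add: a_minus_def M.minus_add M.a_comm)

lemma norm_triangle_minus:
  assumes "x \<in> carrier V" "y \<in> carrier V" "z \<in> carrier V"
  shows "\<parallel>x \<ominus> z\<parallel> \<le> \<parallel>x \<ominus> y\<parallel> + \<parallel>y \<ominus> z\<parallel>"
proof -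
  have "x \<ominus> z = (x \<ominus> y) \<oplus> (y \<ominus> z)"
    using assms by (simp add: a_minus_def M.a_ac M.r_neg2)
  then show ?thesis using mnorm_triangle[of "x \<ominus> y" "y \<ominus> z"] assms by simp
qed

lemma functional_vanishes:
  assumes f: "f \<in> linear_maps K V (scalars K)" "\<And>v. v \<in> carrier V \<Longrightarrow> cmod (f v) \<le> M * \<parallel>v\<parallel>"
    and U: "U \<subseteq> carrier V" "\<And>y. y \<in> U \<Longrightarrow> f y = 0"
    and x: "x \<in> carrier V" "\<And>\<epsilon>. 0 < \<epsilon> \<Longrightarrow> \<exists>y \<in> U. \<parallel>x \<ominus> y\<parallel> < \<epsilon>"
  shows "f x = 0"
proof -
  have "cmod (f x) \<le> 0 + \<epsilon>" if "0 < \<epsilon>" for \<epsilon>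
  proof -
    \<comment> \<open>\<open>M\<close> may be zero or negative; \<open>\<bar>M\<bar> + 1\<close> is
      a positive constant that dominates it.\<close>
    have "0 < \<epsilon> / (\<bar>M\<bar> + 1)" using that by simp
    then obtain y where y: "y \<in> U" "\<parallel>x \<ominus> y\<parallel> < \<epsilon> / (\<bar>M\<bar> + 1)" using x(2) by blast
    have xy: "y \<in> carrier V" "x \<ominus> y \<in> carrier V" using y U x by auto
    have "cmod (f x) = cmod (f (x \<ominus> y))" using functional_minus[OF f(1) x(1) xy(1)] U(2)[OF y(1)] by simp
    also have "\<dots> \<le> M * \<parallel>x \<ominus> y\<parallel>" by (rule f(2)[OF xy(2)])
    also have "\<dots> \<le> (\<bar>M\<bar> + 1) * (\<epsilon> / (\<bar>M\<bar> + 1))" using y xy by (intro mult_mono) auto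
    finally show ?thesis by simp
  qed
  then have "cmod (f x) \<le> 0" by (rule field_le_epsilon)
  then show ?thesis by simp
qed

lemma norm_finsum:
  assumes "finite I" "g \<in> I \<rightarrow> carrier V"
  shows "\<parallel>\<Oplus>i\<in>I. g i\<parallel> \<le> (\<Sum>i\<in>I. \<parallel>g i\<parallel>)"
  using assms
proof (induction I)
  case (insert i I)
  then have "g \<in> I \<rightarrow> carrier V" "g i \<in> carrier V" by auto
  then show ?case using insert mnorm_triangle[of "g i" "finsum V g I"] by simp
qed simp

text \<open>For a subspace \<open>U\<close> this is the seminorm of the quotient by
  \<open>U\<close>. It serves twice: as the norm of the quotient algebras, and as the dominating
  seminorm when a point is separated from a subspace.\<close>

definition setdist_from :: "'a set \<Rightarrow> 'a \<Rightarrow> real" where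
  "setdist_from U x = (INF y\<in>U. \<parallel>x \<ominus> y\<parallel>)"

lemma setdist_le:
  assumes "submodule U (scalars K) V" "z \<in> carrier V" "y \<in> U"
  shows "setdist_from U z \<le> \<parallel>z \<ominus> y\<parallel>"
  unfolding setdist_from_def using assms submoduleE(1)[OF assms(1)]
  by (intro cINF_lower bdd_belowI2[where m = 0]) auto

lemma setdist_ge:
  assumes "submodule U (scalars K) V" "\<And>y. y \<in> U \<Longrightarrow> m \<le> \<parallel>z \<ominus> y\<parallel>"
  shows "m \<le> setdist_from U z"
  unfolding setdist_from_def using assms submoduleE(2)[OF assms(1)] by (intro cINF_greatest) auto

lemma setdist_add:
  assumes U: "submodule U (scalars K) V" and z: "z \<in> carrier V" and w: "w \<in> carrier V"
  shows "setdist_from U (z \<oplus> w) \<le> setdist_from U z + setdist_from U w"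
proof -
  let ?p = "setdist_from U"
  have UV: "y \<in> carrier V" if "y \<in> U" for y using submoduleE(1)[OF U] that by blast
  have *: "?p (z \<oplus> w) \<le> \<parallel>z \<ominus> y\<parallel> + \<parallel>w \<ominus> y'\<parallel>" if y: "y \<in> U" "y' \<in> U" for y y'
  proof -
    have "(z \<oplus> w) \<ominus> (y \<oplus> y') = (z \<ominus> y) \<oplus> (w \<ominus> y')"
      using z w y UV by (simp add: a_minus_def M.minus_add M.a_ac)
    then show ?thesis
      using setdist_le[OF U, of "z \<oplus> w" "y \<oplus> y'"] mnorm_triangle[of "z \<ominus> y" "w \<ominus> y'"]
        z w y UV submoduleE(5)[OF U y] by simp
  qed
  have "?p (z \<oplus> w) - \<parallel>z \<ominus> y\<parallel> \<le> ?p w" if "y \<in> U" for y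
    by (rule setdist_ge[OF U]) (use *[OF that] in \<open>simp add: algebra_simps\<close>)
  then have "?p (z \<oplus> w) - ?p w \<le> ?p z" by (intro setdist_ge[OF U]) (simp add: algebra_simps)
  then show ?thesis by simp
qed

text \<open>One inequality comes from scaling the approximants by \<open>c\<close>, the other from
  applying the first to \<open>1 / c\<close>.\<close>

lemma setdist_smult:
  assumes U: "submodule U (scalars K) V" and c: "c \<in> K" and z: "z \<in> carrier V"
  shows "setdist_from U (c \<odot> z) = cmod c * setdist_from U z"
proof -
  let ?p = "setdist_from U"
  have UV: "y \<in> carrier V" if "y \<in> U" for y using submoduleE(1)[OF U] that by blast
  have le: "?p (c \<odot> z) \<le> cmod c * ?p z" if c: "c \<in> K" "c \<noteq> 0" and z: "z \<in> carrier V" for c z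
  proof -
    have "?p (c \<odot> z) / cmod c \<le> ?p z"
    proof (rule setdist_ge[OF U])
      fix y assume y: "y \<in> U"
      have "c \<odot> z \<ominus> c \<odot> y = c \<odot> (z \<ominus> y)"
        using c z UV[OF y] by (simp add: a_minus_def smult_add_right minus_eq_smult smult_smult)
      then have "?p (c \<odot> z) \<le> cmod c * \<parallel>z \<ominus> y\<parallel>"
        using setdist_le[OF U, of "c \<odot> z" "c \<odot> y"] c z UV[OF y] submoduleE(4)[OF U, of c y] y
        by (simp add: mnorm_smult)
      then show "?p (c \<odot> z) / cmod c \<le> \<parallel>z \<ominus> y\<parallel>" using c by (simp add: field_simps)
    qed
    then show ?thesis using c by (simp add: field_simps)
  qed
  show ?thesis
  proof (cases "c = 0")
    case True
    have "?p \<zero> \<le> 0" using setdist_le[OF U _ zero_in_submodule[OF U], of \<zero>] by (simp add: a_minus_def M.r_neg)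
    moreover have "0 \<le> ?p \<zero>" by (rule setdist_ge[OF U]) (use UV in auto)
    ultimately show ?thesis using True z by simp
  next
    case False
    have "?p ((1 / c) \<odot> (c \<odot> z)) \<le> cmod (1 / c) * ?p (c \<odot> z)"
      using False c z by (intro le) auto
    then have "cmod c * ?p z \<le> ?p (c \<odot> z)"
      using False c z by (simp add: smult_smult norm_divide field_simps)
    then show ?thesis using le[OF c False z] by simp
  qed
qed

lemma ndist_eq: "\<lbrakk>x \<in> carrier V; y \<in> carrier V\<rbrakk> \<Longrightarrow> ndist V x y = \<parallel>x \<ominus> y\<parallel>"
  by (simp add: ndist_def)

lemma Metric_space_ndist: "Metric_space (carrier V) (ndist V)"
proof
  show "0 \<le> ndist V x y" for x y by (simp add: ndist_def)
  show "ndist V x y = ndist V y x" for x y by (simp add: ndist_def norm_minus_commute)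
  show "ndist V x y = 0 \<longleftrightarrow> x = y" if "x \<in> carrier V" "y \<in> carrier V" for x y
    using that by (simp add: ndist_eq mnorm_eq_zero_iff minus_eq_zero_iff)
  show "ndist V x z \<le> ndist V x y + ndist V y z"
    if "x \<in> carrier V" "y \<in> carrier V" "z \<in> carrier V" for x y z
    using that norm_triangle_minus by (simp add: ndist_eq)
qed

lemma banach_spaceI:
  assumes "\<And>x :: nat \<Rightarrow> 'a. \<lbrakk>\<And>n. x n \<in> carrier V; \<And>\<epsilon>. 0 < \<epsilon> \<Longrightarrow> \<exists>N. \<forall>m\<ge>N. \<forall>n\<ge>N. \<parallel>x m \<ominus> x n\<parallel> < \<epsilon>\<rbrakk>
    \<Longrightarrow> \<exists>l \<in> carrier V. \<forall>\<epsilon>>0. \<exists>N. \<forall>n\<ge>N. \<parallel>x n \<ominus> l\<parallel> < \<epsilon>"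
  shows "banach_space K V"
proof -
  interpret Metric_space "carrier V" "ndist V" by (rule Metric_space_ndist)
  have "mcomplete"
    unfolding mcomplete_def
  proof (intro allI impI)
    fix x assume x: "MCauchy x"
    then have xV: "x n \<in> carrier V" for n unfolding MCauchy_def by auto
    have "\<exists>N. \<forall>m\<ge>N. \<forall>n\<ge>N. \<parallel>x m \<ominus> x n\<parallel> < \<epsilon>" if \<epsilon>: "0 < \<epsilon>" for \<epsilon>
    proof -
      obtain N where N: "\<forall>m n. N \<le> m \<longrightarrow> N \<le> n \<longrightarrow> ndist V (x m) (x n) < \<epsilon>"
        using x[unfolded MCauchy_def, THEN conjunct2, THEN spec, THEN mp, OF \<epsilon>] by (rule exE)
      show ?thesis
      proof (intro exI[of _ N] allI impI)
        fix m n assume "N \<le> m" "N \<le> n"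
        then show "\<parallel>x m \<ominus> x n\<parallel> < \<epsilon>" using N xV ndist_eq by metis
      qed
    qed
    from assms[OF xV this] obtain l where l: "l \<in> carrier V"
      "\<forall>\<epsilon>>0. \<exists>N. \<forall>n\<ge>N. \<parallel>x n \<ominus> l\<parallel> < \<epsilon>" by blast
    have "limitin mtopology x l sequentially"
      unfolding limit_metric_sequentially
    proof (intro conjI allI impI)
      fix \<epsilon> :: real assume "0 < \<epsilon>"
      then obtain N where "\<forall>n\<ge>N. \<parallel>x n \<ominus> l\<parallel> < \<epsilon>" using l by blast
      then show "\<exists>N. \<forall>n\<ge>N. x n \<in> carrier V \<and> ndist V (x n) l < \<epsilon>"
        using xV l ndist_eq by auto
    qed (rule l)
    then show "\<exists>l. limitin mtopology x l sequentially" by blast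
  qed
  then show ?thesis by (intro banach_space.intro normed_space_axioms banach_space_axioms.intro)
qed

lemma closure_eq_carrier_iff:
  assumes "S \<subseteq> carrier V"
  shows "norm_topology V closure_of S = carrier V \<longleftrightarrow>
    (\<forall>x \<in> carrier V. \<forall>\<epsilon>>0. \<exists>y \<in> S. \<parallel>x \<ominus> y\<parallel> < \<epsilon>)"
proof -
  interpret Metric_space "carrier V" "ndist V" by (rule Metric_space_ndist)
  have "mtopology closure_of S = carrier V \<longleftrightarrow> carrier V \<subseteq> mtopology closure_of S"
    using closure_of_subset_topspace[of mtopology S] by auto
  also have "\<dots> \<longleftrightarrow> (\<forall>x \<in> carrier V. \<forall>\<epsilon>>0. \<exists>y \<in> S. y \<in> mball x \<epsilon>)"
    unfolding metric_closure_of by blast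
  also have "\<dots> \<longleftrightarrow> (\<forall>x \<in> carrier V. \<forall>\<epsilon>>0. \<exists>y \<in> S. \<parallel>x \<ominus> y\<parallel> < \<epsilon>)"
    using assms by (auto simp: ndist_eq subset_iff)
  finally show ?thesis .
qed

lemma nspace_submodule:
  assumes H: "submodule H (scalars K) V"
  shows "nspace K (V\<lparr>carrier := H\<rparr>)"
proof -
  interpret H: kspace K "V\<lparr>carrier := H\<rparr>" by (rule kspace_submodule[OF H])
  have "H \<subseteq> carrier V" using submoduleE(1)[OF H] .
  then show ?thesis
    by unfold_locales (auto simp: mnorm_eq_zero_iff mnorm_triangle mnorm_smult subset_iff)
qed

text \<open>The numbers \<open>r j\<close> need not be the values of functionals at a vector: the
  bound is also applied to differences between such values and their limits.\<close>

lemma norm_functionals_bound: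
  fixes k :: nat
  assumes I: "finite I" "g \<in> I \<rightarrow> carrier V" and "\<And>s j. \<gamma> s j \<in> K" "\<And>j. j < k \<Longrightarrow> r j \<in> K"
  shows "\<parallel>\<Oplus>s\<in>I. (\<Sum>j<k. \<gamma> s j * r j) \<odot> g s\<parallel> \<le>
    (\<Sum>s\<in>I. \<Sum>j<k. cmod (\<gamma> s j) * \<parallel>g s\<parallel>) * (\<Sum>j<k. cmod (r j))"
proof -
  have gV: "g s \<in> carrier V" if "s \<in> I" for s using that I(2) by auto
  have "\<parallel>\<Oplus>s\<in>I. (\<Sum>j<k. \<gamma> s j * r j) \<odot> g s\<parallel> \<le> (\<Sum>s\<in>I. \<parallel>(\<Sum>j<k. \<gamma> s j * r j) \<odot> g s\<parallel>)"
    using assms gV by (intro norm_finsum) (auto intro!: smult_in sum_closed)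
  also have "\<dots> = (\<Sum>s\<in>I. cmod (\<Sum>j<k. \<gamma> s j * r j) * \<parallel>g s\<parallel>)"
    using assms gV by (intro sum.cong refl mnorm_smult sum_closed) auto
  also have "\<dots> \<le> (\<Sum>s\<in>I. (\<Sum>j<k. cmod (\<gamma> s j) * \<parallel>g s\<parallel>) * (\<Sum>j<k. cmod (r j)))"
  proof (rule sum_mono)
    fix s assume s: "s \<in> I"
    have "cmod (\<Sum>j<k. \<gamma> s j * r j) \<le> (\<Sum>j<k. cmod (\<gamma> s j) * cmod (r j))"
      by (rule order_trans[OF norm_sum]) (simp add: norm_mult)
    also have "\<dots> \<le> (\<Sum>j<k. cmod (\<gamma> s j) * (\<Sum>j<k. cmod (r j)))"
      by (intro sum_mono mult_left_mono member_le_sum) auto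
    finally have "cmod (\<Sum>j<k. \<gamma> s j * r j) * \<parallel>g s\<parallel>
        \<le> (\<Sum>j<k. cmod (\<gamma> s j) * (\<Sum>j<k. cmod (r j))) * \<parallel>g s\<parallel>"
      using gV[OF s] by (intro mult_right_mono) auto
    also have "\<dots> = (\<Sum>j<k. cmod (\<gamma> s j) * \<parallel>g s\<parallel>) * (\<Sum>j<k. cmod (r j))"
      by (simp add: mult_ac flip: sum_distrib_left sum_distrib_right)
    finally show "cmod (\<Sum>j<k. \<gamma> s j * r j) * \<parallel>g s\<parallel>
        \<le> (\<Sum>j<k. cmod (\<gamma> s j) * \<parallel>g s\<parallel>) * (\<Sum>j<k. cmod (r j))" .
  qed
  finally show ?thesis by (simp add: sum_distrib_right)
qed

text \<open>One half of the equivalence of norms in finite dimension, with an explicit constant from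
  the reproducing formula instead of a compactness argument.\<close>

lemma functionals_norm_bound:
  fixes k :: nat and \<rho> :: "nat \<Rightarrow> 'a \<Rightarrow> complex"
  assumes \<rho>': "\<forall>i<k. \<rho> i \<in> linear_maps K V (scalars K)"
    and inj': "\<forall>x \<in> carrier V. (\<forall>i<k. \<rho> i x = 0) \<longrightarrow> x = \<zero>"
  obtains C where "0 \<le> C" "\<And>x. x \<in> carrier V \<Longrightarrow> \<parallel>x\<parallel> \<le> C * (\<Sum>i<k. cmod (\<rho> i x))"
proof -
  note \<rho> = \<rho>'[rule_format]
  obtain I :: "(nat \<Rightarrow> complex) set" and g \<gamma> where I: "finite I" "g \<in> I \<rightarrow> carrier V"
    and \<gamma>: "\<And>s j. \<gamma> s j \<in> K"
    and rep: "\<And>x. x \<in> carrier V \<Longrightarrow> x = (\<Oplus>s\<in>I. (\<Sum>j<k. \<gamma> s j * \<rho> j x) \<odot> g s)"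
    by (rule functional_coordinates[OF \<rho>' inj']) (rule that)
  show thesis
  proof (rule that[of "\<Sum>s\<in>I. \<Sum>j<k. cmod (\<gamma> s j) * \<parallel>g s\<parallel>"])
    show "0 \<le> (\<Sum>s\<in>I. \<Sum>j<k. cmod (\<gamma> s j) * \<parallel>g s\<parallel>)"
      using I by (intro sum_nonneg mult_nonneg_nonneg) (auto simp: Pi_iff)
    show "\<parallel>x\<parallel> \<le> (\<Sum>s\<in>I. \<Sum>j<k. cmod (\<gamma> s j) * \<parallel>g s\<parallel>) * (\<Sum>i<k. cmod (\<rho> i x))"
      if "x \<in> carrier V" for x
      using norm_functionals_bound[OF I, of \<gamma> k "\<lambda>j. \<rho> j x"] rep[OF that] \<gamma>
        linear_functionalD(1)[OF \<rho>] that by simp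
  qed
qed

text \<open>Bounded functionals map a Cauchy sequence to convergent sequences of scalars, and the
  reproducing formula assembles a limit vector from their limits.\<close>

lemma banach_functionals:
  fixes k :: nat and \<rho> :: "nat \<Rightarrow> 'a \<Rightarrow> complex"
  assumes \<rho>': "\<forall>i<k. \<rho> i \<in> linear_maps K V (scalars K)"
    and inj': "\<forall>x \<in> carrier V. (\<forall>i<k. \<rho> i x = 0) \<longrightarrow> x = \<zero>"
    and bdd: "\<And>i x. \<lbrakk>i < k; x \<in> carrier V\<rbrakk> \<Longrightarrow> cmod (\<rho> i x) \<le> M i * \<parallel>x\<parallel>"
  shows "banach_space K V"
proof (rule banach_spaceI)
  note \<rho> = \<rho>'[rule_format]
  fix x :: "nat \<Rightarrow> 'a" assume x: "\<And>n. x n \<in> carrier V"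
    and cauchy: "\<And>\<epsilon>. 0 < \<epsilon> \<Longrightarrow> \<exists>N. \<forall>m\<ge>N. \<forall>n\<ge>N. \<parallel>x m \<ominus> x n\<parallel> < \<epsilon>"
  obtain I :: "(nat \<Rightarrow> complex) set" and g \<gamma> where I: "finite I" "g \<in> I \<rightarrow> carrier V"
    and \<gamma>: "\<And>s j. \<gamma> s j \<in> K"
    and rep: "\<And>x. x \<in> carrier V \<Longrightarrow> x = (\<Oplus>s\<in>I. (\<Sum>j<k. \<gamma> s j * \<rho> j x) \<odot> g s)"
    by (rule functional_coordinates[OF \<rho>' inj']) (rule that)
  have "\<exists>r. (\<lambda>n. \<rho> i (x n)) \<longlonglongrightarrow> r" if i: "i < k" for i
  proof -
    have "Cauchy (\<lambda>n. \<rho> i (x n))"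
    proof (rule CauchyI)
      fix e :: real assume e: "0 < e"
      define \<epsilon> where "\<epsilon> = e / (\<bar>M i\<bar> + 1)"
      have "0 < \<epsilon>" using e by (simp add: \<epsilon>_def)
      then obtain N where N: "\<forall>m\<ge>N. \<forall>n\<ge>N. \<parallel>x m \<ominus> x n\<parallel> < \<epsilon>" using cauchy by blast
      show "\<exists>N. \<forall>m\<ge>N. \<forall>n\<ge>N. norm (\<rho> i (x m) - \<rho> i (x n)) < e"
      proof (intro exI[of _ N] allI impI)
        fix m n assume "N \<le> m" "N \<le> n"
        then have "\<parallel>x m \<ominus> x n\<parallel> < \<epsilon>" using N by blast
        have "cmod (\<rho> i (x m) - \<rho> i (x n)) = cmod (\<rho> i (x m \<ominus> x n))"
          using functional_minus[OF \<rho>[OF i] x x] by simp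
        also have "\<dots> \<le> M i * \<parallel>x m \<ominus> x n\<parallel>" by (rule bdd[OF i]) (use x in auto)
        also have "\<dots> \<le> (\<bar>M i\<bar> + 1) * \<parallel>x m \<ominus> x n\<parallel>"
          using x by (intro mult_right_mono) auto
        also have "\<dots> < (\<bar>M i\<bar> + 1) * \<epsilon>"
          using \<open>\<parallel>x m \<ominus> x n\<parallel> < \<epsilon>\<close> by (intro mult_strict_left_mono) auto
        also have "\<dots> = e" by (simp add: \<epsilon>_def)
        finally show "norm (\<rho> i (x m) - \<rho> i (x n)) < e" .
      qed
    qed
    then show ?thesis by (simp add: Cauchy_convergent_iff convergent_def)
  qed
  then obtain r where r: "\<And>i. i < k \<Longrightarrow> (\<lambda>n. \<rho> i (x n)) \<longlonglongrightarrow> r i" by metis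
  have rK: "r i \<in> K" if "i < k" for i
    using lim_closed[OF _ r[OF that]] linear_functionalD(1)[OF \<rho>[OF that]] x by blast
  \<comment> \<open>The formula evaluated at the limiting coordinates. Subtracting it from the
    formula for \<open>x n\<close> leaves coefficients that tend to 0.\<close>
  define l where "l = (\<Oplus>s\<in>I. (\<Sum>j<k. \<gamma> s j * r j) \<odot> g s)"
  define C where "C = (\<Sum>s\<in>I. \<Sum>j<k. cmod (\<gamma> s j) * \<parallel>g s\<parallel>)"
  have l: "l \<in> carrier V" unfolding l_def using I rK \<gamma>
    by (intro M.finsum_closed) (auto intro!: smult_in sum_closed)
  have bound: "\<parallel>x n \<ominus> l\<parallel> \<le> C * (\<Sum>j<k. cmod (\<rho> j (x n) - r j))" for n
  proof -
    have \<rho>K: "\<rho> j (x n) \<in> K" if "j < k" for j using linear_functionalD(1)[OF \<rho>[OF that] x] .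
    have "x n \<ominus> l = (\<Oplus>s\<in>I. (\<Sum>j<k. \<gamma> s j * \<rho> j (x n)) \<odot> g s) \<ominus> l"
      by (rule arg_cong[OF rep[OF x], where f = "\<lambda>v. v \<ominus> l"])
    also have "\<dots> = (\<Oplus>s\<in>I. ((\<Sum>j<k. \<gamma> s j * \<rho> j (x n)) - (\<Sum>j<k. \<gamma> s j * r j)) \<odot> g s)"
      unfolding l_def by (rule finsum_smult_diff) (use I rK \<rho>K \<gamma> in auto)
    also have "\<dots> = (\<Oplus>s\<in>I. (\<Sum>j<k. \<gamma> s j * (\<rho> j (x n) - r j)) \<odot> g s)"
      by (simp add: algebra_simps sum_subtractf)
    finally show ?thesis
      using norm_functionals_bound[OF I, of \<gamma> k "\<lambda>j. \<rho> j (x n) - r j"] \<gamma> rK \<rho>K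
      by (simp add: C_def)
  qed
  have "(\<lambda>n. C * (\<Sum>j<k. cmod (\<rho> j (x n) - r j))) \<longlonglongrightarrow> C * (\<Sum>j<k. cmod (r j - r j))"
    by (intro tendsto_intros r) auto
  then have lim: "(\<lambda>n. C * (\<Sum>j<k. cmod (\<rho> j (x n) - r j))) \<longlonglongrightarrow> 0" by simp
  show "\<exists>l \<in> carrier V. \<forall>\<epsilon>>0. \<exists>N. \<forall>n\<ge>N. \<parallel>x n \<ominus> l\<parallel> < \<epsilon>"
  proof (intro bexI[of _ l] allI impI)
    fix \<epsilon> :: real assume "0 < \<epsilon>"
    from order_tendstoD(2)[OF lim this] obtain N
      where "\<forall>n\<ge>N. C * (\<Sum>j<k. cmod (\<rho> j (x n) - r j)) < \<epsilon>"
      by (auto simp: eventually_sequentially)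
    then show "\<exists>N. \<forall>n\<ge>N. \<parallel>x n \<ominus> l\<parallel> < \<epsilon>" using bound by (meson le_less_trans)
  qed (rule l)
qed

end

section \<open>Dual spaces and preduals\<close>

lemma dual_space_simps [simp]:
  "zero (dual_space K V) = (\<lambda>x \<in> carrier V. 0)"
  "add (dual_space K V) = (\<lambda>f g. \<lambda>x \<in> carrier V. f x + g x)"
  "smult (dual_space K V) = (\<lambda>c f. \<lambda>x \<in> carrier V. c * f x)"
  by (simp_all add: dual_space_def)

context nspace
begin

lemma dual_norm_bound:
  assumes f: "f \<in> carrier (dual_space K V)" and x: "x \<in> carrier V"
  shows "cmod (f x) \<le> \<parallel>f\<parallel>\<^bsub>dual_space K V\<^esub> * \<parallel>x\<parallel>"
proof (cases "x = \<zero>")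
  case True
  then show ?thesis using functional_zero[of f] f by (simp add: dual_space_def)
next
  case False
  have lin: "f \<in> linear_maps K V (scalars K)"
    and bdd: "bdd_above ((\<lambda>x. cmod (f x)) ` {x \<in> carrier V. \<parallel>x\<parallel> \<le> 1})"
    using f by (auto simp: dual_space_def)
  define u where "u = complex_of_real (1 / \<parallel>x\<parallel>) \<odot> x"
  have nx: "0 < \<parallel>x\<parallel>" using False mnorm_eq_zero_iff[OF x] norm_nonneg[OF x] by linarith
  have u: "u \<in> carrier V" "\<parallel>u\<parallel> = 1" using nx x by (auto simp: u_def mnorm_smult norm_divide)
  have "cmod (f u) \<le> \<parallel>f\<parallel>\<^bsub>dual_space K V\<^esub>"
    unfolding dual_space_def using u bdd by (auto intro!: cSUP_upper)
  moreover have "f u = complex_of_real (1 / \<parallel>x\<parallel>) * f x"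
    unfolding u_def by (rule linear_functionalD(3)[OF lin _ x]) auto
  ultimately show ?thesis using nx by (simp add: norm_divide field_simps)
qed

lemma dual_spaceI:
  assumes "f \<in> linear_maps K V (scalars K)" "f \<in> extensional (carrier V)"
    "\<And>x. x \<in> carrier V \<Longrightarrow> cmod (f x) \<le> M * \<parallel>x\<parallel>"
  shows "f \<in> carrier (dual_space K V)"
proof -
  have "cmod (f x) \<le> \<bar>M\<bar>" if "x \<in> carrier V" "\<parallel>x\<parallel> \<le> 1" for x
  proof -
    have "M * \<parallel>x\<parallel> \<le> \<bar>M\<bar> * 1" using that by (intro mult_mono) auto
    then show ?thesis using assms(3)[OF that(1)] by simp
  qed
  then show ?thesis using assms(1,2) by (auto simp: dual_space_def intro!: bdd_aboveI2)
qed

lemma dual_norm_le: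
  assumes "0 \<le> M" "\<And>x. x \<in> carrier V \<Longrightarrow> cmod (f x) \<le> M * \<parallel>x\<parallel>"
  shows "\<parallel>f\<parallel>\<^bsub>dual_space K V\<^esub> \<le> M"
  unfolding dual_space_def
proof (simp, rule cSUP_least)
  show "{x \<in> carrier V. \<parallel>x\<parallel> \<le> 1} \<noteq> {}" by (auto intro!: exI[of _ \<zero>])
  fix x assume "x \<in> {x \<in> carrier V. \<parallel>x\<parallel> \<le> 1}"
  then have x: "x \<in> carrier V" "\<parallel>x\<parallel> \<le> 1" by auto
  have "M * \<parallel>x\<parallel> \<le> M * 1" using x assms(1) by (intro mult_left_mono) auto
  then show "cmod (f x) \<le> M" using assms(2)[OF x(1)] by simp
qed

lemma dual_spaceD:
  assumes "f \<in> carrier (dual_space K V)"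
  shows "f \<in> linear_maps K V (scalars K)" "f \<in> extensional (carrier V)"
  using assms by (auto simp: dual_space_def)

lemma dual_norm_nonneg:
  assumes "f \<in> carrier (dual_space K V)" shows "0 \<le> \<parallel>f\<parallel>\<^bsub>dual_space K V\<^esub>"
proof -
  have "cmod (f \<zero>) \<le> \<parallel>f\<parallel>\<^bsub>dual_space K V\<^esub>"
    using assms unfolding dual_space_def by (auto intro!: cSUP_upper)
  then show ?thesis by (meson norm_ge_zero order_trans)
qed

lemma dual_eqI:
  assumes "f \<in> carrier (dual_space K V)" "g \<in> carrier (dual_space K V)"
    "\<And>x. x \<in> carrier V \<Longrightarrow> f x = g x"
  shows "f = g"
  using assms dual_spaceD(2) by (intro extensionalityI[of f "carrier V" g]) auto

lemma dual_add_closed: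
  assumes "f \<in> carrier (dual_space K V)" "g \<in> carrier (dual_space K V)"
  shows "(\<lambda>x \<in> carrier V. f x + g x) \<in> carrier (dual_space K V)"
    "\<parallel>\<lambda>x \<in> carrier V. f x + g x\<parallel>\<^bsub>dual_space K V\<^esub> \<le> \<parallel>f\<parallel>\<^bsub>dual_space K V\<^esub> + \<parallel>g\<parallel>\<^bsub>dual_space K V\<^esub>"
proof -
  note lin = linear_functionalD[OF dual_spaceD(1)]
  have b: "cmod ((\<lambda>x \<in> carrier V. f x + g x) x)
      \<le> (\<parallel>f\<parallel>\<^bsub>dual_space K V\<^esub> + \<parallel>g\<parallel>\<^bsub>dual_space K V\<^esub>) * \<parallel>x\<parallel>" if "x \<in> carrier V" for x
    using that norm_triangle_ineq[of "f x" "g x"] dual_norm_bound[OF assms(1) that]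
      dual_norm_bound[OF assms(2) that] by (simp add: distrib_right)
  have "(\<lambda>x \<in> carrier V. f x + g x) \<in> linear_maps K V (scalars K)"
    by (rule linear_functionalI) (auto simp: lin[OF assms(1)] lin[OF assms(2)] algebra_simps)
  then show "(\<lambda>x \<in> carrier V. f x + g x) \<in> carrier (dual_space K V)" by (rule dual_spaceI) (use b in auto)
  show "\<parallel>\<lambda>x \<in> carrier V. f x + g x\<parallel>\<^bsub>dual_space K V\<^esub> \<le> \<parallel>f\<parallel>\<^bsub>dual_space K V\<^esub> + \<parallel>g\<parallel>\<^bsub>dual_space K V\<^esub>"
    by (rule dual_norm_le) (use b dual_norm_nonneg assms in auto)
qed

lemma dual_smult_closed:
  assumes "f \<in> carrier (dual_space K V)" "c \<in> K"
  shows "(\<lambda>x \<in> carrier V. c * f x) \<in> carrier (dual_space K V)"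
    "\<parallel>\<lambda>x \<in> carrier V. c * f x\<parallel>\<^bsub>dual_space K V\<^esub> \<le> cmod c * \<parallel>f\<parallel>\<^bsub>dual_space K V\<^esub>"
proof -
  note lin = linear_functionalD[OF dual_spaceD(1)[OF assms(1)]]
  have b: "cmod ((\<lambda>x \<in> carrier V. c * f x) x) \<le> (cmod c * \<parallel>f\<parallel>\<^bsub>dual_space K V\<^esub>) * \<parallel>x\<parallel>"
    if "x \<in> carrier V" for x
    using mult_left_mono[OF dual_norm_bound[OF assms(1) that], of "cmod c"] that
    by (simp add: norm_mult mult.assoc)
  have "(\<lambda>x \<in> carrier V. c * f x) \<in> linear_maps K V (scalars K)"
    by (rule linear_functionalI) (use assms(2) in \<open>auto simp: lin algebra_simps\<close>)
  then show "(\<lambda>x \<in> carrier V. c * f x) \<in> carrier (dual_space K V)" by (rule dual_spaceI) (use b in auto)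
  show "\<parallel>\<lambda>x \<in> carrier V. c * f x\<parallel>\<^bsub>dual_space K V\<^esub> \<le> cmod c * \<parallel>f\<parallel>\<^bsub>dual_space K V\<^esub>"
    by (rule dual_norm_le) (use b dual_norm_nonneg assms in auto)
qed

lemma nspace_dual: "nspace K (dual_space K V)"
proof -
  let ?D = "dual_space K V"
  have zero: "(\<lambda>x \<in> carrier V. 0) \<in> carrier ?D"
    by (rule dual_spaceI[where M = 0]) (auto intro!: linear_functionalI)
  have grp: "abelian_group ?D"
  proof (rule abelian_groupI)
    fix f assume f: "f \<in> carrier ?D"
    show "\<exists>g\<in>carrier ?D. g \<oplus>\<^bsub>?D\<^esub> f = \<zero>\<^bsub>?D\<^esub>"
      using dual_smult_closed(1)[OF f, of "- 1"]
      by (intro bexI[of _ "\<lambda>x \<in> carrier V. - 1 * f x"]) (auto simp: fun_eq_iff)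
    show "\<zero>\<^bsub>?D\<^esub> \<oplus>\<^bsub>?D\<^esub> f = f"
      by (rule dual_eqI[OF _ f]) (use dual_add_closed(1)[OF zero f] in auto)
  qed (use dual_add_closed zero in \<open>auto simp: fun_eq_iff\<close>)
  have mod: "Module.module (scalars K) ?D"
  proof (rule moduleI[OF cring_scalars grp])
    fix f assume f: "f \<in> carrier ?D"
    show "\<one>\<^bsub>scalars K\<^esub> \<odot>\<^bsub>?D\<^esub> f = f"
      by (rule dual_eqI[OF _ f]) (use dual_smult_closed(1)[OF f, of 1] in auto)
  qed (use dual_smult_closed in \<open>auto simp: fun_eq_iff algebra_simps\<close>)
  have ns: "normed_space K ?D"
  proof (intro normed_space.intro mod normed_space_axioms.intro)
    fix f assume f: "f \<in> carrier ?D"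
    show "\<parallel>f\<parallel>\<^bsub>?D\<^esub> = 0 \<longleftrightarrow> f = \<zero>\<^bsub>?D\<^esub>"
    proof
      assume "\<parallel>f\<parallel>\<^bsub>?D\<^esub> = 0"
      then show "f = \<zero>\<^bsub>?D\<^esub>"
        using dual_norm_bound[OF f] zero by (intro dual_eqI[OF f]) auto
    next
      assume "f = \<zero>\<^bsub>?D\<^esub>"
      then have "\<parallel>f\<parallel>\<^bsub>?D\<^esub> \<le> 0" by (intro dual_norm_le) auto
      then show "\<parallel>f\<parallel>\<^bsub>?D\<^esub> = 0" using dual_norm_nonneg[OF f] by simp
    qed
    fix c assume c: "c \<in> K"
    show "\<parallel>c \<odot>\<^bsub>?D\<^esub> f\<parallel>\<^bsub>?D\<^esub> = cmod c * \<parallel>f\<parallel>\<^bsub>?D\<^esub>"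
    proof (cases "c = 0")
      case True
      have "\<parallel>\<lambda>x \<in> carrier V. 0 * f x\<parallel>\<^bsub>?D\<^esub> \<le> 0" by (rule dual_norm_le) auto
      then show ?thesis
        using True dual_norm_nonneg[OF dual_smult_closed(1)[OF f c]] by simp
    next
      case False
      define g where "g = (\<lambda>x \<in> carrier V. c * f x)"
      have g: "g \<in> carrier ?D" unfolding g_def by (rule dual_smult_closed(1)[OF f c])
      have "f = (\<lambda>x \<in> carrier V. (1 / c) * g x)"
        using False c by (intro dual_eqI[OF f dual_smult_closed(1)[OF g]]) (auto simp: g_def)
      then have "\<parallel>f\<parallel>\<^bsub>?D\<^esub> \<le> cmod (1 / c) * \<parallel>g\<parallel>\<^bsub>?D\<^esub>"
        using dual_smult_closed(2)[OF g, of "1 / c"] c by simp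
      then have "cmod c * \<parallel>f\<parallel>\<^bsub>?D\<^esub> \<le> \<parallel>g\<parallel>\<^bsub>?D\<^esub>" using False by (simp add: norm_divide field_simps)
      then show ?thesis using dual_smult_closed(2)[OF f c] by (simp add: g_def)
    qed
  qed (use dual_add_closed(2) in auto)
  show ?thesis by (intro nspace.intro ns scalar_field_axioms)
qed

end

locale predual_pair = nspace K B + E: nspace K E
  for K and B :: "(complex, 'b) normed_module" (structure) and E :: "(complex, 'e) normed_module" +
  fixes \<Phi> :: "'b \<Rightarrow> 'e \<Rightarrow> complex"
  assumes predual: "predual K B E \<Phi>"
begin

lemma pair_in_dual: "b \<in> carrier B \<Longrightarrow> \<Phi> b \<in> carrier (dual_space K E)"
  using predual by (auto simp: predual_def linear_maps_def hom_def)

lemma pair_linear: "b \<in> carrier B \<Longrightarrow> \<Phi> b \<in> linear_maps K E (scalars K)"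
  using E.dual_spaceD(1)[OF pair_in_dual] .

lemma pair_add: "\<lbrakk>b \<in> carrier B; c \<in> carrier B; e \<in> carrier E\<rbrakk> \<Longrightarrow> \<Phi> (b \<oplus> c) e = \<Phi> b e + \<Phi> c e"
  using predual by (auto simp: predual_def linear_maps_def hom_def)

lemma pair_smult: "\<lbrakk>c \<in> K; b \<in> carrier B; e \<in> carrier E\<rbrakk> \<Longrightarrow> \<Phi> (c \<odot> b) e = c * \<Phi> b e"
  using predual by (auto simp: predual_def linear_maps_def hom_def)

lemma pair_linear_left: "e \<in> carrier E \<Longrightarrow> (\<lambda>b. \<Phi> b e) \<in> linear_maps K B (scalars K)"
  using linear_functionalD(1)[OF pair_linear] by (intro linear_functionalI) (auto simp: pair_add pair_smult)

lemma pair_minus: "\<lbrakk>b \<in> carrier B; c \<in> carrier B; e \<in> carrier E\<rbrakk> \<Longrightarrow> \<Phi> (b \<ominus> c) e = \<Phi> b e - \<Phi> c e"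
  using functional_minus[OF pair_linear_left] by simp

lemma pair_bound:
  assumes "b \<in> carrier B" "e \<in> carrier E" shows "cmod (\<Phi> b e) \<le> \<parallel>b\<parallel> * \<parallel>e\<parallel>\<^bsub>E\<^esub>"
  using E.dual_norm_bound[OF pair_in_dual[OF assms(1)] assms(2)] predual assms(1)
  by (auto simp: predual_def bij_isometry_def)

text \<open>Functionals arrive without being extensional; their restrictions to the carrier are
  members of the dual, and the isometry transfers the bound \<open>M\<close> to the representing
  element.\<close>

lemma pair_surj:
  assumes "f \<in> linear_maps K E (scalars K)" "0 \<le> M"
    and b: "\<And>e. e \<in> carrier E \<Longrightarrow> cmod (f e) \<le> M * \<parallel>e\<parallel>\<^bsub>E\<^esub>"
  obtains b where "b \<in> carrier B" "\<parallel>b\<parallel> \<le> M" "\<And>e. e \<in> carrier E \<Longrightarrow> \<Phi> b e = f e"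
proof -
  define g where "g = restrict f (carrier E)"
  have "g \<in> linear_maps K E (scalars K)"
    unfolding g_def by (rule linear_functionalI) (use linear_functionalD[OF assms(1)] in auto)
  then have g: "g \<in> carrier (dual_space K E)"
    by (rule E.dual_spaceI[where M = M]) (auto simp: g_def b)
  then obtain b where b': "b \<in> carrier B" "\<Phi> b = g"
    using predual unfolding predual_def bij_isometry_def bij_betw_def by (metis imageE)
  have "\<parallel>b\<parallel> = \<parallel>g\<parallel>\<^bsub>dual_space K E\<^esub>" using predual b' by (auto simp: predual_def bij_isometry_def)
  also have "\<dots> \<le> M" by (rule E.dual_norm_le[OF assms(2)]) (simp add: g_def b)
  finally show thesis using that[of b] b' by (simp add: g_def)
qed

lemma pair_inj:
  assumes b: "b \<in> carrier B" "\<And>e. e \<in> carrier E \<Longrightarrow> \<Phi> b e = 0" shows "b = \<zero>"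
proof -
  have z: "\<Phi> \<zero> e = 0" if "e \<in> carrier E" for e using functional_zero[OF pair_linear_left[OF that]] .
  have "\<Phi> b = \<Phi> \<zero>"
    by (rule E.dual_eqI) (use pair_in_dual assms z in auto)
  then show ?thesis using predual b(1)
    by (auto simp: predual_def bij_isometry_def bij_betw_def inj_on_def)
qed

end

section \<open>Quotient algebras\<close>

text \<open>The quotient of \<open>B\<close> by the fibres of \<open>\<rho>\<close>, with each coset
  replaced by its label \<open>\<rho> b\<close>. The carrier thereby lies in the type of the labels,
  which can be coordinates whatever the type of \<open>B\<close> is.\<close>

definition transported_quotient ::
  "(complex, 'b) normed_module \<Rightarrow> ('b \<Rightarrow> 'f) \<Rightarrow> (complex, 'f) normed_module" where
  "transported_quotient B \<rho> = (let \<sigma> = inv_into (carrier B) \<rho> in \<lparr>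
     carrier = \<rho> ` carrier B, mult = (\<lambda>x y. \<rho> (\<sigma> x \<otimes>\<^bsub>B\<^esub> \<sigma> y)), one = \<rho> \<one>\<^bsub>B\<^esub>,
     zero = \<rho> \<zero>\<^bsub>B\<^esub>, add = (\<lambda>x y. \<rho> (\<sigma> x \<oplus>\<^bsub>B\<^esub> \<sigma> y)), smult = (\<lambda>c x. \<rho> (c \<odot>\<^bsub>B\<^esub> \<sigma> x)),
     mnorm = (\<lambda>x. INF b \<in> {b \<in> carrier B. \<rho> b = x}. \<parallel>b\<parallel>\<^bsub>B\<^esub>)\<rparr>)"

text \<open>Here \<open>\<rho>\<close> is just a labelling of the cosets of \<open>I\<close>: its
  target receives all its structure from \<open>B\<close>. Closedness of \<open>I\<close> is stated
  by approximation and makes the quotient seminorm a norm.\<close>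

locale algebra_quotient = scalar_field K + unital_banach_algebra K B
  for K and B :: "(complex, 'b) normed_module" (structure) +
  fixes \<rho> :: "'b \<Rightarrow> 'f" and I :: "'b set"
  assumes I_ideal: "ideal I B" and I_proper: "I \<noteq> carrier B"
    and fibre: "\<lbrakk>b \<in> carrier B; c \<in> carrier B\<rbrakk> \<Longrightarrow> \<rho> b = \<rho> c \<longleftrightarrow> b \<ominus> c \<in> I"
    and I_closed: "\<lbrakk>b \<in> carrier B; \<And>\<epsilon>. 0 < \<epsilon> \<Longrightarrow> \<exists>c \<in> I. \<parallel>b \<ominus> c\<parallel> < \<epsilon>\<rbrakk> \<Longrightarrow> b \<in> I"

sublocale algebra_quotient \<subseteq> nspace K B ..

context algebra_quotient
begin

abbreviation "Q \<equiv> transported_quotient B \<rho>"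

interpretation I: ideal I B by (rule I_ideal)

lemma carrier_Q: "carrier Q = \<rho> ` carrier B"
  by (simp add: transported_quotient_def Let_def)

lemma section_\<rho>:
  assumes "b \<in> carrier B"
  shows "inv_into (carrier B) \<rho> (\<rho> b) \<in> carrier B" "\<rho> (inv_into (carrier B) \<rho> (\<rho> b)) = \<rho> b"
  using assms by (auto intro: inv_into_into f_inv_into_f)

lemma Q_add: "\<lbrakk>b \<in> carrier B; c \<in> carrier B\<rbrakk> \<Longrightarrow> \<rho> b \<oplus>\<^bsub>Q\<^esub> \<rho> c = \<rho> (b \<oplus> c)"
proof -
  assume b: "b \<in> carrier B" and c: "c \<in> carrier B"
  let ?b = "inv_into (carrier B) \<rho> (\<rho> b)" and ?c = "inv_into (carrier B) \<rho> (\<rho> c)"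
  note s = section_\<rho>[OF b] section_\<rho>[OF c]
  have "?b \<ominus> b \<in> I" "?c \<ominus> c \<in> I" using fibre s b c by auto
  then have "(?b \<ominus> b) \<oplus> (?c \<ominus> c) \<in> I" by (rule I.a_closed)
  also have "(?b \<ominus> b) \<oplus> (?c \<ominus> c) = (?b \<oplus> ?c) \<ominus> (b \<oplus> c)"
    using b c s by (simp add: a_minus_def a_ac minus_add)
  finally have "\<rho> (?b \<oplus> ?c) = \<rho> (b \<oplus> c)" using fibre[of "?b \<oplus> ?c" "b \<oplus> c"] b c s by simp
  then show "\<rho> b \<oplus>\<^bsub>Q\<^esub> \<rho> c = \<rho> (b \<oplus> c)" by (simp add: transported_quotient_def Let_def)
qed

lemma Q_mult: "\<lbrakk>b \<in> carrier B; c \<in> carrier B\<rbrakk> \<Longrightarrow> \<rho> b \<otimes>\<^bsub>Q\<^esub> \<rho> c = \<rho> (b \<otimes> c)"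
proof -
  assume b: "b \<in> carrier B" and c: "c \<in> carrier B"
  let ?b = "inv_into (carrier B) \<rho> (\<rho> b)" and ?c = "inv_into (carrier B) \<rho> (\<rho> c)"
  note s = section_\<rho>[OF b] section_\<rho>[OF c]
  have "?b \<ominus> b \<in> I" "?c \<ominus> c \<in> I" using fibre s b c by auto
  then have "(?b \<ominus> b) \<otimes> ?c \<oplus> b \<otimes> (?c \<ominus> c) \<in> I"
    using b s by (intro I.a_closed I.I_r_closed I.I_l_closed)
  also have "(?b \<ominus> b) \<otimes> ?c \<oplus> b \<otimes> (?c \<ominus> c) = (?b \<otimes> ?c) \<ominus> (b \<otimes> c)"
    using b c s by (simp add: a_minus_def l_distr r_distr l_minus r_minus a_ac r_neg2 r_neg1)
  finally have "\<rho> (?b \<otimes> ?c) = \<rho> (b \<otimes> c)" using fibre[of "?b \<otimes> ?c" "b \<otimes> c"] b c s by simp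
  then show "\<rho> b \<otimes>\<^bsub>Q\<^esub> \<rho> c = \<rho> (b \<otimes> c)" by (simp add: transported_quotient_def Let_def)
qed

text \<open>A ring ideal is a linear subspace because scalars act as multiplication by multiples of
  the unit.\<close>

lemma I_smult: "\<lbrakk>k \<in> K; b \<in> I\<rbrakk> \<Longrightarrow> k \<odot> b \<in> I"
proof -
  assume k: "k \<in> K" and b: "b \<in> I"
  have "k \<odot> b = (k \<odot> \<one>) \<otimes> b" using k b I.a_subset by (simp add: smult_mult_left subset_iff)
  then show ?thesis using k b by (auto intro: I.I_l_closed)
qed

lemma Q_smult: "\<lbrakk>k \<in> K; b \<in> carrier B\<rbrakk> \<Longrightarrow> k \<odot>\<^bsub>Q\<^esub> \<rho> b = \<rho> (k \<odot> b)"
proof -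
  assume k: "k \<in> K" and b: "b \<in> carrier B"
  let ?b = "inv_into (carrier B) \<rho> (\<rho> b)"
  note s = section_\<rho>[OF b]
  have "?b \<ominus> b \<in> I" using fibre s b by auto
  then have "k \<odot> (?b \<ominus> b) \<in> I" by (rule I_smult[OF k])
  also have "k \<odot> (?b \<ominus> b) = k \<odot> ?b \<ominus> k \<odot> b"
    using k b s by (simp add: a_minus_def smult_add_right minus_eq_smult smult_smult)
  finally have "\<rho> (k \<odot> ?b) = \<rho> (k \<odot> b)" using fibre[of "k \<odot> ?b" "k \<odot> b"] k b s by simp
  then show "k \<odot>\<^bsub>Q\<^esub> \<rho> b = \<rho> (k \<odot> b)" by (simp add: transported_quotient_def Let_def)
qed

lemma Q_zero: "\<zero>\<^bsub>Q\<^esub> = \<rho> \<zero>" and Q_one: "\<one>\<^bsub>Q\<^esub> = \<rho> \<one>"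
  by (simp_all add: transported_quotient_def Let_def)

lemma kernel_\<rho>: "b \<in> carrier B \<Longrightarrow> \<rho> b = \<rho> \<zero> \<longleftrightarrow> b \<in> I"
  using fibre[of b \<zero>] by (simp add: a_minus_def)

lemma Q_norm: "\<parallel>x\<parallel>\<^bsub>Q\<^esub> = (INF b \<in> {b \<in> carrier B. \<rho> b = x}. \<parallel>b\<parallel>)"
  by (simp add: transported_quotient_def Let_def)

lemma Q_norm_le: "b \<in> carrier B \<Longrightarrow> \<parallel>\<rho> b\<parallel>\<^bsub>Q\<^esub> \<le> \<parallel>b\<parallel>"
  unfolding Q_norm by (rule cINF_lower) (auto intro!: bdd_belowI2[where m = 0])

lemma Q_norm_ge:
  assumes "b \<in> carrier B" "\<And>c. \<lbrakk>c \<in> carrier B; \<rho> c = \<rho> b\<rbrakk> \<Longrightarrow> m \<le> \<parallel>c\<parallel>"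
  shows "m \<le> \<parallel>\<rho> b\<parallel>\<^bsub>Q\<^esub>"
  unfolding Q_norm by (rule cINF_greatest) (use assms in auto)

text \<open>Takes the infimum over representatives under a factor. Submultiplicativity follows by
  using it for one factor after the other, and boundedness of coordinates in the quotient norm by
  using it once.\<close>

lemma Q_norm_ge_scaled:
  assumes b: "b \<in> carrier B" and a: "0 \<le> a"
    and le: "\<And>c. \<lbrakk>c \<in> carrier B; \<rho> c = \<rho> b\<rbrakk> \<Longrightarrow> m \<le> a * \<parallel>c\<parallel>"
  shows "m \<le> a * \<parallel>\<rho> b\<parallel>\<^bsub>Q\<^esub>"
proof (cases "a = 0")
  case True
  then show ?thesis using le[OF b] by simp
next
  case False
  then have "m / a \<le> \<parallel>\<rho> b\<parallel>\<^bsub>Q\<^esub>"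
    using le a by (intro Q_norm_ge[OF b]) (auto simp: field_simps)
  then show ?thesis using False a by (simp add: field_simps)
qed

lemma Q_norm_nonneg: "b \<in> carrier B \<Longrightarrow> 0 \<le> \<parallel>\<rho> b\<parallel>\<^bsub>Q\<^esub>"
  by (rule Q_norm_ge) auto

lemma submodule_I: "submodule I (scalars K) B"
  by (rule submoduleI') (use I.a_subset I.zero_closed I.a_closed I_smult in auto)

text \<open>The involution \<open>c \<mapsto> b \<ominus> c\<close> exchanges the coset of
  \<open>b\<close> and the ideal, so both infima run over the same norms.\<close>

lemma Q_norm_setdist:
  assumes b: "b \<in> carrier B" shows "\<parallel>\<rho> b\<parallel>\<^bsub>Q\<^esub> = setdist_from I b"
proof -
  have diff: "b \<ominus> (b \<ominus> c) = c" if "c \<in> carrier B" for c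
    using b that by (simp add: a_minus_def minus_add a_assoc[symmetric] r_neg)
  have "mnorm B ` {c \<in> carrier B. \<rho> c = \<rho> b} = (\<lambda>y. \<parallel>b \<ominus> y\<parallel>) ` I"
  proof (intro equalityI subsetI; elim imageE)
    fix x c assume "x = \<parallel>c\<parallel>" "c \<in> {c \<in> carrier B. \<rho> c = \<rho> b}"
    then show "x \<in> (\<lambda>y. \<parallel>b \<ominus> y\<parallel>) ` I"
      using fibre[OF b, of c] diff[of c] by (intro image_eqI[of _ _ "b \<ominus> c"]) auto
  next
    fix x y assume "x = \<parallel>b \<ominus> y\<parallel>" "y \<in> I"
    moreover from this have "y \<in> carrier B" using I.a_subset by blast
    ultimately show "x \<in> mnorm B ` {c \<in> carrier B. \<rho> c = \<rho> b}"
      using fibre[OF b, of "b \<ominus> y"] diff[of y] b by (intro image_eqI[of _ _ "b \<ominus> y"]) auto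
  qed
  then show ?thesis by (simp add: Q_norm setdist_from_def)
qed

lemma unital_algebra_Q: "unital_algebra K Q"
proof -
  have grp: "abelian_group Q"
  proof (rule abelian_groupI)
    fix x assume "x \<in> carrier Q"
    then obtain b where b: "b \<in> carrier B" "x = \<rho> b" by (auto simp: carrier_Q)
    have "\<rho> (\<ominus> b) \<oplus>\<^bsub>Q\<^esub> \<rho> b = \<zero>\<^bsub>Q\<^esub>" using b by (simp add: Q_add Q_zero l_neg)
    then show "\<exists>y\<in>carrier Q. y \<oplus>\<^bsub>Q\<^esub> x = \<zero>\<^bsub>Q\<^esub>" using b by (auto simp: carrier_Q)
  qed (auto simp: carrier_Q Q_add Q_zero a_ac)
  have mod: "Module.module (scalars K) Q"
    by (rule moduleI[OF cring_scalars grp])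
      (auto simp: carrier_Q Q_add Q_smult smult_add_left smult_add_right smult_smult)
  have rng: "ring Q"
  proof (rule ringI[OF grp])
    show "Group.monoid Q"
      by (rule monoidI) (auto simp: carrier_Q Q_mult Q_one m_assoc)
  qed (auto simp: carrier_Q Q_mult Q_add l_distr r_distr)
  show ?thesis
    by (intro unital_algebra.intro mod rng unital_algebra_axioms.intro)
      (auto simp: carrier_Q Q_mult Q_smult smult_mult_left smult_mult_right)
qed

lemma normed_space_Q: "normed_space K Q"
proof -
  interpret Q: unital_algebra K Q by (rule unital_algebra_Q)
  show ?thesis
  proof (intro normed_space.intro Q.module_axioms normed_space_axioms.intro)
    fix x assume "x \<in> carrier Q"
    then obtain b where b: "b \<in> carrier B" "x = \<rho> b" by (auto simp: carrier_Q)
    show "\<parallel>x\<parallel>\<^bsub>Q\<^esub> = 0 \<longleftrightarrow> x = \<zero>\<^bsub>Q\<^esub>"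
    proof
      assume x0: "\<parallel>x\<parallel>\<^bsub>Q\<^esub> = 0"
      \<comment> \<open>If \<open>I\<close> kept a positive distance from \<open>b\<close>, this
        distance would bound the quotient norm from below.\<close>
      have "b \<in> I"
      proof (rule I_closed[OF b(1)], rule ccontr)
        fix \<epsilon> :: real assume "0 < \<epsilon>" "\<not> (\<exists>c\<in>I. \<parallel>b \<ominus> c\<parallel> < \<epsilon>)"
        then show False
          using setdist_ge[OF submodule_I, of \<epsilon> b] x0 b Q_norm_setdist[OF b(1)] by force
      qed
      then show "x = \<zero>\<^bsub>Q\<^esub>" using b kernel_\<rho> by (simp add: Q_zero)
    next
      assume "x = \<zero>\<^bsub>Q\<^esub>"
      then show "\<parallel>x\<parallel>\<^bsub>Q\<^esub> = 0"
        using Q_norm_le[of \<zero>] Q_norm_nonneg[of \<zero>] by (simp add: Q_zero)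
    qed
    show "\<parallel>k \<odot>\<^bsub>Q\<^esub> x\<parallel>\<^bsub>Q\<^esub> = cmod k * \<parallel>x\<parallel>\<^bsub>Q\<^esub>" if "k \<in> K" for k
      using b that setdist_smult[OF submodule_I] by (simp add: Q_smult Q_norm_setdist)
    fix y assume "y \<in> carrier Q"
    then obtain c where "c \<in> carrier B" "y = \<rho> c" by (auto simp: carrier_Q)
    then show "\<parallel>x \<oplus>\<^bsub>Q\<^esub> y\<parallel>\<^bsub>Q\<^esub> \<le> \<parallel>x\<parallel>\<^bsub>Q\<^esub> + \<parallel>y\<parallel>\<^bsub>Q\<^esub>"
      using b setdist_add[OF submodule_I] by (simp add: Q_add Q_norm_setdist)
  qed
qed

lemma Q_norm_mult:
  assumes "x \<in> carrier Q" "y \<in> carrier Q"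
  shows "\<parallel>x \<otimes>\<^bsub>Q\<^esub> y\<parallel>\<^bsub>Q\<^esub> \<le> \<parallel>x\<parallel>\<^bsub>Q\<^esub> * \<parallel>y\<parallel>\<^bsub>Q\<^esub>"
proof -
  obtain b c where b: "b \<in> carrier B" "x = \<rho> b" and c: "c \<in> carrier B" "y = \<rho> c"
    using assms by (auto simp: carrier_Q)
  have *: "\<parallel>\<rho> (b \<otimes> c)\<parallel>\<^bsub>Q\<^esub> \<le> \<parallel>b'\<parallel> * \<parallel>c'\<parallel>"
    if "b' \<in> carrier B" "\<rho> b' = \<rho> b" "c' \<in> carrier B" "\<rho> c' = \<rho> c" for b' c'
  proof -
    have "\<rho> (b \<otimes> c) = \<rho> (b' \<otimes> c')" using Q_mult[of b c] Q_mult[of b' c'] that b c by simp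
    then show ?thesis using Q_norm_le[of "b' \<otimes> c'"] mnorm_mult[of b' c'] that by simp
  qed
  have "\<parallel>\<rho> (b \<otimes> c)\<parallel>\<^bsub>Q\<^esub> \<le> \<parallel>b'\<parallel> * \<parallel>\<rho> c\<parallel>\<^bsub>Q\<^esub>" if "b' \<in> carrier B" "\<rho> b' = \<rho> b" for b'
    by (rule Q_norm_ge_scaled[OF c(1)]) (use *[OF that] that in auto)
  then have "\<parallel>\<rho> (b \<otimes> c)\<parallel>\<^bsub>Q\<^esub> \<le> \<parallel>\<rho> c\<parallel>\<^bsub>Q\<^esub> * \<parallel>\<rho> b\<parallel>\<^bsub>Q\<^esub>"
    by (intro Q_norm_ge_scaled[OF b(1) Q_norm_nonneg[OF c(1)]]) (simp add: mult.commute)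
  then show ?thesis using b c by (simp add: Q_mult mult.commute)
qed

text \<open>The representative \<open>\<one>\<close> gives one inequality. For the other, the norm
  \<open>n\<close> of the unit satisfies \<open>n \<le> n * n\<close> by submultiplicativity, and it
  is nonzero because a proper ideal does not contain the unit.\<close>

lemma Q_norm_one: "\<parallel>\<one>\<^bsub>Q\<^esub>\<parallel>\<^bsub>Q\<^esub> = 1"
proof (rule antisym)
  interpret Q: unital_algebra K Q by (rule unital_algebra_Q)
  interpret Q: normed_space K Q by (rule normed_space_Q)
  show "\<parallel>\<one>\<^bsub>Q\<^esub>\<parallel>\<^bsub>Q\<^esub> \<le> 1" using Q_norm_le[of \<one>] mnorm_one by (simp add: Q_one)
  have "\<one> \<notin> I" using I.one_imp_carrier I_proper by blast
  then have "\<one>\<^bsub>Q\<^esub> \<noteq> \<zero>\<^bsub>Q\<^esub>" using kernel_\<rho>[of \<one>] by (simp add: Q_one Q_zero)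
  then have "\<parallel>\<one>\<^bsub>Q\<^esub>\<parallel>\<^bsub>Q\<^esub> \<noteq> 0" using Q.mnorm_eq_zero_iff[of "\<one>\<^bsub>Q\<^esub>"] by simp
  moreover have "0 \<le> \<parallel>\<one>\<^bsub>Q\<^esub>\<parallel>\<^bsub>Q\<^esub>" using Q_norm_nonneg[of \<one>] by (simp add: Q_one)
  moreover have "\<parallel>\<one>\<^bsub>Q\<^esub>\<parallel>\<^bsub>Q\<^esub> \<le> \<parallel>\<one>\<^bsub>Q\<^esub>\<parallel>\<^bsub>Q\<^esub> * \<parallel>\<one>\<^bsub>Q\<^esub>\<parallel>\<^bsub>Q\<^esub>"
    using Q_norm_mult[of "\<one>\<^bsub>Q\<^esub>" "\<one>\<^bsub>Q\<^esub>"] by simp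
  ultimately show "1 \<le> \<parallel>\<one>\<^bsub>Q\<^esub>\<parallel>\<^bsub>Q\<^esub>" by simp
qed

lemma \<rho>_alg_hom: "\<rho> \<in> alg_hom K B Q"
  by (auto simp: alg_hom_def ring_hom_def linear_maps_def hom_def carrier_Q Q_add Q_mult Q_smult Q_one)

lemma unital_banach_algebra_Q: "banach_space K Q \<Longrightarrow> unital_banach_algebra K Q"
  by (intro unital_banach_algebra.intro unital_algebra_Q unital_banach_algebra_axioms.intro
      Q_norm_mult Q_norm_one)

end

section \<open>From ideal exhaustions to homomorphisms and inverse limits\<close>

lemma alg_homD:
  assumes "h \<in> alg_hom K A B"
  shows "x \<in> carrier A \<Longrightarrow> h x \<in> carrier B"
    "\<lbrakk>x \<in> carrier A; y \<in> carrier A\<rbrakk> \<Longrightarrow> h (x \<oplus>\<^bsub>A\<^esub> y) = h x \<oplus>\<^bsub>B\<^esub> h y"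
    "\<lbrakk>x \<in> carrier A; y \<in> carrier A\<rbrakk> \<Longrightarrow> h (x \<otimes>\<^bsub>A\<^esub> y) = h x \<otimes>\<^bsub>B\<^esub> h y"
    "\<lbrakk>c \<in> K; x \<in> carrier A\<rbrakk> \<Longrightarrow> h (c \<odot>\<^bsub>A\<^esub> x) = c \<odot>\<^bsub>B\<^esub> h x"
    "h \<one>\<^bsub>A\<^esub> = \<one>\<^bsub>B\<^esub>"
  using assms by (auto simp: alg_hom_def ring_hom_def linear_maps_def)

lemma alg_homI:
  assumes "\<And>x. x \<in> carrier A \<Longrightarrow> h x \<in> carrier B"
    "\<And>x y. \<lbrakk>x \<in> carrier A; y \<in> carrier A\<rbrakk> \<Longrightarrow> h (x \<oplus>\<^bsub>A\<^esub> y) = h x \<oplus>\<^bsub>B\<^esub> h y"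
    "\<And>x y. \<lbrakk>x \<in> carrier A; y \<in> carrier A\<rbrakk> \<Longrightarrow> h (x \<otimes>\<^bsub>A\<^esub> y) = h x \<otimes>\<^bsub>B\<^esub> h y"
    "\<And>c x. \<lbrakk>c \<in> K; x \<in> carrier A\<rbrakk> \<Longrightarrow> h (c \<odot>\<^bsub>A\<^esub> x) = c \<odot>\<^bsub>B\<^esub> h x"
    "h \<one>\<^bsub>A\<^esub> = \<one>\<^bsub>B\<^esub>"
  shows "h \<in> alg_hom K A B"
  using assms by (auto simp: alg_hom_def ring_hom_def linear_maps_def hom_def)

locale dual_algebra = unital_banach_algebra K B + predual_pair K B E \<Phi>
  for K and B :: "(complex, 'b) normed_module" (structure)
    and E :: "(complex, 'e) normed_module" and \<Phi>
begin

abbreviation "weak_star \<equiv> pullback_topology (carrier B) \<Phi> (weak_star_topology K E)"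

lemma topspace_weak_star: "topspace weak_star = carrier B"
proof -
  have "f \<in> topspace (weak_star_topology K E)" if "f \<in> carrier (dual_space K E)" for f
    unfolding weak_star_topology_def topology_generated_by_topspace using that
    by (intro UnionI[of "{f \<in> carrier (dual_space K E). f \<zero>\<^bsub>E\<^esub> \<in> UNIV}"]) auto
  then show ?thesis using pair_in_dual by (auto simp: topspace_pullback_topology)
qed

lemma continuous_pairing:
  assumes e: "e \<in> carrier E" shows "continuous_map weak_star euclidean (\<lambda>b. \<Phi> b e)"
  unfolding continuous_map_def topspace_weak_star
proof (intro conjI allI impI)
  fix U :: "complex set" assume "openin euclidean U"
  then have "openin (weak_star_topology K E) {f \<in> carrier (dual_space K E). f e \<in> U}"
    unfolding weak_star_topology_def using e by (intro topology_generated_by_Basis) auto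
  moreover have "{b \<in> carrier B. \<Phi> b e \<in> U}
      = \<Phi> -` {f \<in> carrier (dual_space K E). f e \<in> U} \<inter> carrier B"
    using pair_in_dual by auto
  ultimately show "openin weak_star {b \<in> carrier B. \<Phi> b e \<in> U}"
    unfolding openin_pullback_topology by blast
qed simp

text \<open>Collects what is used of \<open>B\<close> modulo the annihilator of \<open>S\<close>, in
  the type of coordinates. The quotient norm is described as the greatest lower bound of the norms
  of representatives, in two clauses, so that no infimum has to be handled later.\<close>

definition fd_quotient :: "'e set \<Rightarrow> (complex, nat \<Rightarrow> complex) normed_module \<Rightarrow> ('b \<Rightarrow> nat \<Rightarrow> complex) \<Rightarrow> bool"
  where "fd_quotient S F \<rho> \<longleftrightarrow> unital_banach_algebra K F \<and> fin_dim K F \<and> \<rho> \<in> alg_hom K B F \<and>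
    \<rho> ` carrier B = carrier F \<and>
    (\<forall>b \<in> carrier B. \<forall>c \<in> carrier B. \<rho> b = \<rho> c \<longleftrightarrow> b \<ominus> c \<in> annihilator B \<Phi> S) \<and>
    (\<forall>b \<in> carrier B. \<parallel>\<rho> b\<parallel>\<^bsub>F\<^esub> \<le> \<parallel>b\<parallel>) \<and>
    (\<forall>b \<in> carrier B. \<forall>m. (\<forall>c \<in> carrier B. \<rho> c = \<rho> b \<longrightarrow> m \<le> \<parallel>c\<parallel>) \<longrightarrow> m \<le> \<parallel>\<rho> b\<parallel>\<^bsub>F\<^esub>) \<and>
    continuous_map weak_star (norm_topology F) \<rho>"

text \<open>The coset of \<open>b\<close> is labelled by the pairings of \<open>b\<close> with
  vectors spanning \<open>S\<close>, padded with zeros. These coordinates are bounded in the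
  quotient norm, so completeness and finite dimension come from the general lemmas; conversely they
  control the quotient norm, which gives weak-star continuity.\<close>

lemma fd_quotient_exists:
  assumes S: "submodule S (scalars K) E" and fd: "fin_dim K (E\<lparr>carrier := S\<rparr>)"
    and ideal: "ideal (annihilator B \<Phi> S) B" and proper: "annihilator B \<Phi> S \<noteq> carrier B"
  shows "\<exists>F \<rho>. fd_quotient S F \<rho>"
proof -
  obtain k :: nat and e where e: "\<And>i. i < k \<Longrightarrow> e i \<in> S"
    and span: "\<And>v. v \<in> S \<Longrightarrow> \<exists>c. (\<forall>i. c i \<in> K) \<and> v = (\<Oplus>\<^bsub>E\<^esub>i\<in>{..<k}. c i \<odot>\<^bsub>E\<^esub> e i)"
    using E.fin_dim_submoduleE[OF S fd] by blast
  have SE: "S \<subseteq> carrier E" using E.submoduleE(1)[OF S] .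
  have eE: "e i \<in> carrier E" if "i < k" for i using e[OF that] SE by blast
  have ann_iff: "b \<in> annihilator B \<Phi> S \<longleftrightarrow> b \<in> carrier B \<and> (\<forall>i<k. \<Phi> b (e i) = 0)" for b
  proof
    assume b: "b \<in> carrier B \<and> (\<forall>i<k. \<Phi> b (e i) = 0)"
    have "\<Phi> b v = 0" if v: "v \<in> S" for v
    proof -
      obtain c where c: "\<forall>i. c i \<in> K" "v = (\<Oplus>\<^bsub>E\<^esub>i\<in>{..<k}. c i \<odot>\<^bsub>E\<^esub> e i)"
        using span[OF v] by blast
      have "\<Phi> b v = (\<Sum>i<k. \<Phi> b (c i \<odot>\<^bsub>E\<^esub> e i))"
        unfolding c(2) using b c(1) eE by (intro E.functional_finsum pair_linear) auto
      also have "\<dots> = (\<Sum>i<k. c i * \<Phi> b (e i))"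
        using b c(1) eE by (intro sum.cong refl linear_functionalD(3)[OF pair_linear]) auto
      finally show ?thesis using b by simp
    qed
    then show "b \<in> annihilator B \<Phi> S" using b by (simp add: annihilator_def)
  qed (use e in \<open>auto simp: annihilator_def\<close>)
  define \<rho> where "\<rho> b = (\<lambda>i. if i < k then \<Phi> b (e i) else 0)" for b
  interpret q: algebra_quotient K B \<rho> "annihilator B \<Phi> S"
  proof (intro algebra_quotient.intro scalar_field_axioms unital_banach_algebra_axioms
      algebra_quotient_axioms.intro ideal proper)
    show "\<rho> b = \<rho> c \<longleftrightarrow> b \<ominus> c \<in> annihilator B \<Phi> S" if "b \<in> carrier B" "c \<in> carrier B" for b c
      using that by (auto simp: ann_iff \<rho>_def fun_eq_iff pair_minus eE)
    show "b \<in> annihilator B \<Phi> S" if b: "b \<in> carrier B"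
      and close: "\<And>\<epsilon>. 0 < \<epsilon> \<Longrightarrow> \<exists>c\<in>annihilator B \<Phi> S. \<parallel>b \<ominus> c\<parallel> < \<epsilon>" for b
    proof -
      have "\<Phi> b v = 0" if v: "v \<in> S" for v
      proof (rule functional_vanishes[OF pair_linear_left _ _ _ b close])
        show "v \<in> carrier E" using v SE by blast
        then show "cmod (\<Phi> c v) \<le> \<parallel>v\<parallel>\<^bsub>E\<^esub> * \<parallel>c\<parallel>" if "c \<in> carrier B" for c
          using pair_bound[OF that] by (simp add: mult.commute)
      qed (use v in \<open>auto simp: annihilator_def\<close>)
      then show ?thesis using b by (simp add: annihilator_def)
    qed
  qed
  let ?F = "transported_quotient B \<rho>"
  interpret F: nspace K ?F by (intro nspace.intro scalar_field_axioms q.normed_space_Q)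
  have lin: "\<forall>i<k. (\<lambda>x. x i) \<in> linear_maps K ?F (scalars K)"
  proof (intro allI impI linear_functionalI)
    fix i x y assume "i < k" "x \<in> carrier ?F" "y \<in> carrier ?F"
    then show "(x \<oplus>\<^bsub>?F\<^esub> y) i = x i + y i"
      by (auto simp: q.carrier_Q q.Q_add) (auto simp: \<rho>_def pair_add eE)
  next
    fix i c x assume "i < k" "c \<in> K" "x \<in> carrier ?F"
    then show "(c \<odot>\<^bsub>?F\<^esub> x) i = c * x i"
      by (auto simp: q.carrier_Q q.Q_smult) (auto simp: \<rho>_def pair_smult eE)
  qed (auto simp: q.carrier_Q \<rho>_def linear_functionalD(1)[OF pair_linear eE])
  have inj: "\<forall>x \<in> carrier ?F. (\<forall>i<k. x i = 0) \<longrightarrow> x = \<zero>\<^bsub>?F\<^esub>"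
  proof (intro ballI impI)
    fix x assume "x \<in> carrier ?F" and x0: "\<forall>i<k. x i = 0"
    then obtain b where b: "b \<in> carrier B" "x = \<rho> b" by (auto simp: q.carrier_Q)
    then have "b \<in> annihilator B \<Phi> S" using x0 by (simp add: ann_iff \<rho>_def)
    then show "x = \<zero>\<^bsub>?F\<^esub>" using q.kernel_\<rho>[OF b(1)] b by (simp add: q.Q_zero)
  qed
  \<comment> \<open>The pairing bound holds for every representative and hence passes to the infimum
    that defines the quotient norm.\<close>
  have bdd: "cmod (x i) \<le> \<parallel>e i\<parallel>\<^bsub>E\<^esub> * \<parallel>x\<parallel>\<^bsub>?F\<^esub>" if i: "i < k" and x: "x \<in> carrier ?F" for i x
  proof -
    obtain b where b: "b \<in> carrier B" "x = \<rho> b" using x by (auto simp: q.carrier_Q)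
    have "cmod (\<rho> b i) \<le> \<parallel>e i\<parallel>\<^bsub>E\<^esub> * \<parallel>\<rho> b\<parallel>\<^bsub>?F\<^esub>"
    proof (rule q.Q_norm_ge_scaled[OF b(1)])
      show "0 \<le> \<parallel>e i\<parallel>\<^bsub>E\<^esub>" using eE[OF i] by simp
      fix c assume c: "c \<in> carrier B" "\<rho> c = \<rho> b"
      have "cmod (\<rho> c i) \<le> \<parallel>e i\<parallel>\<^bsub>E\<^esub> * \<parallel>c\<parallel>"
        using pair_bound[OF c(1) eE[OF i]] i by (simp add: \<rho>_def mult.commute)
      then show "cmod (\<rho> b i) \<le> \<parallel>e i\<parallel>\<^bsub>E\<^esub> * \<parallel>c\<parallel>" using c by simp
    qed
    then show ?thesis using b by simp
  qed
  have banach: "banach_space K ?F"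
    by (rule F.banach_functionals[OF lin inj, where M = "\<lambda>i. \<parallel>e i\<parallel>\<^bsub>E\<^esub>"]) (use bdd in auto)
  have fd: "fin_dim K ?F" by (rule F.fin_dim_functionals[OF lin inj])
  obtain C where C: "0 \<le> C" "\<And>x. x \<in> carrier ?F \<Longrightarrow> \<parallel>x\<parallel>\<^bsub>?F\<^esub> \<le> C * (\<Sum>i<k. cmod (x i))"
    using F.functionals_norm_bound[OF lin inj] by blast
  interpret FM: Metric_space "carrier ?F" "ndist ?F" by (rule F.Metric_space_ndist)
  have cont: "continuous_map weak_star (norm_topology ?F) \<rho>"
    unfolding FM.continuous_map_to_metric topspace_weak_star
  proof (intro ballI allI impI)
    fix b and \<epsilon> :: real assume b: "b \<in> carrier B" and \<epsilon>: "0 < \<epsilon>"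
    \<comment> \<open>A weak-star continuous majorant of the distance from \<open>\<rho> c\<close>
      to \<open>\<rho> b\<close> that vanishes at \<open>b\<close>.\<close>
    define g where "g c = C * (\<Sum>i<k. cmod (\<Phi> c (e i) - \<Phi> b (e i)))" for c
    have "continuous_map weak_star euclidean g"
      unfolding g_def continuous_map_atin limitin_canonical_iff
    proof
      fix c assume c: "c \<in> topspace weak_star"
      have "((\<lambda>c. \<Phi> c (e i)) \<longlongrightarrow> \<Phi> c (e i)) (atin weak_star c)" if "i < k" for i
        using continuous_pairing[OF eE[OF that]] c
        unfolding continuous_map_atin limitin_canonical_iff by blast
      then show "((\<lambda>c. C * (\<Sum>i<k. cmod (\<Phi> c (e i) - \<Phi> b (e i))))
          \<longlongrightarrow> C * (\<Sum>i<k. cmod (\<Phi> c (e i) - \<Phi> b (e i)))) (atin weak_star c)"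
        by (intro tendsto_intros) auto
    qed
    from openin_continuous_map_preimage[OF this, of "{..<\<epsilon>}"]
    have "openin weak_star {c \<in> carrier B. g c < \<epsilon>}" by (simp add: topspace_weak_star)
    moreover have "\<rho> c \<in> FM.mball (\<rho> b) \<epsilon>" if c: "c \<in> carrier B" "g c < \<epsilon>" for c
    proof -
      have \<rho>F: "\<rho> b \<in> carrier ?F" "\<rho> c \<in> carrier ?F" using b c by (auto simp: q.carrier_Q)
      have "(\<rho> c \<ominus>\<^bsub>?F\<^esub> \<rho> b) i = \<Phi> c (e i) - \<Phi> b (e i)" if "i < k" for i
        using F.functional_minus[OF lin[rule_format, OF that] \<rho>F(2,1)] that by (simp add: \<rho>_def)
      then have "\<parallel>\<rho> c \<ominus>\<^bsub>?F\<^esub> \<rho> b\<parallel>\<^bsub>?F\<^esub> \<le> g c"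
        using C(2)[of "\<rho> c \<ominus>\<^bsub>?F\<^esub> \<rho> b"] \<rho>F by (simp add: g_def)
      then have "\<parallel>\<rho> b \<ominus>\<^bsub>?F\<^esub> \<rho> c\<parallel>\<^bsub>?F\<^esub> < \<epsilon>" using F.norm_minus_commute[OF \<rho>F] c by simp
      then show ?thesis using \<rho>F by (simp add: F.ndist_eq)
    qed
    ultimately show "\<exists>U. openin weak_star U \<and> b \<in> U \<and> (\<forall>y\<in>U. \<rho> y \<in> FM.mball (\<rho> b) \<epsilon>)"
      using b \<epsilon> by (intro exI[of _ "{c \<in> carrier B. g c < \<epsilon>}"]) (auto simp: g_def)
  qed
  have "fd_quotient S ?F \<rho>"
    unfolding fd_quotient_def
  proof (intro conjI ballI allI impI)
    fix b m assume "b \<in> carrier B" "\<forall>c\<in>carrier B. \<rho> c = \<rho> b \<longrightarrow> m \<le> \<parallel>c\<parallel>"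
    then show "m \<le> \<parallel>\<rho> b\<parallel>\<^bsub>?F\<^esub>" by (intro q.Q_norm_ge) auto
  qed (use q.unital_banach_algebra_Q[OF banach] fd q.\<rho>_alg_hom q.carrier_Q q.fibre q.Q_norm_le
      cont in simp_all)
  then show ?thesis by blast
qed

text \<open>The functional \<open>\<Phi> b\<close> is norm continuous, so it vanishes on
  \<open>E\<close> once it vanishes on the dense union.\<close>

lemma annihilator_dense:
  assumes dense: "norm_topology E closure_of (\<Union>r. S r) = carrier E"
    and SE: "\<And>r. S r \<subseteq> carrier E"
    and b: "b \<in> carrier B" "\<And>r. b \<in> annihilator B \<Phi> (S r)"
  shows "b = \<zero>"
proof (rule pair_inj[OF b(1)])
  fix e assume e: "e \<in> carrier E"
  have U: "(\<Union>r. S r) \<subseteq> carrier E" using SE by blast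
  show "\<Phi> b e = 0"
  proof (rule E.functional_vanishes[OF pair_linear[OF b(1)] pair_bound[OF b(1)] U _ e])
    show "\<Phi> b y = 0" if "y \<in> (\<Union>r. S r)" for y using b(2) that by (auto simp: annihilator_def)
    show "\<exists>y\<in>\<Union>r. S r. \<parallel>e \<ominus>\<^bsub>E\<^esub> y\<parallel>\<^bsub>E\<^esub> < \<epsilon>" if "0 < \<epsilon>" for \<epsilon>
      using E.closure_eq_carrier_iff[OF U] dense e that by blast
  qed
qed

lemma ideal_exhaustionE:
  assumes "ideal_exhaustion K B E \<Phi>"
  obtains S F \<rho> where "\<And>r. submodule (S r) (scalars K) E"
    "\<And>r s. r \<le> s \<Longrightarrow> S r \<subseteq> S s" "\<And>r. fin_dim K (E\<lparr>carrier := S r\<rparr>)"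
    "norm_topology E closure_of (\<Union>r. S r) = carrier E"
    "\<And>r :: nat. fd_quotient (S r) (F r) (\<rho> r)"
proof -
  obtain S :: "nat \<Rightarrow> 'e set" where S: "\<And>r. submodule (S r) (scalars K) E"
      "\<And>r. fin_dim K (E\<lparr>carrier := S r\<rparr>)" "\<And>r. S r \<subseteq> S (Suc r)"
      "norm_topology E closure_of (\<Union>r. S r) = carrier E"
      "\<And>r. ideal (annihilator B \<Phi> (S r)) B" "\<And>r. annihilator B \<Phi> (S r) \<noteq> carrier B"
    using assms unfolding ideal_exhaustion_def by metis
  have "\<forall>r. \<exists>F \<rho>. fd_quotient (S r) F \<rho>"
    using fd_quotient_exists[OF S(1,2,5,6)] by blast
  then obtain F \<rho> where "\<And>r. fd_quotient (S r) (F r) (\<rho> r)" by metis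
  then show thesis using that[of S F \<rho>] S lift_Suc_mono_le[of S, OF S(3)] by blast
qed

lemma fd_quotientD:
  assumes "fd_quotient S F \<rho>"
  shows "unital_banach_algebra K F" "fin_dim K F" "\<rho> \<in> alg_hom K B F" "\<rho> ` carrier B = carrier F"
    "\<lbrakk>b \<in> carrier B; c \<in> carrier B\<rbrakk> \<Longrightarrow> \<rho> b = \<rho> c \<longleftrightarrow> b \<ominus> c \<in> annihilator B \<Phi> S"
    "b \<in> carrier B \<Longrightarrow> \<parallel>\<rho> b\<parallel>\<^bsub>F\<^esub> \<le> \<parallel>b\<parallel>"
    "\<lbrakk>b \<in> carrier B; \<And>c. \<lbrakk>c \<in> carrier B; \<rho> c = \<rho> b\<rbrakk> \<Longrightarrow> m \<le> \<parallel>c\<parallel>\<rbrakk> \<Longrightarrow> m \<le> \<parallel>\<rho> b\<parallel>\<^bsub>F\<^esub>"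
    "continuous_map weak_star (norm_topology F) \<rho>"
  using assms unfolding fd_quotient_def by blast+

text \<open>The kernels of the quotient maps are exactly the annihilators of the \<open>S n\<close>,
  and these intersect in zero by density.\<close>

lemma ideal_exhaustion_imp_separating_homs:
  assumes "ideal_exhaustion K B E \<Phi>"
  shows "separating_homs TYPE(nat \<Rightarrow> complex) K B E \<Phi>"
proof -
  obtain S F \<rho> where S: "\<And>r. submodule (S r) (scalars K) E"
    "norm_topology E closure_of (\<Union>r. S r) = carrier E"
    and q: "\<And>r :: nat. fd_quotient (S r) (F r) (\<rho> r)"
    using ideal_exhaustionE[OF assms] by metis
  have zero: "\<rho> n \<zero> = \<zero>\<^bsub>F n\<^esub>" for n
  proof -
    interpret F: unital_banach_algebra K "F n" by (rule fd_quotientD(1)[OF q])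
    have "\<rho> n \<zero> = \<rho> n \<zero> \<oplus>\<^bsub>F n\<^esub> \<rho> n \<zero>"
      using alg_homD(2)[OF fd_quotientD(3)[OF q], of \<zero> \<zero>] by simp
    then show ?thesis
      using alg_homD(1)[OF fd_quotientD(3)[OF q], of \<zero>] by (metis F.add.r_cancel_one' zero_closed)
  qed
  have ker: "a_kernel B (F n) (\<rho> n) = annihilator B \<Phi> (S n)" for n
  proof -
    have "\<rho> n b = \<zero>\<^bsub>F n\<^esub> \<longleftrightarrow> b \<in> annihilator B \<Phi> (S n)" if "b \<in> carrier B" for b
      using fd_quotientD(5)[OF q, of b \<zero>] that zero by (simp add: a_minus_def)
    then show ?thesis by (auto simp: a_kernel_def' annihilator_def)
  qed
  have "\<zero> \<in> annihilator B \<Phi> (S n)" for n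
    using functional_zero[OF pair_linear_left] E.submoduleE(1)[OF S(1)] by (auto simp: annihilator_def)
  then have "(\<Inter>n. a_kernel B (F n) (\<rho> n)) = {\<zero>}"
    using annihilator_dense[OF S(2) E.submoduleE(1)[OF S(1)]]
    unfolding ker by (auto simp: annihilator_def)
  moreover have "unital_algebra K (F n) \<and> normed_space K (F n)" for n
  proof -
    interpret F: unital_banach_algebra K "F n" by (rule fd_quotientD(1)[OF q])
    show ?thesis by (intro conjI F.unital_algebra_axioms F.normed_space_axioms)
  qed
  ultimately show ?thesis
    unfolding separating_homs_def
    using fd_quotientD(2,3,8)[OF q] by (intro exI[of _ F] exI[of _ \<rho>] conjI allI) simp_all
qed

text \<open>Almost norm-preserving lifts of the coordinates of a bounded thread need not converge in norm,
  but by density and boundedness they converge pointwise on \<open>E\<close>, i.e. weak-star.\<close>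

lemma bounded_thread_lift:
  assumes S: "\<And>r. submodule (S r) (scalars K) E" "\<And>r s. r \<le> s \<Longrightarrow> S r \<subseteq> S s"
    "norm_topology E closure_of (\<Union>r. S r) = carrier E"
    and q: "\<And>r :: nat. fd_quotient (S r) (F r) (\<rho> r)"
    and c: "\<And>r. c r \<in> carrier B" "\<And>r s. r \<le> s \<Longrightarrow> \<rho> r (c s) = \<rho> r (c r)"
    and M: "0 \<le> M" "\<And>r. \<parallel>\<rho> r (c r)\<parallel>\<^bsub>F r\<^esub> \<le> M"
  obtains b where "b \<in> carrier B" "\<parallel>b\<parallel> \<le> M" "\<And>r. \<rho> r b = \<rho> r (c r)"
proof -
  have SE: "S r \<subseteq> carrier E" for r using E.submoduleE(1)[OF S(1)] .
  \<comment> \<open>The infimum over representatives need not be attained. The slack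
    \<open>inverse (real (Suc r))\<close> disappears in the limit, where the bound is exactly
    \<open>M\<close>.\<close>
  have "\<exists>d \<in> carrier B. \<rho> r d = \<rho> r (c r) \<and> \<parallel>d\<parallel> \<le> M + inverse (real (Suc r))" for r
  proof (rule ccontr)
    assume *: "\<not> ?thesis"
    have "M + inverse (real (Suc r)) \<le> \<parallel>\<rho> r (c r)\<parallel>\<^bsub>F r\<^esub>"
      by (rule fd_quotientD(7)[OF q c(1)]) (use * in fastforce)
    moreover have "0 < inverse (real (Suc r))" by simp
    ultimately show False using M(2)[of r] by linarith
  qed
  then obtain d where d: "\<And>r. d r \<in> carrier B" "\<And>r. \<rho> r (d r) = \<rho> r (c r)"
    "\<And>r. \<parallel>d r\<parallel> \<le> M + inverse (real (Suc r))" by metis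
  \<comment> \<open>From index \<open>s\<close> on, the lifts pair with \<open>e\<close> in a
    constant way. This is what replaces weak-star compactness.\<close>
  have d_const: "\<Phi> (d r) e = \<Phi> (c s) e" if e: "e \<in> S s" and r: "s \<le> r" for r s e
  proof -
    have "d r \<ominus> c r \<in> annihilator B \<Phi> (S r)" "c r \<ominus> c s \<in> annihilator B \<Phi> (S s)"
      using fd_quotientD(5)[OF q d(1)[of r] c(1)[of r], of r] d(2)[of r]
        fd_quotientD(5)[OF q c(1)[of r] c(1)[of s], of s] c(2)[OF r] by simp_all
    moreover have "e \<in> S r" "e \<in> carrier E" using e S(2)[OF r] SE by blast+
    ultimately have "\<Phi> (d r) e - \<Phi> (c r) e = 0" "\<Phi> (c r) e - \<Phi> (c s) e = 0"
      using e d(1) c(1) by (auto simp: annihilator_def pair_minus)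
    then show ?thesis by simp
  qed
  have dM: "\<parallel>d r\<parallel> \<le> M + 1" for r
  proof -
    have "inverse (real (Suc r)) \<le> 1" by (simp add: field_simps)
    then show ?thesis using d(3)[of r] by linarith
  qed
  have dense: "\<forall>x\<in>carrier E. \<forall>\<epsilon>>0. \<exists>y\<in>\<Union>r. S r. \<parallel>x \<ominus>\<^bsub>E\<^esub> y\<parallel>\<^bsub>E\<^esub> < \<epsilon>"
    using E.closure_eq_carrier_iff[of "\<Union>r. S r"] S(3) SE by blast
  have "convergent (\<lambda>r. \<Phi> (d r) e)" if e: "e \<in> carrier E" for e
  proof -
    have "Cauchy (\<lambda>r. \<Phi> (d r) e)"
    proof (rule CauchyI)
      fix \<epsilon> :: real assume "0 < \<epsilon>"
      then have "0 < \<epsilon> / (2 * (M + 1))" using M(1) by simp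
      then obtain y s where y: "y \<in> S s" "\<parallel>e \<ominus>\<^bsub>E\<^esub> y\<parallel>\<^bsub>E\<^esub> < \<epsilon> / (2 * (M + 1))" using dense e by blast
      have yE: "y \<in> carrier E" using y SE by blast
      \<comment> \<open>The pairing with \<open>y\<close> already has its final value
        \<open>\<Phi> (c s) y\<close>; only the distance from \<open>e\<close> to \<open>y\<close>
        contributes, with the uniform bound \<open>M + 1\<close> on the lifts. Two such terms add up
        to \<open>\<epsilon>\<close>.\<close>
      have near: "cmod (\<Phi> (d r) e - \<Phi> (c s) y) < \<epsilon> / 2" if "s \<le> r" for r
      proof -
        have "\<Phi> (d r) e - \<Phi> (c s) y = \<Phi> (d r) (e \<ominus>\<^bsub>E\<^esub> y)"
          using E.functional_minus[OF pair_linear[OF d(1)] e yE] d_const[OF y(1) that] by simp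
        then have "cmod (\<Phi> (d r) e - \<Phi> (c s) y) \<le> \<parallel>d r\<parallel> * \<parallel>e \<ominus>\<^bsub>E\<^esub> y\<parallel>\<^bsub>E\<^esub>"
          using pair_bound[OF d(1)] e yE by simp
        also have "\<dots> \<le> (M + 1) * \<parallel>e \<ominus>\<^bsub>E\<^esub> y\<parallel>\<^bsub>E\<^esub>"
          using dM e yE by (intro mult_right_mono) auto
        also have "\<dots> < (M + 1) * (\<epsilon> / (2 * (M + 1)))"
          using y M(1) by (intro mult_strict_left_mono) auto
        also have "\<dots> = \<epsilon> / 2" using M(1) by (simp add: field_simps)
        finally show ?thesis .
      qed
      show "\<exists>N. \<forall>m\<ge>N. \<forall>n\<ge>N. norm (\<Phi> (d m) e - \<Phi> (d n) e) < \<epsilon>"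
      proof (intro exI[of _ s] allI impI)
        fix m n assume "s \<le> m" "s \<le> n"
        then show "norm (\<Phi> (d m) e - \<Phi> (d n) e) < \<epsilon>"
          using norm_diff_triangle_less[OF near[of m], of "\<Phi> (d n) e" "\<epsilon> / 2"] near[of n]
          by (simp add: Real_Vector_Spaces.norm_minus_commute)
      qed
    qed
    then show ?thesis by (simp add: Cauchy_convergent_iff)
  qed
  define f where "f e = lim (\<lambda>r. \<Phi> (d r) e)" for e
  have f: "(\<lambda>r. \<Phi> (d r) e) \<longlonglongrightarrow> f e" if "e \<in> carrier E" for e
    using \<open>\<And>e. e \<in> carrier E \<Longrightarrow> convergent (\<lambda>r. \<Phi> (d r) e)\<close>[OF that]
    by (simp add: f_def convergent_LIMSEQ_iff)
  have flin: "f \<in> linear_maps K E (scalars K)"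
    by (rule E.linear_functional_limit[OF pair_linear[OF d(1)] f])
  have fM: "cmod (f e) \<le> M * \<parallel>e\<parallel>\<^bsub>E\<^esub>" if e: "e \<in> carrier E" for e
  proof (rule LIMSEQ_le)
    show "(\<lambda>r. cmod (\<Phi> (d r) e)) \<longlonglongrightarrow> cmod (f e)" by (intro tendsto_intros f e)
    have "(\<lambda>r. (M + inverse (real (Suc r))) * \<parallel>e\<parallel>\<^bsub>E\<^esub>) \<longlonglongrightarrow> (M + 0) * \<parallel>e\<parallel>\<^bsub>E\<^esub>"
      by (intro tendsto_intros LIMSEQ_inverse_real_of_nat)
    then show "(\<lambda>r. (M + inverse (real (Suc r))) * \<parallel>e\<parallel>\<^bsub>E\<^esub>) \<longlonglongrightarrow> M * \<parallel>e\<parallel>\<^bsub>E\<^esub>" by simp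
    have "cmod (\<Phi> (d r) e) \<le> (M + inverse (real (Suc r))) * \<parallel>e\<parallel>\<^bsub>E\<^esub>" for r
      using pair_bound[OF d(1) e, of r] mult_right_mono[OF d(3), of "\<parallel>e\<parallel>\<^bsub>E\<^esub>" r] e
      by (meson E.norm_nonneg order_trans)
    then show "\<exists>N. \<forall>r\<ge>N. cmod (\<Phi> (d r) e) \<le> (M + inverse (real (Suc r))) * \<parallel>e\<parallel>\<^bsub>E\<^esub>" by blast
  qed
  obtain b where b: "b \<in> carrier B" "\<parallel>b\<parallel> \<le> M" "\<And>e. e \<in> carrier E \<Longrightarrow> \<Phi> b e = f e"
    using pair_surj[OF flin M(1) fM] by blast
  have "\<rho> s b = \<rho> s (c s)" for s
  proof -
    have "\<Phi> b e = \<Phi> (c s) e" if e: "e \<in> S s" for e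
    proof -
      have "(\<lambda>r. \<Phi> (d r) e) \<longlonglongrightarrow> \<Phi> (c s) e"
        by (rule tendsto_eventually)
          (use d_const[OF e] in \<open>auto simp: eventually_sequentially intro!: exI[of _ s]\<close>)
      then have "f e = \<Phi> (c s) e" using LIMSEQ_unique[OF f] e SE by blast
      then show ?thesis using b(3)[of e] e SE by auto
    qed
    then have "b \<ominus> c s \<in> annihilator B \<Phi> (S s)"
      using b(1) c(1) SE by (auto simp: annihilator_def pair_minus subset_iff)
    then show ?thesis using fd_quotientD(5)[OF q b(1) c(1)] by simp
  qed
  then show thesis using that b by blast
qed

text \<open>The metric-quotient condition holds because all norms are quotient norms of
  \<open>B\<close>, and an infimum over a coset can be taken in two stages. Contractivity of the
  quotient maps and norm-controlled lifts of threads are the two halves of the isometry.\<close>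

lemma ideal_exhaustion_imp_inverse_limit:
  assumes "ideal_exhaustion K B E \<Phi>"
  shows "is_bounded_inverse_limit TYPE(nat \<Rightarrow> complex) K B"
proof -
  obtain S F \<rho> where S: "\<And>r. submodule (S r) (scalars K) E" "\<And>r s. r \<le> s \<Longrightarrow> S r \<subseteq> S s"
    "norm_topology E closure_of (\<Union>r. S r) = carrier E"
    and q: "\<And>r :: nat. fd_quotient (S r) (F r) (\<rho> r)"
    using ideal_exhaustionE[OF assms] by metis
  note hom = alg_homD[OF fd_quotientD(3)[OF q]] and onto = fd_quotientD(4)[OF q, symmetric]
  have \<rho>_mono: "\<rho> r b = \<rho> r c" if "r \<le> s" "b \<in> carrier B" "c \<in> carrier B" "\<rho> s b = \<rho> s c" for r s b c
    using fd_quotientD(5)[OF q, of b c] that S(2)[OF that(1)] by (auto simp: annihilator_def)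
  \<comment> \<open>Any preimage under \<open>\<rho> s\<close> will do: for \<open>r \<le> s\<close>
    the annihilator of \<open>S s\<close> lies in that of \<open>S r\<close>, so
    \<open>\<rho> r\<close> is constant on the fibres of \<open>\<rho> s\<close>.\<close>
  define \<pi> where "\<pi> r s x = \<rho> r (inv_into (carrier B) (\<rho> s) x)" for r s x
  have \<pi>: "\<pi> r s (\<rho> s b) = \<rho> r b" if "r \<le> s" "b \<in> carrier B" for r s b
    unfolding \<pi>_def using that by (intro \<rho>_mono[OF that(1)]) (auto intro: inv_into_into f_inv_into_f)
  have nonneg: "0 \<le> \<parallel>y\<parallel>\<^bsub>F r\<^esub>" if "y \<in> carrier (F r)" for r y
  proof -
    interpret F: unital_banach_algebra K "F r" by (rule fd_quotientD(1)[OF q])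
    interpret F: nspace K "F r" by (intro nspace.intro scalar_field_axioms F.normed_space_axioms)
    show ?thesis using that by simp
  qed
  have sys: "metric_inverse_system K F \<pi>"
  proof (rule metric_inverse_system.intro)
    fix r s :: nat assume rs: "r \<le> s"
    show "\<pi> r s \<in> alg_hom K (F s) (F r)"
      by (rule alg_homI)
        (auto simp: onto \<pi>[OF rs] hom(1) simp flip: hom(2-5) simp: hom(5)[symmetric])
    show "\<pi> r s ` carrier (F s) = carrier (F r)"
      using \<pi>[OF rs] by (auto simp: onto image_iff)
    fix x assume "x \<in> carrier (F r)"
    then obtain b where b: "b \<in> carrier B" "x = \<rho> r b" by (auto simp: onto)
    let ?N = "{y \<in> carrier (F s). \<pi> r s y = x}"
    have bdd: "bdd_below ((\<lambda>y. \<parallel>y\<parallel>\<^bsub>F s\<^esub>) ` ?N)" by (rule bdd_belowI2[where m = 0]) (auto intro: nonneg)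
    show "\<parallel>x\<parallel>\<^bsub>F r\<^esub> = (INF y \<in> ?N. \<parallel>y\<parallel>\<^bsub>F s\<^esub>)"
    proof (rule antisym)
      show "\<parallel>x\<parallel>\<^bsub>F r\<^esub> \<le> (INF y \<in> ?N. \<parallel>y\<parallel>\<^bsub>F s\<^esub>)"
      proof (rule cINF_greatest)
        show "?N \<noteq> {}" using b \<pi>[OF rs b(1)] by (auto simp: onto)
        fix y assume "y \<in> ?N"
        then obtain c where c: "c \<in> carrier B" "y = \<rho> s c" "\<rho> r c = x" using \<pi>[OF rs] by (auto simp: onto)
        show "\<parallel>x\<parallel>\<^bsub>F r\<^esub> \<le> \<parallel>y\<parallel>\<^bsub>F s\<^esub>"
          unfolding c(2)
        proof (rule fd_quotientD(7)[OF q c(1)])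
          fix d assume d: "d \<in> carrier B" "\<rho> s d = \<rho> s c"
          have "x = \<rho> r d" using \<rho>_mono[OF rs d(1) c(1) d(2)] c(3) by simp
          then show "\<parallel>x\<parallel>\<^bsub>F r\<^esub> \<le> \<parallel>d\<parallel>" using fd_quotientD(6)[OF q d(1)] by simp
        qed
      qed
      show "(INF y \<in> ?N. \<parallel>y\<parallel>\<^bsub>F s\<^esub>) \<le> \<parallel>x\<parallel>\<^bsub>F r\<^esub>"
        unfolding b(2)
      proof (rule fd_quotientD(7)[OF q b(1)])
        fix c assume c: "c \<in> carrier B" "\<rho> r c = \<rho> r b"
        have "(INF y \<in> ?N. \<parallel>y\<parallel>\<^bsub>F s\<^esub>) \<le> \<parallel>\<rho> s c\<parallel>\<^bsub>F s\<^esub>"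
          using c b \<pi>[OF rs c(1)] by (intro cINF_lower[OF bdd]) (auto simp: onto)
        also have "\<dots> \<le> \<parallel>c\<parallel>" by (rule fd_quotientD(6)[OF q c(1)])
        finally show "(INF y \<in> {y \<in> carrier (F s). \<pi> r s y = \<rho> r b}. \<parallel>y\<parallel>\<^bsub>F s\<^esub>) \<le> \<parallel>c\<parallel>"
          using b by simp
      qed
    qed
  next
    fix r s t :: nat and x assume rs: "r \<le> s" "s \<le> t" and "x \<in> carrier (F t)"
    then obtain b where "b \<in> carrier B" "x = \<rho> t b" by (auto simp: onto)
    then show "\<pi> r s (\<pi> s t x) = \<pi> r t x" using rs by (simp add: \<pi>)
  qed (use fd_quotientD(1,2)[OF q] in auto)
  define \<Psi> where "\<Psi> b = (\<lambda>r. \<rho> r b)" for b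
  let ?L = "bounded_inverse_limit F \<pi>"
  have \<rho>_le: "\<parallel>\<rho> r b\<parallel>\<^bsub>F r\<^esub> \<le> \<parallel>b\<parallel>" if "b \<in> carrier B" for r b
    by (rule fd_quotientD(6)[OF q that])
  have L_carrier: "carrier ?L = {a. (\<forall>r. a r \<in> carrier (F r)) \<and> (\<forall>r s. r \<le> s \<longrightarrow> \<pi> r s (a s) = a r) \<and>
      bdd_above (range (\<lambda>r. \<parallel>a r\<parallel>\<^bsub>F r\<^esub>))}"
    and L_norm: "\<parallel>a\<parallel>\<^bsub>?L\<^esub> = (SUP r. \<parallel>a r\<parallel>\<^bsub>F r\<^esub>)" for a
    by (simp_all add: bounded_inverse_limit_def)
  have \<Psi>_in: "\<Psi> b \<in> carrier ?L" if "b \<in> carrier B" for b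
    using that \<rho>_le[OF that] by (auto simp: L_carrier \<Psi>_def hom(1) \<pi> intro!: bdd_aboveI2)
  have \<Psi>_hom: "\<Psi> \<in> alg_hom K B ?L"
    by (rule alg_homI) (use \<Psi>_in in \<open>auto simp: \<Psi>_def bounded_inverse_limit_def hom\<close>)
  have lift: "\<exists>b \<in> carrier B. \<Psi> b = a \<and> \<parallel>b\<parallel> \<le> \<parallel>a\<parallel>\<^bsub>?L\<^esub>" if a: "a \<in> carrier ?L" for a
  proof -
    have aF: "a r \<in> carrier (F r)" and a\<pi>: "r \<le> s \<Longrightarrow> \<pi> r s (a s) = a r" for r s
      using a by (auto simp: L_carrier)
    have "\<forall>r. \<exists>c \<in> carrier B. \<rho> r c = a r" using aF by (metis imageE onto)
    then obtain c where c: "\<And>r. c r \<in> carrier B" "\<And>r. \<rho> r (c r) = a r" by metis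
    have bdd: "bdd_above (range (\<lambda>r. \<parallel>a r\<parallel>\<^bsub>F r\<^esub>))" using a by (simp add: L_carrier)
    have le: "\<parallel>a r\<parallel>\<^bsub>F r\<^esub> \<le> \<parallel>a\<parallel>\<^bsub>?L\<^esub>" for r unfolding L_norm by (rule cSUP_upper[OF _ bdd]) simp
    have cc: "\<rho> r (c s) = \<rho> r (c r)" if "r \<le> s" for r s
      using \<pi>[OF that c(1)[of s]] a\<pi>[OF that] by (simp add: c(2))
    have "0 \<le> \<parallel>a\<parallel>\<^bsub>?L\<^esub>" using nonneg[OF aF] le order_trans by blast
    moreover have "\<parallel>\<rho> r (c r)\<parallel>\<^bsub>F r\<^esub> \<le> \<parallel>a\<parallel>\<^bsub>?L\<^esub>" for r using le c(2) by simp
    ultimately obtain b where "b \<in> carrier B" "\<parallel>b\<parallel> \<le> \<parallel>a\<parallel>\<^bsub>?L\<^esub>" "\<And>r. \<rho> r b = \<rho> r (c r)"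
      using bounded_thread_lift[OF S q c(1) cc] by metis
    then show ?thesis by (intro bexI[of _ b]) (auto simp: \<Psi>_def c(2))
  qed
  have \<Psi>_inj: "b = c" if "b \<in> carrier B" "c \<in> carrier B" "\<Psi> b = \<Psi> c" for b c
  proof -
    have "b \<ominus> c \<in> annihilator B \<Phi> (S r)" for r
      using fd_quotientD(5)[OF q that(1,2), of r] fun_cong[OF that(3), of r] by (simp add: \<Psi>_def)
    then have "b \<ominus> c = \<zero>"
      using annihilator_dense[OF S(3) E.submoduleE(1)[OF S(1)]] that by simp
    then show ?thesis using minus_eq_zero_iff that by simp
  qed
  have "bij_isometry B ?L \<Psi>"
    unfolding bij_isometry_def bij_betw_def
  proof (intro conjI ballI)
    show "inj_on \<Psi> (carrier B)" using \<Psi>_inj by (auto simp: inj_on_def)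
    show "\<Psi> ` carrier B = carrier ?L" using \<Psi>_in lift by (auto simp: image_iff)
    fix b assume b: "b \<in> carrier B"
    \<comment> \<open>By injectivity the lift of \<open>\<Psi> b\<close> is \<open>b\<close> itself,
      so the norm bound of the lift is the lower estimate for \<open>\<Psi>\<close>.\<close>
    obtain c where c: "c \<in> carrier B" "\<Psi> c = \<Psi> b" "\<parallel>c\<parallel> \<le> \<parallel>\<Psi> b\<parallel>\<^bsub>?L\<^esub>" using lift[OF \<Psi>_in[OF b]] by blast
    have "\<parallel>\<Psi> b\<parallel>\<^bsub>?L\<^esub> \<le> \<parallel>b\<parallel>" unfolding L_norm by (rule cSUP_least) (use \<rho>_le[OF b] in \<open>auto simp: \<Psi>_def\<close>)
    then show "\<parallel>\<Psi> b\<parallel>\<^bsub>?L\<^esub> = \<parallel>b\<parallel>" using c \<Psi>_inj[OF c(1) b c(2)] by simp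
  qed
  then show ?thesis unfolding is_bounded_inverse_limit_def using sys \<Psi>_hom by blast
qed

end

section \<open>From separating homomorphisms to ideal exhaustions\<close>

context nspace
begin

text \<open>The Hahn-Banach theorem for \<open>setdist_from U\<close>, a seminorm that is at most
  the norm, vanishes on \<open>U\<close> and is at least \<open>\<epsilon>\<close> at
  \<open>x\<close>, where the functional attains it.\<close>

lemma separating_functional:
  assumes U: "submodule U (scalars K) V" and x: "x \<in> carrier V"
    and \<epsilon>: "0 < \<epsilon>" "\<And>y. y \<in> U \<Longrightarrow> \<epsilon> \<le> \<parallel>x \<ominus> y\<parallel>"
  obtains f where "f \<in> linear_maps K V (scalars K)" "\<And>v. v \<in> carrier V \<Longrightarrow> cmod (f v) \<le> \<parallel>v\<parallel>"
    "\<And>y. y \<in> U \<Longrightarrow> f y = 0" "f x \<noteq> 0"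
proof -
  let ?p = "setdist_from U"
  have UV: "y \<in> carrier V" if "y \<in> U" for y using submoduleE(1)[OF U] that by blast
  note le = setdist_le[OF U] and ge = setdist_ge[OF U]
  have norm: "?p z \<le> \<parallel>z\<parallel>" if "z \<in> carrier V" for z
    using le[OF that zero_in_submodule[OF U]] that by (simp add: a_minus_def minus_eq_smult)
  have on_U: "?p y \<le> 0" if "y \<in> U" for y
    using le[OF UV[OF that] that] UV[OF that] by (simp add: a_minus_def M.r_neg)
  obtain f where f: "f \<in> linear_maps K V (scalars K)" "f x = complex_of_real (?p x)"
    "\<And>v. v \<in> carrier V \<Longrightarrow> cmod (f v) \<le> ?p v"
    using hahn_banach[OF x setdist_add[OF U] setdist_smult[OF U]] by blast
  show thesis
  proof (rule that[OF f(1)])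
    show "cmod (f v) \<le> \<parallel>v\<parallel>" if "v \<in> carrier V" for v using f(3)[OF that] norm[OF that] by linarith
    show "f y = 0" if "y \<in> U" for y using f(3)[OF UV[OF that]] on_U[OF that] by (smt (verit) norm_le_zero_iff)
    have "\<epsilon> \<le> ?p x" by (rule ge) (rule \<epsilon>(2))
    then show "f x \<noteq> 0" using \<epsilon>(1) f(2) by simp
  qed
qed

lemma norming_functional:
  assumes "x \<in> carrier V"
  shows "\<exists>f \<in> linear_maps K V (scalars K). f x = complex_of_real \<parallel>x\<parallel> \<and>
    (\<forall>v \<in> carrier V. cmod (f v) \<le> \<parallel>v\<parallel>)"
  by (rule hahn_banach[OF assms, of "mnorm V"]) (auto intro: mnorm_triangle mnorm_smult)

text \<open>Combinations of the spanning vectors with coefficients in a countable dense subset of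
  \<open>K\<close> approximate every element of every \<open>S r\<close>, hence of the
  space.\<close>

lemma separable_fd_exhaustion:
  assumes S: "\<And>r :: nat. submodule (S r) (scalars K) V" "\<And>r. fin_dim K (V\<lparr>carrier := S r\<rparr>)"
    "norm_topology V closure_of (\<Union>r. S r) = carrier V"
  shows "separable_space (norm_topology V)"
proof -
  interpret Metric_space "carrier V" "ndist V" by (rule Metric_space_ndist)
  have SV: "S r \<subseteq> carrier V" for r using submoduleE(1)[OF S(1)] .
  have "\<exists>k :: nat. \<exists>e. (\<forall>i<k. e i \<in> S r) \<and>
      (\<forall>v \<in> S r. \<exists>c. (\<forall>i. c i \<in> K) \<and> v = (\<Oplus>i\<in>{..<k}. c i \<odot> e i))" for r
    by (rule fin_dim_submoduleE[OF S(1,2), of r]) blast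
  then obtain k :: "nat \<Rightarrow> nat" and e where e: "\<And>r i. i < k r \<Longrightarrow> e r i \<in> S r"
    and span: "\<And>r v. v \<in> S r \<Longrightarrow> \<exists>c. (\<forall>i. c i \<in> K) \<and> v = (\<Oplus>i\<in>{..<k r}. c i \<odot> e r i)"
    by metis
  have eV: "e r i \<in> carrier V" if "i < k r" for r i using e[OF that] SV by blast
  have USV: "(\<Union>r. S r) \<subseteq> carrier V" using SV by blast
  note dense = closure_eq_carrier_iff[OF USV, THEN iffD1, OF S(3)]
  obtain Q where Q: "countable Q" "Q \<subseteq> K" "K \<subseteq> closure Q" using separable[of K] by blast
  \<comment> \<open>Extensional families of coefficients keep this set of families countable;
    unrestricted functions on the naturals could be uncountably many.\<close>
  define C where "C = (\<Union>r. (\<lambda>c. \<Oplus>i\<in>{..<k r}. c i \<odot> e r i) ` ({..<k r} \<rightarrow>\<^sub>E Q))"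
  have "countable C"
    unfolding C_def by (intro countable_UN countable_image countable_PiE) (auto simp: Q)
  moreover have CV: "C \<subseteq> carrier V"
  proof -
    have "(\<Oplus>i\<in>{..<k r}. c i \<odot> e r i) \<in> carrier V" if "c \<in> {..<k r} \<rightarrow>\<^sub>E Q" for c r
      using that Q(2) eV by (intro M.finsum_closed) (auto simp: PiE_iff)
    then show ?thesis by (auto simp: C_def)
  qed
  moreover have "\<exists>z\<in>C. \<parallel>x \<ominus> z\<parallel> < \<epsilon>" if x: "x \<in> carrier V" and \<epsilon>: "0 < \<epsilon>" for x \<epsilon>
  proof -
    have "\<exists>y\<in>\<Union>r. S r. \<parallel>x \<ominus> y\<parallel> < \<epsilon> / 2"
      using dense[rule_format, OF x, of "\<epsilon> / 2"] \<epsilon> by simp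
    then obtain r y where y: "y \<in> S r" "\<parallel>x \<ominus> y\<parallel> < \<epsilon> / 2" by blast
    obtain c where c': "\<forall>i. c i \<in> K" "y = (\<Oplus>i\<in>{..<k r}. c i \<odot> e r i)"
      using span[OF y(1)] by blast
    note c = c'(1)[rule_format] c'(2)
    define n where "n = (\<Sum>i<k r. \<parallel>e r i\<parallel>)"
    have n: "0 \<le> n" unfolding n_def using eV by (intro sum_nonneg) auto
    \<comment> \<open>Changing each coefficient by at most \<open>\<delta>\<close> moves the
      combination by less than \<open>\<epsilon> / 2\<close>; the summand 1 covers the case that all
      spanning vectors vanish.\<close>
    define \<delta> where "\<delta> = \<epsilon> / (2 * (n + 1))"
    have \<delta>: "0 < \<delta>" using \<epsilon> n by (simp add: \<delta>_def)
    have "\<exists>q. q \<in> Q \<and> dist q (c i) < \<delta>" for i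
      using subsetD[OF Q(3) c(1)] \<delta> by (auto simp: closure_approachable)
    then obtain q where q: "\<And>i. q i \<in> Q" "\<And>i. dist (q i) (c i) < \<delta>" by metis
    have qK: "q i \<in> K" for i using q(1) Q(2) by blast
    define z where "z = (\<Oplus>i\<in>{..<k r}. q i \<odot> e r i)"
    have "z = (\<Oplus>i\<in>{..<k r}. restrict q {..<k r} i \<odot> e r i)"
      unfolding z_def using eV qK by (intro M.finsum_cong') auto
    moreover have "restrict q {..<k r} \<in> {..<k r} \<rightarrow>\<^sub>E Q" using q(1) by simp
    ultimately have zC: "z \<in> C" unfolding C_def by (intro UN_I[OF UNIV_I] image_eqI)
    have "y \<ominus> z = (\<Oplus>i\<in>{..<k r}. (c i - q i) \<odot> e r i)"
      unfolding c(2) z_def using c(1) qK eV by (intro finsum_smult_diff) auto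
    also have "\<parallel>\<dots>\<parallel> \<le> (\<Sum>i<k r. \<parallel>(c i - q i) \<odot> e r i\<parallel>)"
      using c(1) qK eV by (intro norm_finsum) auto
    also have "\<dots> \<le> (\<Sum>i<k r. \<delta> * \<parallel>e r i\<parallel>)"
    proof (rule sum_mono)
      fix i assume i: "i \<in> {..<k r}"
      have "cmod (c i - q i) \<le> \<delta>" using q(2)[of i] by (simp add: dist_norm Real_Vector_Spaces.norm_minus_commute)
      then show "\<parallel>(c i - q i) \<odot> e r i\<parallel> \<le> \<delta> * \<parallel>e r i\<parallel>"
        using i c(1) qK eV by (subst mnorm_smult) (auto intro!: mult_right_mono)
    qed
    also have "\<dots> = \<delta> * n" by (simp add: n_def sum_distrib_left)
    also have "\<dots> < \<delta> * (n + 1)" using \<delta> by simp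
    also have "\<dots> = \<epsilon> / 2" using n by (simp add: \<delta>_def field_simps)
    finally have "\<parallel>y \<ominus> z\<parallel> < \<epsilon> / 2" .
    moreover have "\<parallel>x \<ominus> z\<parallel> \<le> \<parallel>x \<ominus> y\<parallel> + \<parallel>y \<ominus> z\<parallel>"
      using x y SV zC CV by (intro norm_triangle_minus) auto
    ultimately have "\<parallel>x \<ominus> z\<parallel> < \<epsilon>" using y(2) by linarith
    then show ?thesis using zC by blast
  qed
  ultimately show ?thesis
    unfolding separable_space_def using closure_eq_carrier_iff[OF CV] by auto
qed

end

context dual_algebra
begin

lemma contraction_represented:
  assumes "f \<in> linear_maps K E (scalars K)" "\<forall>v \<in> carrier E. cmod (f v) \<le> \<parallel>v\<parallel>\<^bsub>E\<^esub>"
  shows "\<exists>b \<in> carrier B. \<forall>e \<in> carrier E. \<Phi> b e = f e"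
  by (rule pair_surj[OF assms(1), of 1]) (use assms(2) in auto)

text \<open>Induction over the generation of the topology: for an intersection the finite sets are
  united and the smaller radius is kept, while one member suffices for a union.\<close>

lemma weak_star_neighbourhood:
  assumes "openin (weak_star_topology K E) U" "f \<in> U"
  shows "\<exists>T \<delta>. finite T \<and> T \<subseteq> carrier E \<and> 0 < \<delta> \<and>
    (\<forall>g \<in> carrier (dual_space K E). (\<forall>e\<in>T. cmod (g e - f e) < \<delta>) \<longrightarrow> g \<in> U)"
proof -
  have "generate_topology_on {{f \<in> carrier (dual_space K E). f e \<in> U} |e U. e \<in> carrier E \<and> open U} U"
    using assms(1) unfolding weak_star_topology_def by (rule openin_topology_generated_by)
  then show ?thesis using assms(2)
  proof (induction U)
    case Empty
    then show ?case by simp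
  next
    case (Int U U')
    obtain T \<delta> where T: "finite T" "T \<subseteq> carrier E" "0 < \<delta>"
      "\<forall>g \<in> carrier (dual_space K E). (\<forall>e\<in>T. cmod (g e - f e) < \<delta>) \<longrightarrow> g \<in> U"
      using Int.IH(1)[OF IntD1[OF Int.prems]] by (elim exE conjE)
    obtain T' \<delta>' where T': "finite T'" "T' \<subseteq> carrier E" "0 < \<delta>'"
      "\<forall>g \<in> carrier (dual_space K E). (\<forall>e\<in>T'. cmod (g e - f e) < \<delta>') \<longrightarrow> g \<in> U'"
      using Int.IH(2)[OF IntD2[OF Int.prems]] by (elim exE conjE)
    show ?case
      using T T' by (intro exI[of _ "T \<union> T'"] exI[of _ "min \<delta> \<delta>'"]) auto
  next
    case (UN \<U>)
    then obtain U where U: "U \<in> \<U>" "f \<in> U" by blast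
    from UN.IH[OF this] obtain T \<delta> where T: "finite T" "T \<subseteq> carrier E" "0 < \<delta>"
      "\<forall>g \<in> carrier (dual_space K E). (\<forall>e\<in>T. cmod (g e - f e) < \<delta>) \<longrightarrow> g \<in> U"
      by (elim exE conjE)
    then show ?case using U(1) by (intro exI[of _ T] exI[of _ \<delta>]) auto
  next
    case (Basis U)
    then obtain e W where e: "e \<in> carrier E" "open W" "U = {f \<in> carrier (dual_space K E). f e \<in> W}"
      by blast
    then have "f e \<in> W" using Basis.prems by simp
    then obtain \<delta> where "0 < \<delta>" "\<forall>y. dist y (f e) < \<delta> \<longrightarrow> y \<in> W"
      using e(2) unfolding open_dist by blast
    then show ?case using e by (intro exI[of _ "{e}"] exI[of _ \<delta>]) (auto simp: dist_norm)
  qed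
qed

text \<open>Some weak-star neighbourhood of zero is mapped into the open unit ball. It contains the
  common kernel of finitely many pairings, a linear subspace; the image of that is a subspace inside
  the ball and hence zero.\<close>

lemma weak_star_continuous_kernel:
  assumes F: "normed_space K F" and \<rho>: "\<rho> \<in> alg_hom K B F"
    and cont: "continuous_map weak_star (norm_topology F) \<rho>"
  shows "\<exists>T. finite T \<and> T \<subseteq> carrier E \<and>
    (\<forall>b \<in> carrier B. (\<forall>e\<in>T. \<Phi> b e = 0) \<longrightarrow> \<rho> b = \<zero>\<^bsub>F\<^esub>)"
proof -
  interpret F: nspace K F by (intro nspace.intro scalar_field_axioms F)
  interpret FM: Metric_space "carrier F" "ndist F" by (rule F.Metric_space_ndist)
  note hom = alg_homD[OF \<rho>]
  have \<rho>0: "\<rho> \<zero> = \<zero>\<^bsub>F\<^esub>" using hom(4)[of 0 \<zero>] hom(1)[of \<zero>] by simp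
  obtain U where U: "openin weak_star U" "\<zero> \<in> U" "\<forall>y\<in>U. \<rho> y \<in> FM.mball (\<rho> \<zero>) 1"
    using cont unfolding FM.continuous_map_to_metric topspace_weak_star
    by (meson zero_closed zero_less_one)
  obtain W where W: "openin (weak_star_topology K E) W" "U = \<Phi> -` W \<inter> carrier B"
    using U(1) unfolding openin_pullback_topology by blast
  then have "\<Phi> \<zero> \<in> W" using U(2) by blast
  from weak_star_neighbourhood[OF W(1) this] obtain T \<delta> where T: "finite T" "T \<subseteq> carrier E" "0 < \<delta>"
    "\<forall>g \<in> carrier (dual_space K E). (\<forall>e\<in>T. cmod (g e - \<Phi> \<zero> e) < \<delta>) \<longrightarrow> g \<in> W" by blast
  have "\<rho> b = \<zero>\<^bsub>F\<^esub>" if b: "b \<in> carrier B" and b0: "\<forall>e\<in>T. \<Phi> b e = 0" for b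
  proof (rule ccontr)
    assume "\<rho> b \<noteq> \<zero>\<^bsub>F\<^esub>"
    then have n: "0 < \<parallel>\<rho> b\<parallel>\<^bsub>F\<^esub>"
      using F.mnorm_eq_zero_iff[OF hom(1)[OF b]] F.norm_nonneg[OF hom(1)[OF b]] by linarith
    \<comment> \<open>Scales \<open>\<rho> b\<close> to norm 1, just outside the open unit
      ball.\<close>
    define t where "t = complex_of_real (1 / \<parallel>\<rho> b\<parallel>\<^bsub>F\<^esub>)"
    have t: "t \<in> K" unfolding t_def by blast
    have "cmod (\<Phi> (t \<odot> b) e - \<Phi> \<zero> e) < \<delta>" if "e \<in> T" for e
      using that b0 T(2,3) pair_smult[OF t b, of e] functional_zero[OF pair_linear_left, of e] by auto
    then have "t \<odot> b \<in> U" using T(4) W(2) pair_in_dual t b by auto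
    then have "\<rho> (t \<odot> b) \<in> FM.mball (\<rho> \<zero>) 1" using U(3) by blast
    then have "\<parallel>\<zero>\<^bsub>F\<^esub> \<ominus>\<^bsub>F\<^esub> \<rho> (t \<odot> b)\<parallel>\<^bsub>F\<^esub> < 1" using F.ndist_eq[OF F.M.zero_closed] by (auto simp: \<rho>0)
    then have "\<parallel>t \<odot>\<^bsub>F\<^esub> \<rho> b\<parallel>\<^bsub>F\<^esub> < 1" using hom(1)[OF b] hom(4)[OF t b] t by (simp add: a_minus_def)
    then show False
      using F.mnorm_smult[OF t hom(1)[OF b]] n by (simp add: t_def norm_divide)
  qed
  then show ?thesis using T(1,2) by blast
qed

text \<open>Modulo \<open>J\<close>, elements of \<open>B\<close> are determined by their pairings
  with the finite set \<open>T\<close>. In these coordinates the bipolar theorem shows that the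
  preannihilator \<open>S\<close> recovers \<open>J\<close>. Its dimension is finite because
  finitely many elements span \<open>B\<close> modulo \<open>J\<close>, and these separate the
  points of \<open>S\<close>.\<close>

lemma finite_codim_annihilator:
  assumes J: "submodule J (scalars K) B" and T: "finite T" "T \<subseteq> carrier E"
    and TJ: "\<forall>b \<in> carrier B. (\<forall>e\<in>T. \<Phi> b e = 0) \<longrightarrow> b \<in> J"
  defines "S \<equiv> {v \<in> carrier E. \<forall>b\<in>J. \<Phi> b v = 0}"
  shows "submodule S (scalars K) E" "fin_dim K (E\<lparr>carrier := S\<rparr>)" "annihilator B \<Phi> S = J"
proof -
  note sub = submoduleE[OF J]
  note lin = linear_functionalD[OF pair_linear]
  have JB: "b \<in> carrier B" if "b \<in> J" for b using sub(1) that by blast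
  show S: "submodule S (scalars K) E"
    by (rule E.submoduleI') (auto simp: S_def lin JB E.functional_zero[OF pair_linear])
  obtain h where h: "bij_betw h {0..<card T} T" using ex_bij_betw_nat_finite[OF T(1)] by blast
  define k where "k = card T"
  have hT: "h ` {..<k} = T" using h by (simp add: bij_betw_def lessThan_atLeast0 k_def)
  have hE: "h i \<in> carrier E" if "i < k" for i using hT that T(2) by blast
  have TJ': "b \<in> J" if "b \<in> carrier B" "\<forall>i<k. \<Phi> b (h i) = 0" for b
    using TJ that hT by auto
  define r where "r b = (\<lambda>i. if i < k then \<Phi> b (h i) else 0)" for b
  have coord: "coord_space K (r ` H)" if "submodule H (scalars K) B" for H
    unfolding r_def using that pair_linear_left hE by (intro coord_space_image) auto
  show "annihilator B \<Phi> S = J"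
  proof (intro equalityI subsetI)
    fix b assume "b \<in> annihilator B \<Phi> S"
    then have b: "b \<in> carrier B" "\<And>v. v \<in> S \<Longrightarrow> \<Phi> b v = 0" by (auto simp: annihilator_def)
    have "\<exists>w\<in>r ` J. \<forall>i<k. w i = r b i"
    proof (rule coord_bipolar[OF coord[OF J]])
      show "r b i \<in> K" for i using b(1) by (auto simp: r_def lin(1) hE)
      fix c :: "nat \<Rightarrow> complex"
      assume c: "\<And>i. c i \<in> K" "\<And>w. w \<in> r ` J \<Longrightarrow> (\<Sum>i<k. c i * w i) = 0"
      \<comment> \<open>A functional \<open>c\<close> on coordinates is the pairing with a
        combination \<open>v\<close> of elements of \<open>T\<close>; that it vanishes on the image
        of \<open>J\<close> says that \<open>v\<close> lies in \<open>S\<close>.\<close>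
      define v where "v = (\<Oplus>\<^bsub>E\<^esub>i\<in>{..<k}. c i \<odot>\<^bsub>E\<^esub> h i)"
      have \<Phi>v: "\<Phi> d v = (\<Sum>i<k. c i * r d i)" if d: "d \<in> carrier B" for d
      proof -
        have "\<Phi> d v = (\<Sum>i<k. \<Phi> d (c i \<odot>\<^bsub>E\<^esub> h i))"
          unfolding v_def using c(1) hE by (intro E.functional_finsum pair_linear d) auto
        then show ?thesis using c(1) hE d by (simp add: r_def lin(3))
      qed
      have "v \<in> carrier E" unfolding v_def using c(1) hE by (intro E.M.finsum_closed) auto
      then have "v \<in> S" using c(2) \<Phi>v JB by (auto simp: S_def)
      then show "(\<Sum>i<k. c i * r b i) = 0" using b(2)[of v] \<Phi>v[OF b(1)] by simp
    qed
    \<comment> \<open>\<open>b\<close> and \<open>b'\<close> have the same pairings with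
      \<open>T\<close>, so \<open>TJ\<close> puts their difference into \<open>J\<close>.\<close>
    then obtain b' where b': "b' \<in> J" "\<forall>i<k. r b' i = r b i" by blast
    then have "\<forall>i<k. \<Phi> (b \<ominus> b') (h i) = 0" using b(1) JB hE by (simp add: pair_minus r_def)
    then have "b \<ominus> b' \<in> J" using TJ' b(1) JB[OF b'(1)] by simp
    then have "(b \<ominus> b') \<oplus> b' \<in> J" using b'(1) sub(5) by blast
    then show "b \<in> J" using b(1) JB[OF b'(1)] by (simp add: a_minus_def a_assoc l_neg)
  qed (auto simp: annihilator_def S_def JB)
  show "fin_dim K (E\<lparr>carrier := S\<rparr>)"
  proof -
    from coord_spanning[OF coord[OF carrier_is_submodule], of k] obtain I \<gamma>
      where I: "finite I" "I \<subseteq> r ` carrier B" and \<gamma>: "\<forall>s j. \<gamma> s j \<in> K"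
        and rep: "\<forall>w\<in>r ` carrier B. \<forall>i<k. w i = (\<Sum>s\<in>I. (\<Sum>j<k. \<gamma> s j * w j) * s i)"
      by (elim exE conjE)
    obtain g where g: "bij_betw g {0..<card I} I" using ex_bij_betw_nat_finite[OF I(1)] by blast
    \<comment> \<open>Elements of \<open>B\<close> whose coordinates span those of all of
      \<open>B\<close>; they span \<open>B\<close> modulo \<open>J\<close>.\<close>
    define u where "u i = inv_into (carrier B) r (g i)" for i
    have gI: "g ` {..<card I} = I" "inj_on g {..<card I}"
      using g by (auto simp: bij_betw_def lessThan_atLeast0)
    have u: "u i \<in> carrier B" "r (u i) = g i" if "i < card I" for i
    proof -
      have "g i \<in> r ` carrier B" using gI I(2) that by blast
      then show "u i \<in> carrier B" "r (u i) = g i"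
        by (auto simp: u_def inv_into_into f_inv_into_f)
    qed
    interpret S: kspace K "E\<lparr>carrier := S\<rparr>" by (rule E.kspace_submodule[OF S])
    have SE: "S \<subseteq> carrier E" by (auto simp: S_def)
    show ?thesis
    proof (rule S.fin_dim_functionals[where k = "card I" and \<rho> = "\<lambda>i v. \<Phi> (u i) v"])
      show "\<forall>i<card I. \<Phi> (u i) \<in> linear_maps K (E\<lparr>carrier := S\<rparr>) (scalars K)"
        using SE u(1) by (auto simp: linear_functional_iff lin subset_iff)
      show "\<forall>v\<in>carrier (E\<lparr>carrier := S\<rparr>). (\<forall>i<card I. \<Phi> (u i) v = 0) \<longrightarrow> v = \<zero>\<^bsub>E\<lparr>carrier := S\<rparr>\<^esub>"
      proof (intro ballI impI)
        fix v assume "v \<in> carrier (E\<lparr>carrier := S\<rparr>)" and v0: "\<forall>i<card I. \<Phi> (u i) v = 0"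
        then have v: "v \<in> S" "v \<in> carrier E" using SE by auto
        have "\<Phi> b v = 0" if b: "b \<in> carrier B" for b
        proof -
          define c where "c s = (\<Sum>j<k. \<gamma> s j * r b j)" for s
          have c: "c s \<in> K" for s using \<gamma> b hE by (auto simp: c_def r_def lin(1))
          \<comment> \<open>The combination of the \<open>u i\<close> that pairs with
            \<open>T\<close> as \<open>b\<close> does. The difference lies in \<open>J\<close> and
            is therefore invisible on \<open>S\<close>.\<close>
          define d where "d = (\<Oplus>i\<in>{..<card I}. c (g i) \<odot> u i)"
          have d: "d \<in> carrier B" unfolding d_def using c u by (intro finsum_closed) auto
          have \<Phi>d: "\<Phi> d e = (\<Sum>i<card I. c (g i) * \<Phi> (u i) e)" if e: "e \<in> carrier E" for e
          proof -
            have "\<Phi> d e = (\<Sum>i<card I. \<Phi> (c (g i) \<odot> u i) e)"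
              unfolding d_def using c u by (intro functional_finsum[OF pair_linear_left[OF e]]) auto
            then show ?thesis using c u e by (simp add: pair_smult)
          qed
          have "\<Phi> (b \<ominus> d) (h i) = 0" if i: "i < k" for i
          proof -
            have "\<Phi> (u l) (h i) = g l i" if "l < card I" for l
              using fun_cong[OF u(2)[OF that], of i] i by (simp add: r_def)
            then have "\<Phi> d (h i) = (\<Sum>l<card I. c (g l) * g l i)" using \<Phi>d[OF hE[OF i]] by simp
            also have "\<dots> = (\<Sum>s\<in>I. c s * s i)"
              using sum.reindex[OF gI(2), of "\<lambda>s. c s * s i"] gI(1) by simp
            also have "\<dots> = r b i" using rep[rule_format, of "r b" i] b i by (simp add: c_def)
            finally show ?thesis using b d hE[OF i] i by (simp add: pair_minus r_def)
          qed
          then have "b \<ominus> d \<in> J" using TJ' b d by simp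
          then have "\<Phi> (b \<ominus> d) v = 0" using v(1) by (simp add: S_def)
          then have "\<Phi> b v = \<Phi> d v" using v(2) b d by (simp add: pair_minus)
          also have "\<dots> = 0" using \<Phi>d[OF v(2)] v0 by simp
          finally show ?thesis .
        qed
        \<comment> \<open>Every contraction on \<open>E\<close> is represented in \<open>B\<close>
          and vanishes at \<open>v\<close>; a norming functional at \<open>v\<close> would
          not.\<close>
        show "v = \<zero>\<^bsub>E\<lparr>carrier := S\<rparr>\<^esub>"
        proof (rule ccontr)
          assume "v \<noteq> \<zero>\<^bsub>E\<lparr>carrier := S\<rparr>\<^esub>"
          then have "\<parallel>v\<parallel>\<^bsub>E\<^esub> \<noteq> 0" using E.mnorm_eq_zero_iff[OF v(2)] by simp
          then obtain f where f: "f \<in> linear_maps K E (scalars K)"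
            "\<forall>x \<in> carrier E. cmod (f x) \<le> \<parallel>x\<parallel>\<^bsub>E\<^esub>" "f v \<noteq> 0"
            using E.norming_functional[OF v(2)] by fastforce
          then obtain b where "b \<in> carrier B" "\<And>e. e \<in> carrier E \<Longrightarrow> \<Phi> b e = f e"
            using contraction_represented[OF f(1)] by blast
          then show False
            using f(3) v(2) \<open>\<And>b. b \<in> carrier B \<Longrightarrow> \<Phi> b v = 0\<close>[of b] by simp
        qed
      qed
    qed
  qed
qed

lemma separating_homs_imp_ideal_exhaustion:
  assumes "separating_homs TYPE('f) K B E \<Phi>"
  shows "ideal_exhaustion K B E \<Phi>"
proof -
  obtain F :: "nat \<Rightarrow> (complex, 'f) normed_module" and \<rho> where
    F: "\<And>n. unital_algebra K (F n)" "\<And>n. normed_space K (F n)" "\<And>n. \<rho> n \<in> alg_hom K B (F n)"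
      "\<And>n. continuous_map weak_star (norm_topology (F n)) (\<rho> n)"
    and ker: "(\<Inter>n. a_kernel B (F n) (\<rho> n)) = {\<zero>}"
    using assms unfolding separating_homs_def by blast
  note hom = alg_homD[OF F(3)]
  have \<rho>0: "\<rho> n \<zero> = \<zero>\<^bsub>F n\<^esub>" for n
  proof -
    interpret F: unital_algebra K "F n" by (rule F(1))
    show ?thesis using hom(4)[of 0 \<zero> n] F.smult_l_null[of "\<rho> n \<zero>"] hom(1)[of \<zero> n] by simp
  qed
  obtain T where T: "\<And>n. finite (T n)" "\<And>n. T n \<subseteq> carrier E"
    "\<And>n b. \<lbrakk>b \<in> carrier B; \<forall>e\<in>T n. \<Phi> b e = 0\<rbrakk> \<Longrightarrow> \<rho> n b = \<zero>\<^bsub>F n\<^esub>"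
    using weak_star_continuous_kernel[OF F(2,3,4)] by metis
  have "\<one> \<noteq> \<zero>" using mnorm_one mnorm_eq_zero_iff[of \<one>] by auto
  \<comment> \<open>Individual targets may be the zero algebra, but since the kernels intersect in
    zero, some homomorphism does not kill the unit.\<close>
  then obtain m where m: "\<rho> m \<one> \<noteq> \<zero>\<^bsub>F m\<^esub>"
    using ker by (auto simp: a_kernel_def')
  \<comment> \<open>Intersecting all kernels up to \<open>r + m\<close> makes the ideals decrease
    with \<open>r\<close>, and the offset \<open>m\<close> keeps the unit outside each of
    them.\<close>
  define J where "J r = {b \<in> carrier B. \<forall>j\<le>r + m. \<rho> j b = \<zero>\<^bsub>F j\<^esub>}" for r
  define S where "S r = {v \<in> carrier E. \<forall>b\<in>J r. \<Phi> b v = 0}" for r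
  have subJ: "submodule (J r) (scalars K) B" for r
  proof (rule submoduleI')
    fix x y assume xy: "x \<in> J r" "y \<in> J r"
    have "\<rho> j (x \<oplus> y) = \<zero>\<^bsub>F j\<^esub>" if "j \<le> r + m" for j
    proof -
      interpret F: unital_algebra K "F j" by (rule F(1))
      show ?thesis using xy that hom(2)[of x y j] by (simp add: J_def)
    qed
    then show "x \<oplus> y \<in> J r" using xy by (simp add: J_def)
  next
    fix c x assume cx: "c \<in> K" "x \<in> J r"
    have "\<rho> j (c \<odot> x) = \<zero>\<^bsub>F j\<^esub>" if "j \<le> r + m" for j
    proof -
      interpret F: unital_algebra K "F j" by (rule F(1))
      show ?thesis using cx that hom(4)[of c x j] F.smult_r_null[of c] by (simp add: J_def)
    qed
    then show "c \<odot> x \<in> J r" using cx by (simp add: J_def)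
  qed (auto simp: J_def \<rho>0)
  have idealJ: "ideal (J r) B" for r
  proof (rule idealI)
    show "ring B" by (rule ring_axioms)
    show "subgroup (J r) (add_monoid B)" using subJ by (rule submodule.axioms(1))
    fix a x assume a: "a \<in> J r" and x: "x \<in> carrier B"
    have "\<rho> j (x \<otimes> a) = \<zero>\<^bsub>F j\<^esub> \<and> \<rho> j (a \<otimes> x) = \<zero>\<^bsub>F j\<^esub>" if "j \<le> r + m" for j
    proof -
      interpret F: unital_algebra K "F j" by (rule F(1))
      show ?thesis using a x that hom(1)[of x j] hom(3)[of _ _ j] by (simp add: J_def)
    qed
    then show "x \<otimes> a \<in> J r" "a \<otimes> x \<in> J r" using a x by (simp_all add: J_def)
  qed
  have fd: "submodule (S r) (scalars K) E" "fin_dim K (E\<lparr>carrier := S r\<rparr>)" "annihilator B \<Phi> (S r) = J r" for r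
  proof -
    have T': "finite (\<Union>j\<le>r + m. T j)" "(\<Union>j\<le>r + m. T j) \<subseteq> carrier E" using T(1,2) by auto
    have "\<forall>b \<in> carrier B. (\<forall>e\<in>\<Union>j\<le>r + m. T j. \<Phi> b e = 0) \<longrightarrow> b \<in> J r"
      using T(3) by (auto simp: J_def)
    from finite_codim_annihilator[OF subJ T' this]
    show "submodule (S r) (scalars K) E" "fin_dim K (E\<lparr>carrier := S r\<rparr>)" "annihilator B \<Phi> (S r) = J r"
      by (simp_all add: S_def)
  qed
  have proper: "J r \<noteq> carrier B" for r
  proof -
    have "\<one> \<notin> J r" using m by (auto simp: J_def intro!: exI[of _ m])
    then show ?thesis by blast
  qed
  have nonzero: "S r \<noteq> {\<zero>\<^bsub>E\<^esub>}" for r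
  proof
    assume "S r = {\<zero>\<^bsub>E\<^esub>}"
    then have "annihilator B \<Phi> (S r) = carrier B"
      using E.functional_zero[OF pair_linear] by (auto simp: annihilator_def)
    then show False using fd(3) proper by simp
  qed
  have "J s \<subseteq> J r" if "r \<le> s" for r s using that by (auto simp: J_def)
  then have mono: "S r \<subseteq> S s" if "r \<le> s" for r s using that by (fastforce simp: S_def)
  have SE: "S r \<subseteq> carrier E" for r by (auto simp: S_def)
  have U: "submodule (\<Union>r. S r) (scalars K) E" by (rule E.submodule_chain_Union[OF fd(1) mono])
  have dense: "norm_topology E closure_of (\<Union>r. S r) = carrier E"
  proof (rule ccontr)
    assume "norm_topology E closure_of (\<Union>r. S r) \<noteq> carrier E"
    then obtain x \<epsilon> where x: "x \<in> carrier E" "0 < \<epsilon>" "\<And>y. y \<in> (\<Union>r. S r) \<Longrightarrow> \<epsilon> \<le> \<parallel>x \<ominus>\<^bsub>E\<^esub> y\<parallel>\<^bsub>E\<^esub>"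
      using E.closure_eq_carrier_iff[OF E.submoduleE(1)[OF U]] by (meson not_le)
    obtain f where f: "f \<in> linear_maps K E (scalars K)" "\<And>v. v \<in> carrier E \<Longrightarrow> cmod (f v) \<le> \<parallel>v\<parallel>\<^bsub>E\<^esub>"
      "\<And>y. y \<in> (\<Union>r. S r) \<Longrightarrow> f y = 0" "f x \<noteq> 0"
      using E.separating_functional[OF U x] by blast
    obtain b where b: "b \<in> carrier B" "\<And>e. e \<in> carrier E \<Longrightarrow> \<Phi> b e = f e"
      using contraction_represented[OF f(1)] f(2) by blast
    have bJ: "b \<in> J r" for r
      unfolding fd(3)[symmetric] using b f(3) SE by (auto simp: annihilator_def subset_iff)
    have "\<rho> n b = \<zero>\<^bsub>F n\<^esub>" for n using bJ[of n] by (simp add: J_def)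
    then have "b \<in> (\<Inter>n. a_kernel B (F n) (\<rho> n))" using b(1) by (simp add: a_kernel_def')
    then have "b = \<zero>" using ker by simp
    then show False using b(2)[OF x(1)] f(4) functional_zero[OF pair_linear_left[OF x(1)]] by simp
  qed
  show ?thesis
    unfolding ideal_exhaustion_def
    using fd(1,2) nonzero mono[OF le_SucI[OF le_refl]] dense idealJ proper
    by (intro exI[of _ S] conjI allI) (simp_all add: fd(3))
qed

end

section \<open>From inverse limits to ideal exhaustions\<close>

context kspace
begin

lemma minus_submodule:
  assumes H: "submodule H (scalars K) V" and "x \<in> H" "y \<in> H"
  shows "x \<ominus>\<^bsub>V\<lparr>carrier := H\<rparr>\<^esub> y = x \<ominus> y"
proof -
  interpret H: kspace K "V\<lparr>carrier := H\<rparr>" by (rule kspace_submodule[OF H])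
  have "y \<in> carrier V" using submoduleE(1)[OF H] assms(3) by blast
  then show ?thesis
    using assms(3) H.minus_eq_smult[of y] by (simp add: a_minus_def minus_eq_smult)
qed

end

context nspace
begin

lemma eval_linear: "x \<in> carrier V \<Longrightarrow> (\<lambda>f. f x) \<in> linear_maps K (dual_space K V) (scalars K)"
  by (rule linear_functionalI) (auto intro: linear_functionalD(1)[OF dual_spaceD(1)])

lemma dual_minus:
  assumes "f \<in> carrier (dual_space K V)" "g \<in> carrier (dual_space K V)" "x \<in> carrier V"
  shows "(f \<ominus>\<^bsub>dual_space K V\<^esub> g) x = f x - g x"
proof -
  interpret D: nspace K "dual_space K V" by (rule nspace_dual)
  show ?thesis using D.functional_minus[OF eval_linear[OF assms(3)] assms(1,2)] .
qed

lemma norming_dual: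
  assumes "x \<in> carrier V"
  obtains f where "f \<in> carrier (dual_space K V)" "f x = complex_of_real \<parallel>x\<parallel>" "\<parallel>f\<parallel>\<^bsub>dual_space K V\<^esub> \<le> 1"
proof -
  obtain f where f: "f \<in> linear_maps K V (scalars K)" "f x = complex_of_real \<parallel>x\<parallel>"
    "\<forall>v \<in> carrier V. cmod (f v) \<le> \<parallel>v\<parallel>" using norming_functional[OF assms] by blast
  have "restrict f (carrier V) \<in> linear_maps K V (scalars K)"
    by (rule linear_functionalI) (use linear_functionalD[OF f(1)] in auto)
  then show thesis
    using that[of "restrict f (carrier V)"] dual_spaceI[of "restrict f (carrier V)" 1]
      dual_norm_le[of 1 "restrict f (carrier V)"] f assms by simp
qed

lemma dual_separates:
  assumes "x \<in> carrier V" "y \<in> carrier V" "\<And>f. f \<in> carrier (dual_space K V) \<Longrightarrow> f x = f y"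
  shows "x = y"
proof -
  obtain f where f: "f \<in> carrier (dual_space K V)" "f (x \<ominus> y) = complex_of_real \<parallel>x \<ominus> y\<parallel>"
    using norming_dual[of "x \<ominus> y"] assms by auto
  then have "\<parallel>x \<ominus> y\<parallel> = 0"
    using functional_minus[OF dual_spaceD(1)[OF f(1)] assms(1,2)] assms(3)[OF f(1)] by simp
  then show ?thesis using mnorm_eq_zero_iff[of "x \<ominus> y"] minus_eq_zero_iff assms by simp
qed

text \<open>Members of the dual are determined by their values at a spanning family, so evaluations
  at these vectors are a finite separating family on the dual, to which
  \<open>functional_coordinates\<close> applies.\<close>

lemma fin_dim_dual_coordinates:
  assumes "fin_dim K V"
  obtains k :: nat and e and I :: "(nat \<Rightarrow> complex) set" and g \<gamma>
  where "\<And>j. j < k \<Longrightarrow> e j \<in> carrier V" "finite I" "g \<in> I \<rightarrow> carrier (dual_space K V)"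
    "\<And>s j. \<gamma> s j \<in> K"
    "\<And>f. f \<in> carrier (dual_space K V) \<Longrightarrow>
      f = (\<Oplus>\<^bsub>dual_space K V\<^esub>s\<in>I. (\<Sum>j<k. \<gamma> s j * f (e j)) \<odot>\<^bsub>dual_space K V\<^esub> g s)"
proof -
  interpret D: nspace K "dual_space K V" by (rule nspace_dual)
  obtain k :: nat and e where e: "\<And>i. i < k \<Longrightarrow> e i \<in> carrier V"
    and span: "\<And>v. v \<in> carrier V \<Longrightarrow> \<exists>c. (\<forall>i. c i \<in> K) \<and> v = (\<Oplus>i\<in>{..<k}. c i \<odot> e i)"
    by (rule fin_dimE[OF assms]) (rule that)
  have lin: "\<forall>i<k. (\<lambda>f. f (e i)) \<in> linear_maps K (dual_space K V) (scalars K)"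
    using eval_linear e by blast
  have inj: "\<forall>f \<in> carrier (dual_space K V). (\<forall>i<k. f (e i) = 0) \<longrightarrow> f = \<zero>\<^bsub>dual_space K V\<^esub>"
  proof (intro ballI impI)
    fix f assume f: "f \<in> carrier (dual_space K V)" and f0: "\<forall>i<k. f (e i) = 0"
    show "f = \<zero>\<^bsub>dual_space K V\<^esub>"
    proof (rule dual_eqI[OF f D.M.zero_closed])
      fix x assume x: "x \<in> carrier V"
      obtain c where c: "\<forall>i. c i \<in> K" "x = (\<Oplus>i\<in>{..<k}. c i \<odot> e i)" using span[OF x] by blast
      have "f x = (\<Sum>i<k. f (c i \<odot> e i))"
        unfolding c(2) using c(1) e by (intro functional_finsum dual_spaceD(1)[OF f]) auto
      also have "\<dots> = 0" using c(1) e f0 by (simp add: linear_functionalD(3)[OF dual_spaceD(1)[OF f]])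
      finally show "f x = \<zero>\<^bsub>dual_space K V\<^esub> x" using x by simp
    qed
  qed
  show thesis
    by (rule D.functional_coordinates[OF lin inj]) (rule that[OF e])
qed

text \<open>Applying \<open>G\<close> to the reproducing formula of the dual and exchanging the two
  sums writes \<open>G f\<close> as a combination of the values \<open>f (e j)\<close>; its
  coefficients, used on the \<open>e j\<close>, define \<open>a\<close>.\<close>

lemma fin_dim_reflexive:
  assumes fd: "fin_dim K V" and G: "G \<in> linear_maps K (dual_space K V) (scalars K)"
  shows "\<exists>a \<in> carrier V. \<forall>f \<in> carrier (dual_space K V). G f = f a"
proof -
  interpret D: nspace K "dual_space K V" by (rule nspace_dual)
  obtain k :: nat and e and I :: "(nat \<Rightarrow> complex) set" and g \<gamma>
    where e: "\<And>j. j < k \<Longrightarrow> e j \<in> carrier V" and I: "finite I" "g \<in> I \<rightarrow> carrier (dual_space K V)"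
      and \<gamma>: "\<And>s j. \<gamma> s j \<in> K"
      and rep: "\<And>f. f \<in> carrier (dual_space K V) \<Longrightarrow>
        f = (\<Oplus>\<^bsub>dual_space K V\<^esub>s\<in>I. (\<Sum>j<k. \<gamma> s j * f (e j)) \<odot>\<^bsub>dual_space K V\<^esub> g s)"
    by (rule fin_dim_dual_coordinates[OF fd]) (rule that)
  note Glin = linear_functionalD[OF G]
  have gD: "g s \<in> carrier (dual_space K V)" if "s \<in> I" for s using I(2) that by auto
  define a where "a = (\<Oplus>j\<in>{..<k}. (\<Sum>s\<in>I. \<gamma> s j * G (g s)) \<odot> e j)"
  have aK: "(\<Sum>s\<in>I. \<gamma> s j * G (g s)) \<in> K" for j using \<gamma> Glin(1) gD by auto
  have a: "a \<in> carrier V" unfolding a_def using aK e by (intro M.finsum_closed) auto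
  have "G f = f a" if f: "f \<in> carrier (dual_space K V)" for f
  proof -
    note flin = linear_functionalD[OF dual_spaceD(1)[OF f]]
    have fK: "(\<Sum>j<k. \<gamma> s j * f (e j)) \<in> K" for s using \<gamma> flin(1) e by auto
    have "G f = G (\<Oplus>\<^bsub>dual_space K V\<^esub>s\<in>I. (\<Sum>j<k. \<gamma> s j * f (e j)) \<odot>\<^bsub>dual_space K V\<^esub> g s)"
      by (rule arg_cong[OF rep[OF f]])
    also have "\<dots> = (\<Sum>s\<in>I. G ((\<Sum>j<k. \<gamma> s j * f (e j)) \<odot>\<^bsub>dual_space K V\<^esub> g s))"
      using fK gD by (intro D.functional_finsum[OF G I(1)] Pi_I D.smult_in)
    also have "\<dots> = (\<Sum>s\<in>I. (\<Sum>j<k. \<gamma> s j * f (e j)) * G (g s))"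
      using fK gD by (intro sum.cong refl Glin(3))
    also have "\<dots> = (\<Sum>s\<in>I. \<Sum>j<k. \<gamma> s j * G (g s) * f (e j))"
      by (simp add: sum_distrib_left sum_distrib_right mult_ac)
    also have "\<dots> = (\<Sum>j<k. \<Sum>s\<in>I. \<gamma> s j * G (g s) * f (e j))" by (rule sum.swap)
    also have "\<dots> = (\<Sum>j<k. (\<Sum>s\<in>I. \<gamma> s j * G (g s)) * f (e j))" by (simp add: sum_distrib_right)
    also have "\<dots> = (\<Sum>j<k. f ((\<Sum>s\<in>I. \<gamma> s j * G (g s)) \<odot> e j))"
      using aK e flin(3) by simp
    also have "\<dots> = f a"
      unfolding a_def using aK e by (intro functional_finsum[symmetric] dual_spaceD(1)[OF f]) auto
    finally show ?thesis .
  qed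
  then show ?thesis using a by blast
qed

definition norm_closure :: "'a set \<Rightarrow> 'a set" where
  "norm_closure U = {x \<in> carrier V. \<forall>\<epsilon>>0. \<exists>y \<in> U. \<parallel>x \<ominus> y\<parallel> < \<epsilon>}"

lemma norm_closure_superset: "U \<subseteq> carrier V \<Longrightarrow> U \<subseteq> norm_closure U"
  by (auto simp: norm_closure_def a_minus_def M.r_neg intro!: bexI)

lemma submodule_norm_closure:
  assumes U: "submodule U (scalars K) V"
  shows "submodule (norm_closure U) (scalars K) V"
proof (rule submoduleI')
  note sub = submoduleE[OF U]
  have UV: "y \<in> carrier V" if "y \<in> U" for y using sub(1) that by blast
  show "norm_closure U \<subseteq> carrier V" by (auto simp: norm_closure_def)
  have "\<zero> \<in> U" by (rule zero_in_submodule[OF U])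
  then show "\<zero> \<in> norm_closure U" using norm_closure_superset[OF sub(1)] by blast
  fix x assume x: "x \<in> norm_closure U"
  then have xV: "x \<in> carrier V" by (simp add: norm_closure_def)
  show "x \<oplus> y \<in> norm_closure U" if y: "y \<in> norm_closure U" for y
    unfolding norm_closure_def
  proof (intro CollectI conjI allI impI)
    have yV: "y \<in> carrier V" using y by (simp add: norm_closure_def)
    show "x \<oplus> y \<in> carrier V" using xV yV by simp
    fix \<epsilon> :: real assume \<epsilon>: "0 < \<epsilon>"
    then have "0 < \<epsilon> / 2" by simp
    then obtain u v where u: "u \<in> U" "\<parallel>x \<ominus> u\<parallel> < \<epsilon> / 2" and v: "v \<in> U" "\<parallel>y \<ominus> v\<parallel> < \<epsilon> / 2"
      using x y unfolding norm_closure_def by blast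
    have "(x \<oplus> y) \<ominus> (u \<oplus> v) = (x \<ominus> u) \<oplus> (y \<ominus> v)"
      using xV yV u v UV by (simp add: a_minus_def M.minus_add M.a_ac)
    then have "\<parallel>(x \<oplus> y) \<ominus> (u \<oplus> v)\<parallel> < \<epsilon>"
      using mnorm_triangle[of "x \<ominus> u" "y \<ominus> v"] xV yV u v UV by simp
    then show "\<exists>w\<in>U. \<parallel>(x \<oplus> y) \<ominus> w\<parallel> < \<epsilon>" using sub(5)[OF u(1) v(1)] by blast
  qed
  show "c \<odot> x \<in> norm_closure U" if c: "c \<in> K" for c
    unfolding norm_closure_def
  proof (intro CollectI conjI allI impI)
    show "c \<odot> x \<in> carrier V" using xV c by simp
    fix \<epsilon> :: real assume \<epsilon>: "0 < \<epsilon>"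
    then have "0 < \<epsilon> / (cmod c + 1)" by (simp add: add_nonneg_pos)
    then obtain u where u: "u \<in> U" "\<parallel>x \<ominus> u\<parallel> < \<epsilon> / (cmod c + 1)"
      using x unfolding norm_closure_def by blast
    have "c \<odot> x \<ominus> c \<odot> u = c \<odot> (x \<ominus> u)"
      using c xV UV[OF u(1)] by (simp add: a_minus_def smult_add_right minus_eq_smult smult_smult)
    then have "\<parallel>c \<odot> x \<ominus> c \<odot> u\<parallel> = cmod c * \<parallel>x \<ominus> u\<parallel>" using c xV UV[OF u(1)] by (simp add: mnorm_smult)
    also have "\<dots> \<le> (cmod c + 1) * \<parallel>x \<ominus> u\<parallel>" using xV UV[OF u(1)] by (intro mult_right_mono) auto
    also have "\<dots> < (cmod c + 1) * (\<epsilon> / (cmod c + 1))"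
      using u by (intro mult_strict_left_mono) (auto simp: add_nonneg_pos)
    also have "\<dots> = \<epsilon>" using add_nonneg_pos[OF norm_ge_zero[of c] zero_less_one] by simp
    finally show "\<exists>w\<in>U. \<parallel>c \<odot> x \<ominus> w\<parallel> < \<epsilon>" using sub(4)[of c u] c u by auto
  qed
qed

lemma norm_closure_closed:
  assumes U: "U \<subseteq> carrier V" and x: "x \<in> carrier V"
    and close: "\<And>\<epsilon>. 0 < \<epsilon> \<Longrightarrow> \<exists>y \<in> norm_closure U. \<parallel>x \<ominus> y\<parallel> < \<epsilon>"
  shows "x \<in> norm_closure U"
  unfolding norm_closure_def
proof (intro CollectI conjI allI impI x)
  fix \<epsilon> :: real assume "0 < \<epsilon>"
  then have \<epsilon>: "0 < \<epsilon> / 2" by simp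
  obtain y where y: "y \<in> norm_closure U" "\<parallel>x \<ominus> y\<parallel> < \<epsilon> / 2" using close[OF \<epsilon>] by blast
  obtain u where u: "u \<in> U" "\<parallel>y \<ominus> u\<parallel> < \<epsilon> / 2" using y(1) \<epsilon> unfolding norm_closure_def by blast
  have "\<parallel>x \<ominus> u\<parallel> \<le> \<parallel>x \<ominus> y\<parallel> + \<parallel>y \<ominus> u\<parallel>"
    using x y u U by (intro norm_triangle_minus) (auto simp: norm_closure_def)
  then show "\<exists>u\<in>U. \<parallel>x \<ominus> u\<parallel> < \<epsilon>" using y u by (intro bexI[of _ u]) auto
qed

text \<open>A Cauchy sequence of functionals converges pointwise; since the Cauchy estimates are
  uniform on the unit ball, the limit is bounded and the convergence is in norm. It is proved
  directly for closed subspaces, the form in which the predual arises.\<close>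

lemma banach_closed_in_dual:
  assumes H: "submodule H (scalars K) (dual_space K V)"
    and closed: "\<And>f. \<lbrakk>f \<in> carrier (dual_space K V);
      \<And>\<epsilon>. 0 < \<epsilon> \<Longrightarrow> \<exists>g \<in> H. \<parallel>f \<ominus>\<^bsub>dual_space K V\<^esub> g\<parallel>\<^bsub>dual_space K V\<^esub> < \<epsilon>\<rbrakk> \<Longrightarrow> f \<in> H"
  shows "banach_space K (dual_space K V\<lparr>carrier := H\<rparr>)"
proof -
  let ?D = "dual_space K V"
  interpret D: nspace K ?D by (rule nspace_dual)
  interpret H: nspace K "?D\<lparr>carrier := H\<rparr>" by (rule D.nspace_submodule[OF H])
  have HD: "f \<in> carrier ?D" if "f \<in> H" for f using D.submoduleE(1)[OF H] that by blast
  show ?thesis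
  proof (rule H.banach_spaceI)
    fix f :: "nat \<Rightarrow> 'a \<Rightarrow> complex"
    assume "\<And>n. f n \<in> carrier (?D\<lparr>carrier := H\<rparr>)"
      and cauchy0: "\<And>\<epsilon>. 0 < \<epsilon> \<Longrightarrow> \<exists>N. \<forall>m\<ge>N. \<forall>n\<ge>N.
        \<parallel>f m \<ominus>\<^bsub>?D\<lparr>carrier := H\<rparr>\<^esub> f n\<parallel>\<^bsub>?D\<lparr>carrier := H\<rparr>\<^esub> < \<epsilon>"
    then have fH: "f n \<in> H" for n by simp
    have fD: "f n \<in> carrier ?D" for n using HD[OF fH] .
    have cauchy: "\<exists>N. \<forall>m\<ge>N. \<forall>n\<ge>N. \<parallel>f m \<ominus>\<^bsub>?D\<^esub> f n\<parallel>\<^bsub>?D\<^esub> < \<epsilon>" if "0 < \<epsilon>" for \<epsilon>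
      using cauchy0[OF that] D.minus_submodule[OF H fH fH] by simp
    have diff: "cmod (f m x - f n x) \<le> \<parallel>f m \<ominus>\<^bsub>?D\<^esub> f n\<parallel>\<^bsub>?D\<^esub> * \<parallel>x\<parallel>" if "x \<in> carrier V" for m n x
      using dual_norm_bound[of "f m \<ominus>\<^bsub>?D\<^esub> f n" x] dual_minus[OF fD fD that] fD that by simp
    have "convergent (\<lambda>n. f n x)" if x: "x \<in> carrier V" for x
    proof -
      have "Cauchy (\<lambda>n. f n x)"
      proof (rule CauchyI)
        fix \<epsilon> :: real assume "0 < \<epsilon>"
        have nx: "0 \<le> \<parallel>x\<parallel>" using x by simp
        then have "0 < \<epsilon> / (\<parallel>x\<parallel> + 1)" using \<open>0 < \<epsilon>\<close> by simp
        then obtain N where N: "\<forall>m\<ge>N. \<forall>n\<ge>N. \<parallel>f m \<ominus>\<^bsub>?D\<^esub> f n\<parallel>\<^bsub>?D\<^esub> < \<epsilon> / (\<parallel>x\<parallel> + 1)"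
          using cauchy by blast
        show "\<exists>N. \<forall>m\<ge>N. \<forall>n\<ge>N. norm (f m x - f n x) < \<epsilon>"
        proof (intro exI[of _ N] allI impI)
          fix m n assume mn: "N \<le> m" "N \<le> n"
          have "cmod (f m x - f n x) \<le> \<parallel>f m \<ominus>\<^bsub>?D\<^esub> f n\<parallel>\<^bsub>?D\<^esub> * \<parallel>x\<parallel>" by (rule diff[OF x])
          also have "\<dots> \<le> \<parallel>f m \<ominus>\<^bsub>?D\<^esub> f n\<parallel>\<^bsub>?D\<^esub> * (\<parallel>x\<parallel> + 1)"
            using fD by (intro mult_left_mono) auto
          also have "\<dots> < \<epsilon> / (\<parallel>x\<parallel> + 1) * (\<parallel>x\<parallel> + 1)"
            using N mn nx by (intro mult_strict_right_mono) auto
          also have "\<dots> = \<epsilon>" using nx by simp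
          finally show "norm (f m x - f n x) < \<epsilon>" .
        qed
      qed
      then show ?thesis by (simp add: Cauchy_convergent_iff)
    qed
    then obtain l where l: "\<And>x. x \<in> carrier V \<Longrightarrow> (\<lambda>n. f n x) \<longlonglongrightarrow> l x"
      unfolding convergent_def by metis
    define g where "g = restrict l (carrier V)"
    have glin: "g \<in> linear_maps K V (scalars K)"
      by (rule linear_functional_limit[where f = f, OF dual_spaceD(1)[OF fD]]) (simp add: g_def l)
    \<comment> \<open>The index \<open>m\<close> tends to infinity in the Cauchy estimate, point by
      point, but with \<open>N\<close> independent of \<open>x\<close>.\<close>
    have near: "\<exists>N. \<forall>n\<ge>N. \<forall>x \<in> carrier V. cmod (f n x - g x) \<le> \<epsilon> * \<parallel>x\<parallel>" if \<epsilon>: "0 < \<epsilon>" for \<epsilon>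
    proof -
      obtain N where N: "\<forall>m\<ge>N. \<forall>n\<ge>N. \<parallel>f m \<ominus>\<^bsub>?D\<^esub> f n\<parallel>\<^bsub>?D\<^esub> < \<epsilon>" using cauchy[OF \<epsilon>] by blast
      have "cmod (f n x - g x) \<le> \<epsilon> * \<parallel>x\<parallel>" if n: "N \<le> n" and x: "x \<in> carrier V" for n x
      proof (rule LIMSEQ_le_const2)
        show "(\<lambda>m. cmod (f n x - f m x)) \<longlonglongrightarrow> cmod (f n x - g x)"
          using l[OF x] x by (auto simp: g_def intro!: tendsto_intros)
        have "cmod (f n x - f m x) \<le> \<epsilon> * \<parallel>x\<parallel>" if m: "N \<le> m" for m
        proof -
          have "\<parallel>f n \<ominus>\<^bsub>?D\<^esub> f m\<parallel>\<^bsub>?D\<^esub> \<le> \<epsilon>" using N n m less_imp_le by blast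
          then have "\<parallel>f n \<ominus>\<^bsub>?D\<^esub> f m\<parallel>\<^bsub>?D\<^esub> * \<parallel>x\<parallel> \<le> \<epsilon> * \<parallel>x\<parallel>" using x by (intro mult_right_mono) auto
          then show ?thesis using diff[OF x, of n m] by linarith
        qed
        then show "\<exists>M. \<forall>m\<ge>M. cmod (f n x - f m x) \<le> \<epsilon> * \<parallel>x\<parallel>" by blast
      qed
      then show ?thesis by blast
    qed
    have gD: "g \<in> carrier ?D"
    proof -
      obtain N where N: "\<forall>n\<ge>N. \<forall>x \<in> carrier V. cmod (f n x - g x) \<le> 1 * \<parallel>x\<parallel>" using near[of 1] by auto
      show ?thesis
      proof (rule dual_spaceI[OF glin])
        show "g \<in> extensional (carrier V)" by (simp add: g_def)
        fix x assume x: "x \<in> carrier V"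
        have "cmod (g x) \<le> cmod (f N x) + cmod (f N x - g x)"
          using norm_triangle_sub[of "g x" "f N x"] by (simp add: Real_Vector_Spaces.norm_minus_commute)
        also have "\<dots> \<le> \<parallel>f N\<parallel>\<^bsub>?D\<^esub> * \<parallel>x\<parallel> + 1 * \<parallel>x\<parallel>"
          using dual_norm_bound[OF fD x, of N] N x by (intro add_mono) auto
        finally show "cmod (g x) \<le> (\<parallel>f N\<parallel>\<^bsub>?D\<^esub> + 1) * \<parallel>x\<parallel>" by (simp add: distrib_right)
      qed
    qed
    have conv: "\<exists>N. \<forall>n\<ge>N. \<parallel>f n \<ominus>\<^bsub>?D\<^esub> g\<parallel>\<^bsub>?D\<^esub> < \<epsilon>" if \<epsilon>: "0 < \<epsilon>" for \<epsilon>
    proof -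
      \<comment> \<open>Bounds on a supremum are not strict, hence
        \<open>\<epsilon> / 2\<close>.\<close>
      obtain N where N: "\<forall>n\<ge>N. \<forall>x \<in> carrier V. cmod (f n x - g x) \<le> \<epsilon> / 2 * \<parallel>x\<parallel>"
        using near[of "\<epsilon> / 2"] \<epsilon> by auto
      have "\<parallel>f n \<ominus>\<^bsub>?D\<^esub> g\<parallel>\<^bsub>?D\<^esub> < \<epsilon>" if n: "N \<le> n" for n
      proof -
        have "\<parallel>f n \<ominus>\<^bsub>?D\<^esub> g\<parallel>\<^bsub>?D\<^esub> \<le> \<epsilon> / 2"
          using N n \<epsilon> by (intro dual_norm_le) (auto simp: dual_minus[OF fD gD])
        then show ?thesis using \<epsilon> by simp
      qed
      then show ?thesis by blast
    qed
    have gH: "g \<in> H"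
    proof (rule closed[OF gD])
      fix \<epsilon> :: real assume "0 < \<epsilon>"
      then obtain N where "\<parallel>f N \<ominus>\<^bsub>?D\<^esub> g\<parallel>\<^bsub>?D\<^esub> < \<epsilon>" using conv by blast
      then show "\<exists>h\<in>H. \<parallel>g \<ominus>\<^bsub>?D\<^esub> h\<parallel>\<^bsub>?D\<^esub> < \<epsilon>"
        using fH[of N] D.norm_minus_commute[OF gD fD[of N]] by (intro bexI[of _ "f N"]) simp_all
    qed
    show "\<exists>l\<in>carrier (?D\<lparr>carrier := H\<rparr>). \<forall>\<epsilon>>0. \<exists>N. \<forall>n\<ge>N.
        \<parallel>f n \<ominus>\<^bsub>?D\<lparr>carrier := H\<rparr>\<^esub> l\<parallel>\<^bsub>?D\<lparr>carrier := H\<rparr>\<^esub> < \<epsilon>"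
      using gH conv D.minus_submodule[OF H fH gH] by (intro bexI[of _ g]) auto
  qed
qed

end

text \<open>The transpose of \<open>h\<close>, restricted to the carrier because members of
  \<open>dual_space\<close> are extensional.\<close>

definition pullback :: "(complex, 'a) normed_module \<Rightarrow> ('a \<Rightarrow> 'c) \<Rightarrow> ('c \<Rightarrow> complex) \<Rightarrow> 'a \<Rightarrow> complex" where
  "pullback V h f = (\<lambda>x \<in> carrier V. f (h x))"

lemma pullback_dual:
  assumes V: "nspace K V" and W: "nspace K W"
    and h: "h \<in> linear_maps K V W" "\<And>x. x \<in> carrier V \<Longrightarrow> \<parallel>h x\<parallel>\<^bsub>W\<^esub> \<le> \<parallel>x\<parallel>\<^bsub>V\<^esub>"
    and f: "f \<in> carrier (dual_space K W)"
  shows "pullback V h f \<in> carrier (dual_space K V)"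
    "\<parallel>pullback V h f\<parallel>\<^bsub>dual_space K V\<^esub> \<le> \<parallel>f\<parallel>\<^bsub>dual_space K W\<^esub>"
proof -
  interpret V: nspace K V by (rule V)
  interpret W: nspace K W by (rule W)
  note flin = linear_functionalD[OF W.dual_spaceD(1)[OF f]]
  have hW: "h x \<in> carrier W" if "x \<in> carrier V" for x
    using h(1) that by (auto simp: linear_maps_def hom_def)
  have b: "cmod (pullback V h f x) \<le> \<parallel>f\<parallel>\<^bsub>dual_space K W\<^esub> * \<parallel>x\<parallel>\<^bsub>V\<^esub>" if x: "x \<in> carrier V" for x
  proof -
    have "cmod (f (h x)) \<le> \<parallel>f\<parallel>\<^bsub>dual_space K W\<^esub> * \<parallel>h x\<parallel>\<^bsub>W\<^esub>" by (rule W.dual_norm_bound[OF f hW[OF x]])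
    also have "\<dots> \<le> \<parallel>f\<parallel>\<^bsub>dual_space K W\<^esub> * \<parallel>x\<parallel>\<^bsub>V\<^esub>"
      by (intro mult_left_mono h(2)[OF x] W.dual_norm_nonneg[OF f])
    finally show ?thesis using x by (simp add: pullback_def)
  qed
  have "pullback V h f \<in> linear_maps K V (scalars K)"
    by (rule linear_functionalI)
      (use h(1) hW flin in \<open>auto simp: pullback_def linear_maps_def hom_def\<close>)
  then show "pullback V h f \<in> carrier (dual_space K V)"
    by (rule V.dual_spaceI) (use b in \<open>auto simp: pullback_def\<close>)
  show "\<parallel>pullback V h f\<parallel>\<^bsub>dual_space K V\<^esub> \<le> \<parallel>f\<parallel>\<^bsub>dual_space K W\<^esub>"
    by (rule V.dual_norm_le[OF W.dual_norm_nonneg[OF f] b])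
qed

text \<open>The predual is the closure in the dual of \<open>B\<close> of the functionals that factor through some
  coordinate \<open>A r\<close>.  Reflexivity of \<open>A r\<close> turns a functional on it into a bounded thread.\<close>

lemma inverse_limit_imp_ideal_exhaustion:
  fixes B :: "(complex, 'b) normed_module"
  assumes field: "scalar_field K" and B: "unital_banach_algebra K B"
    and lim: "is_bounded_inverse_limit TYPE('a) K B"
  shows "has_ideal_exhaustion TYPE('b \<Rightarrow> complex) K B"
proof -
  interpret scalar_field K by (rule field)
  interpret B: unital_banach_algebra K B by (rule B)
  interpret B: nspace K B by (intro nspace.intro field B.normed_space_axioms)
  obtain A :: "nat \<Rightarrow> (complex, 'a) normed_module" and \<pi> \<Psi> where
    sys: "metric_inverse_system K A \<pi>" and \<Psi>: "\<Psi> \<in> alg_hom K B (bounded_inverse_limit A \<pi>)"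
    and iso: "bij_isometry B (bounded_inverse_limit A \<pi>) \<Psi>"
    using lim unfolding is_bounded_inverse_limit_def by blast
  interpret sys: metric_inverse_system K A \<pi> by (rule sys)
  have A: "nspace K (A r)" for r
    using sys.unital_banach_algebra[of r] field
    by (auto simp: nspace_def unital_banach_algebra_def banach_space_def)
  have Aalg: "unital_algebra K (A r)" for r
    using sys.unital_banach_algebra[of r] by (simp add: unital_banach_algebra_def)

  \<comment> \<open>The coordinate maps of \<open>B\<close> and their contractivity\<close>
  define \<psi> where "\<psi> r b = \<Psi> b r" for r b
  have \<Psi>L: "\<Psi> b \<in> carrier (bounded_inverse_limit A \<pi>)" if "b \<in> carrier B" for b
    using alg_homD(1)[OF \<Psi> that] .
  have \<psi>_hom: "\<psi> r \<in> alg_hom K B (A r)" for r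
    by (rule alg_homI)
      (use \<Psi>L alg_homD(2-5)[OF \<Psi>] in \<open>auto simp: \<psi>_def bounded_inverse_limit_def\<close>)
  note hom = alg_homD[OF \<psi>_hom]
  have \<psi>_lin: "\<psi> r \<in> linear_maps K B (A r)" for r using \<psi>_hom by (simp add: alg_hom_def)
  have \<pi>\<psi>: "\<pi> r s (\<psi> s b) = \<psi> r b" if "r \<le> s" "b \<in> carrier B" for r s b
    using \<Psi>L[OF that(2)] that(1) by (auto simp: \<psi>_def bounded_inverse_limit_def)
  have bddN: "bdd_above (range (\<lambda>r. \<parallel>\<psi> r b\<parallel>\<^bsub>A r\<^esub>))" if "b \<in> carrier B" for b
    using \<Psi>L[OF that] by (simp add: \<psi>_def bounded_inverse_limit_def)
  have normB: "\<parallel>b\<parallel>\<^bsub>B\<^esub> = (SUP r. \<parallel>\<psi> r b\<parallel>\<^bsub>A r\<^esub>)" if "b \<in> carrier B" for b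
    using iso that by (simp add: bij_isometry_def \<psi>_def bounded_inverse_limit_def)
  have \<psi>_le: "\<parallel>\<psi> r b\<parallel>\<^bsub>A r\<^esub> \<le> \<parallel>b\<parallel>\<^bsub>B\<^esub>" if "b \<in> carrier B" for r b
    unfolding normB[OF that] by (rule cSUP_upper[OF _ bddN[OF that]]) simp
  have thread: "\<exists>b \<in> carrier B. \<forall>r. \<psi> r b = a r"
    if "\<And>r. a r \<in> carrier (A r)" "\<And>r s. r \<le> s \<Longrightarrow> \<pi> r s (a s) = a r" "\<And>r. \<parallel>a r\<parallel>\<^bsub>A r\<^esub> \<le> M" for a M
  proof -
    have "a \<in> carrier (bounded_inverse_limit A \<pi>)"
      using that by (auto simp: bounded_inverse_limit_def intro!: bdd_aboveI2)
    then have "a \<in> \<Psi> ` carrier B" using iso by (simp add: bij_isometry_def bij_betw_def)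
    then obtain b where "b \<in> carrier B" "\<Psi> b = a" by blast
    then show ?thesis by (auto simp: \<psi>_def)
  qed
  have \<pi>_lin: "\<pi> r s \<in> linear_maps K (A s) (A r)" if "r \<le> s" for r s
    using sys.alg_hom[OF that] by (simp add: alg_hom_def)
  have \<pi>_in: "\<pi> r s x \<in> carrier (A r)" if "r \<le> s" "x \<in> carrier (A s)" for r s x
    using alg_homD(1)[OF sys.alg_hom[OF that(1)] that(2)] .
  \<comment> \<open>By the metric-quotient condition the left side is an infimum over a fibre to
    which \<open>x\<close> belongs.\<close>
  have \<pi>_le: "\<parallel>\<pi> r s x\<parallel>\<^bsub>A r\<^esub> \<le> \<parallel>x\<parallel>\<^bsub>A s\<^esub>" if rs: "r \<le> s" and x: "x \<in> carrier (A s)" for r s x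
    unfolding sys.metric_quotient[OF rs \<pi>_in[OF rs x]]
    by (rule cINF_lower) (use x nspace.norm_nonneg[OF A] in \<open>auto intro!: bdd_belowI2[where m = 0]\<close>)

  \<comment> \<open>Functionals on \<open>B\<close> that factor through a coordinate\<close>
  let ?D = "dual_space K B" and ?DA = "\<lambda>r. dual_space K (A r)"
  interpret D: nspace K ?D by (rule B.nspace_dual)
  define lift where "lift r = pullback B (\<psi> r)" for r
  have lift: "lift r f \<in> carrier ?D" "\<parallel>lift r f\<parallel>\<^bsub>?D\<^esub> \<le> \<parallel>f\<parallel>\<^bsub>?DA r\<^esub>" if "f \<in> carrier (?DA r)" for r f
    unfolding lift_def by (rule pullback_dual[OF B.nspace_axioms A \<psi>_lin \<psi>_le that], assumption)+
  have lift_apply: "lift r f b = f (\<psi> r b)" if "b \<in> carrier B" for r f b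
    using that by (simp add: lift_def pullback_def)
  have lift_add: "lift r (f \<oplus>\<^bsub>?DA r\<^esub> g) = lift r f \<oplus>\<^bsub>?D\<^esub> lift r g" for r f g
    by (auto simp: lift_def pullback_def fun_eq_iff hom(1))
  have lift_smult: "lift r (c \<odot>\<^bsub>?DA r\<^esub> f) = c \<odot>\<^bsub>?D\<^esub> lift r f" for r c f
    by (auto simp: lift_def pullback_def fun_eq_iff hom(1))
  define S where "S r = lift r ` carrier (?DA r)" for r
  have SD: "S r \<subseteq> carrier ?D" for r using lift(1) by (auto simp: S_def)
  have subS: "submodule (S r) (scalars K) ?D" for r
  proof -
    interpret DA: nspace K "?DA r" by (rule nspace.nspace_dual[OF A])
    show ?thesis
    proof (rule D.submoduleI'[OF SD])
      show "\<zero>\<^bsub>?D\<^esub> \<in> S r"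
        unfolding S_def by (rule image_eqI[OF _ DA.M.zero_closed]) (auto simp: lift_def pullback_def hom(1))
      show "x \<oplus>\<^bsub>?D\<^esub> y \<in> S r" if "x \<in> S r" "y \<in> S r" for x y
        using that DA.M.add.m_closed unfolding S_def by (auto simp: lift_add[symmetric] simp del: dual_space_simps)
      show "c \<odot>\<^bsub>?D\<^esub> x \<in> S r" if "c \<in> K" "x \<in> S r" for c x
        using that DA.smult_in unfolding S_def by (auto simp: lift_smult[symmetric] simp del: dual_space_simps)
    qed
  qed
  have fdS: "fin_dim K (?D\<lparr>carrier := S r\<rparr>)" for r
  proof -
    interpret A: nspace K "A r" by (rule A)
    interpret DA: nspace K "?DA r" by (rule A.nspace_dual)
    obtain k :: nat and e and I :: "(nat \<Rightarrow> complex) set" and g \<gamma>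
      where e: "\<And>j. j < k \<Longrightarrow> e j \<in> carrier (A r)" and I: "finite I" "g \<in> I \<rightarrow> carrier (?DA r)"
        and \<gamma>: "\<And>s j. \<gamma> s j \<in> K"
        and rep: "\<And>f. f \<in> carrier (?DA r) \<Longrightarrow>
          f = (\<Oplus>\<^bsub>?DA r\<^esub>s\<in>I. (\<Sum>j<k. \<gamma> s j * f (e j)) \<odot>\<^bsub>?DA r\<^esub> g s)"
      by (rule A.fin_dim_dual_coordinates[OF sys.fin_dim]) (rule that)
    have gD: "g s \<in> carrier (?DA r)" if "s \<in> I" for s using I(2) that by auto
    show ?thesis
    proof (rule D.fin_dim_submoduleI[OF subS I(1), of "\<lambda>s. lift r (g s)"])
      show "(\<lambda>s. lift r (g s)) \<in> I \<rightarrow> S r" using gD by (auto simp: S_def)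
      fix v assume "v \<in> S r"
      then obtain f where f: "f \<in> carrier (?DA r)" "v = lift r f" by (auto simp: S_def)
      define c where "c s = (\<Sum>j<k. \<gamma> s j * f (e j))" for s
      have c: "c s \<in> K" for s
        using \<gamma> e linear_functionalD(1)[OF A.dual_spaceD(1)[OF f(1)]] by (auto simp: c_def)
      have cl: "(\<lambda>s. c s \<odot>\<^bsub>?D\<^esub> lift r (g s)) \<in> I \<rightarrow> carrier ?D"
        by (intro Pi_I D.smult_in c lift(1) gD)
      have "v = (\<Oplus>\<^bsub>?D\<^esub>s\<in>I. c s \<odot>\<^bsub>?D\<^esub> lift r (g s))"
        unfolding f(2)
      proof (rule B.dual_eqI[OF lift(1)[OF f(1)] D.M.finsum_closed[OF cl]])
        fix b assume b: "b \<in> carrier B"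
        have "f (\<psi> r b) = (\<Oplus>\<^bsub>?DA r\<^esub>s\<in>I. c s \<odot>\<^bsub>?DA r\<^esub> g s) (\<psi> r b)"
          using fun_cong[OF rep[OF f(1)], of "\<psi> r b"] by (simp only: c_def)
        also have "\<dots> = (\<Sum>s\<in>I. (c s \<odot>\<^bsub>?DA r\<^esub> g s) (\<psi> r b))"
          by (rule DA.functional_finsum[OF A.eval_linear[OF hom(1)[OF b]] I(1)])
            (intro Pi_I DA.smult_in c gD)
        also have "\<dots> = (\<Sum>s\<in>I. (c s \<odot>\<^bsub>?D\<^esub> lift r (g s)) b)"
          using b hom(1)[OF b] by (simp add: lift_apply)
        also have "\<dots> = (\<Oplus>\<^bsub>?D\<^esub>s\<in>I. c s \<odot>\<^bsub>?D\<^esub> lift r (g s)) b"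
          by (rule D.functional_finsum[OF B.eval_linear[OF b] I(1) cl, symmetric])
        finally show "lift r f b = (\<Oplus>\<^bsub>?D\<^esub>s\<in>I. c s \<odot>\<^bsub>?D\<^esub> lift r (g s)) b" using b by (simp add: lift_apply)
      qed
      then show "\<exists>c\<in>I \<rightarrow> K. v = (\<Oplus>\<^bsub>?D\<^esub>s\<in>I. c s \<odot>\<^bsub>?D\<^esub> lift r (g s))"
        using c by (intro bexI[of _ c]) auto
    qed
  qed
  \<comment> \<open>A functional on \<open>A r\<close> composed with the bonding map is a functional
    on \<open>A s\<close> with the same lift to \<open>B\<close>. This is why the spaces
    \<open>S r\<close> increase, and it will make threads compatible.\<close>
  have lift_\<pi>: "pullback (A s) (\<pi> r s) f \<in> carrier (?DA s)" "lift s (pullback (A s) (\<pi> r s) f) = lift r f"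
    if rs: "r \<le> s" and f: "f \<in> carrier (?DA r)" for r s f
  proof -
    show *: "pullback (A s) (\<pi> r s) f \<in> carrier (?DA s)"
      by (rule pullback_dual(1)[OF A A \<pi>_lin[OF rs] \<pi>_le[OF rs] f])
    show "lift s (pullback (A s) (\<pi> r s) f) = lift r f"
      using B.dual_eqI[OF lift(1)[OF *] lift(1)[OF f]] \<pi>\<psi>[OF rs] hom(1)
      by (simp add: lift_apply) (simp add: pullback_def)
  qed
  have S_mono: "S r \<subseteq> S s" if "r \<le> s" for r s
  proof
    fix v assume "v \<in> S r"
    then obtain f where f: "f \<in> carrier (?DA r)" "v = lift r f" by (auto simp: S_def)
    show "v \<in> S s"
      unfolding S_def f(2) using lift_\<pi>[OF that f(1)] by (intro image_eqI[of _ _ "pullback (A s) (\<pi> r s) f"]) auto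
  qed
  have U: "submodule (\<Union>r. S r) (scalars K) ?D" by (rule D.submodule_chain_Union[OF subS S_mono])

  \<comment> \<open>The predual as a closed subspace of the dual of \<open>B\<close>\<close>
  define H where "H = D.norm_closure (\<Union>r. S r)"
  have UD: "(\<Union>r. S r) \<subseteq> carrier ?D" using SD by blast
  have subH: "submodule H (scalars K) ?D" unfolding H_def by (rule D.submodule_norm_closure[OF U])
  have SH: "S r \<subseteq> H" for r using D.norm_closure_superset[OF UD] unfolding H_def by blast
  have HD: "f \<in> carrier ?D" if "f \<in> H" for f using that by (simp add: H_def D.norm_closure_def)
  define E where "E = ?D\<lparr>carrier := H\<rparr>"
  have E_simps: "carrier E = H" "mnorm E = mnorm ?D" "zero E = zero ?D" "add E = add ?D" "smult E = smult ?D"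
    by (simp_all add: E_def)
  have E_banach: "banach_space K E"
    unfolding E_def
    by (rule B.banach_closed_in_dual[OF subH]) (unfold H_def, rule D.norm_closure_closed[OF UD])
  interpret E: nspace K E unfolding E_def by (rule D.nspace_submodule[OF subH])
  have E_minus: "f \<ominus>\<^bsub>E\<^esub> g = f \<ominus>\<^bsub>?D\<^esub> g" if "f \<in> H" "g \<in> H" for f g
    unfolding E_def by (rule D.minus_submodule[OF subH that])
  have dense: "norm_topology E closure_of (\<Union>r. S r) = carrier E"
  proof -
    have "\<exists>y \<in> \<Union>r. S r. \<parallel>x \<ominus>\<^bsub>E\<^esub> y\<parallel>\<^bsub>E\<^esub> < \<epsilon>" if x: "x \<in> H" and \<epsilon>: "0 < \<epsilon>" for x \<epsilon>
    proof -
      obtain y where y: "y \<in> (\<Union>r. S r)" "\<parallel>x \<ominus>\<^bsub>?D\<^esub> y\<parallel>\<^bsub>?D\<^esub> < \<epsilon>"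
        using x \<epsilon> unfolding H_def D.norm_closure_def by blast
      then have "y \<in> H" using SH by blast
      then show ?thesis using y E_minus[OF x, of y] by (intro bexI[of _ y]) (simp_all add: E_simps(2))
    qed
    then show ?thesis using E.closure_eq_carrier_iff[of "\<Union>r. S r"] SH by (auto simp: E_simps(1))
  qed

  \<comment> \<open>The pairing and its isometry\<close>
  define \<Phi> where "\<Phi> b = (\<lambda>f \<in> H. f b)" for b
  have \<Phi>_bound: "cmod (\<Phi> b f) \<le> \<parallel>b\<parallel>\<^bsub>B\<^esub> * \<parallel>f\<parallel>\<^bsub>E\<^esub>" if "b \<in> carrier B" "f \<in> carrier E" for b f
    using B.dual_norm_bound[OF HD that(1), of f] that by (simp add: \<Phi>_def E_simps mult.commute)
  have \<Phi>_dual: "\<Phi> b \<in> carrier (dual_space K E)" if b: "b \<in> carrier B" for b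
  proof (rule E.dual_spaceI)
    show "\<Phi> b \<in> linear_maps K E (scalars K)"
    proof (rule linear_functionalI)
      show "\<Phi> b x \<in> K" if "x \<in> carrier E" for x
        using that linear_functionalD(1)[OF B.dual_spaceD(1)[OF HD] b] by (simp add: \<Phi>_def E_simps)
      show "\<Phi> b (x \<oplus>\<^bsub>E\<^esub> y) = \<Phi> b x + \<Phi> b y" if "x \<in> carrier E" "y \<in> carrier E" for x y
        using that b E.M.add.m_closed[OF that] by (simp add: \<Phi>_def E_simps)
      show "\<Phi> b (c \<odot>\<^bsub>E\<^esub> x) = c * \<Phi> b x" if "c \<in> K" "x \<in> carrier E" for c x
        using that b E.smult_in[OF that] by (simp add: \<Phi>_def E_simps)
    qed
    show "\<Phi> b \<in> extensional (carrier E)" by (simp add: \<Phi>_def E_simps)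
  qed (rule \<Phi>_bound[OF b])
  have \<Phi>_lift: "\<Phi> b (lift r f) = f (\<psi> r b)" if "b \<in> carrier B" "f \<in> carrier (?DA r)" for b r f
  proof -
    have "lift r f \<in> H" using SH that(2) unfolding S_def by blast
    then show ?thesis using that by (simp add: \<Phi>_def lift_apply)
  qed
  have \<Phi>_lin: "\<Phi> \<in> linear_maps K B (dual_space K E)"
  proof -
    have "\<Phi> (b \<oplus>\<^bsub>B\<^esub> c) = \<Phi> b \<oplus>\<^bsub>dual_space K E\<^esub> \<Phi> c" if "b \<in> carrier B" "c \<in> carrier B" for b c
      using that linear_functionalD(2)[OF B.dual_spaceD(1)[OF HD]]
      by (auto simp: \<Phi>_def E_simps fun_eq_iff)
    moreover have "\<Phi> (c \<odot>\<^bsub>B\<^esub> b) = c \<odot>\<^bsub>dual_space K E\<^esub> \<Phi> b" if "c \<in> K" "b \<in> carrier B" for c b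
      using that linear_functionalD(3)[OF B.dual_spaceD(1)[OF HD]]
      by (auto simp: \<Phi>_def E_simps fun_eq_iff)
    ultimately show ?thesis using \<Phi>_dual by (auto simp: linear_maps_def hom_def)
  qed
  have \<Phi>_norm: "\<parallel>\<Phi> b\<parallel>\<^bsub>dual_space K E\<^esub> = \<parallel>b\<parallel>\<^bsub>B\<^esub>" if b: "b \<in> carrier B" for b
  proof (rule antisym)
    show "\<parallel>\<Phi> b\<parallel>\<^bsub>dual_space K E\<^esub> \<le> \<parallel>b\<parallel>\<^bsub>B\<^esub>" by (rule E.dual_norm_le) (use b \<Phi>_bound in auto)
    \<comment> \<open>The lift of a norming functional of \<open>\<psi> r b\<close> is an element of
      the unit ball of \<open>E\<close> that detects the norm of this coordinate; the norm of
      \<open>b\<close> is the supremum over all \<open>r\<close>.\<close>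
    have "\<parallel>\<psi> r b\<parallel>\<^bsub>A r\<^esub> \<le> \<parallel>\<Phi> b\<parallel>\<^bsub>dual_space K E\<^esub>" for r
    proof -
      interpret A: nspace K "A r" by (rule A)
      obtain f where f: "f \<in> carrier (?DA r)" "f (\<psi> r b) = complex_of_real \<parallel>\<psi> r b\<parallel>\<^bsub>A r\<^esub>"
        "\<parallel>f\<parallel>\<^bsub>?DA r\<^esub> \<le> 1" using A.norming_dual[OF hom(1)[OF b]] by blast
      have lE: "lift r f \<in> carrier E" using SH f(1) unfolding S_def E_simps by blast
      have "\<parallel>\<psi> r b\<parallel>\<^bsub>A r\<^esub> = cmod (\<Phi> b (lift r f))"
        using \<Phi>_lift[OF b f(1)] f(2) A.norm_nonneg[OF hom(1)[OF b]] by simp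
      also have "\<dots> \<le> \<parallel>\<Phi> b\<parallel>\<^bsub>dual_space K E\<^esub> * \<parallel>lift r f\<parallel>\<^bsub>E\<^esub>" by (rule E.dual_norm_bound[OF \<Phi>_dual[OF b] lE])
      also have "\<dots> \<le> \<parallel>\<Phi> b\<parallel>\<^bsub>dual_space K E\<^esub> * 1"
        using lift(2)[OF f(1)] f(3) by (intro mult_left_mono E.dual_norm_nonneg[OF \<Phi>_dual[OF b]]) (simp add: E_simps)
      finally show ?thesis by simp
    qed
    then show "\<parallel>b\<parallel>\<^bsub>B\<^esub> \<le> \<parallel>\<Phi> b\<parallel>\<^bsub>dual_space K E\<^esub>" unfolding normB[OF b] by (intro cSUP_least) auto
  qed
  have \<Phi>_inj: "inj_on \<Phi> (carrier B)"
  proof (rule inj_onI)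
    fix b c assume b: "b \<in> carrier B" and c: "c \<in> carrier B" and eq: "\<Phi> b = \<Phi> c"
    have "\<Phi> (b \<ominus>\<^bsub>B\<^esub> c) f = 0" if "f \<in> carrier E" for f
      using B.functional_minus[OF B.dual_spaceD(1)[OF HD] b c, of f] fun_cong[OF eq, of f] that
      by (simp add: \<Phi>_def E_simps)
    then have "\<parallel>\<Phi> (b \<ominus>\<^bsub>B\<^esub> c)\<parallel>\<^bsub>dual_space K E\<^esub> \<le> 0" by (intro E.dual_norm_le) auto
    then have "\<parallel>b \<ominus>\<^bsub>B\<^esub> c\<parallel>\<^bsub>B\<^esub> = 0" 
      using \<Phi>_norm[OF B.M.minus_closed[OF b c]] B.norm_nonneg[OF B.M.minus_closed[OF b c]] by linarith
    then show "b = c" using B.mnorm_eq_zero_iff[of "b \<ominus>\<^bsub>B\<^esub> c"] B.minus_eq_zero_iff[OF b c] b c by simp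
  qed

  \<comment> \<open>Every functional on the predual is a bounded thread\<close>
  have \<Phi>_surj: "\<exists>b \<in> carrier B. \<Phi> b = F" if F: "F \<in> carrier (dual_space K E)" for F
  proof -
    note Flin = linear_functionalD[OF E.dual_spaceD(1)[OF F]]
    have liftE: "lift r f \<in> carrier E" if "f \<in> carrier (?DA r)" for r f
      using SH that unfolding S_def E_simps by blast
    have "\<exists>a \<in> carrier (A r). \<forall>f \<in> carrier (?DA r). F (lift r f) = f a" for r
    proof -
      interpret A: nspace K "A r" by (rule A)
      have "(\<lambda>f. F (lift r f)) \<in> linear_maps K (?DA r) (scalars K)"
      proof (rule linear_functionalI)
        show "F (lift r f) \<in> K" if "f \<in> carrier (?DA r)" for f by (rule Flin(1)[OF liftE[OF that]])
        show "F (lift r (f \<oplus>\<^bsub>?DA r\<^esub> g)) = F (lift r f) + F (lift r g)"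
          if "f \<in> carrier (?DA r)" "g \<in> carrier (?DA r)" for f g
          using Flin(2)[OF liftE[OF that(1)] liftE[OF that(2)]] unfolding lift_add E_simps .
        show "F (lift r (c \<odot>\<^bsub>?DA r\<^esub> f)) = c * F (lift r f)"
          if "c \<in> K" "f \<in> carrier (?DA r)" for c f
          using Flin(3)[OF that(1) liftE[OF that(2)]] unfolding lift_smult E_simps .
      qed
      then show ?thesis by (rule A.fin_dim_reflexive[OF sys.fin_dim])
    qed
    then obtain a where a: "\<And>r. a r \<in> carrier (A r)"
      "\<And>r f. f \<in> carrier (?DA r) \<Longrightarrow> F (lift r f) = f (a r)" by metis
    \<comment> \<open>Both sides agree under every functional on \<open>A r\<close>, because it and
      its pullback to \<open>A s\<close> are the same element of the predual.\<close>
    have "\<pi> r s (a s) = a r" if rs: "r \<le> s" for r s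
    proof (rule nspace.dual_separates[OF A \<pi>_in[OF rs a(1)] a(1)])
      fix f assume f: "f \<in> carrier (?DA r)"
      have "f (\<pi> r s (a s)) = pullback (A s) (\<pi> r s) f (a s)" using a(1) by (simp add: pullback_def)
      also have "\<dots> = F (lift s (pullback (A s) (\<pi> r s) f))" using a(2)[OF lift_\<pi>(1)[OF rs f]] by simp
      also have "\<dots> = f (a r)" unfolding lift_\<pi>(2)[OF rs f] by (rule a(2)[OF f])
      finally show "f (\<pi> r s (a s)) = f (a r)" .
    qed
    moreover have "\<parallel>a r\<parallel>\<^bsub>A r\<^esub> \<le> \<parallel>F\<parallel>\<^bsub>dual_space K E\<^esub>" for r
    proof -
      interpret A: nspace K "A r" by (rule A)
      obtain f where f: "f \<in> carrier (?DA r)" "f (a r) = complex_of_real \<parallel>a r\<parallel>\<^bsub>A r\<^esub>"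
        "\<parallel>f\<parallel>\<^bsub>?DA r\<^esub> \<le> 1" using A.norming_dual[OF a(1)] by blast
      have "\<parallel>a r\<parallel>\<^bsub>A r\<^esub> = cmod (F (lift r f))" using a(2)[OF f(1)] f(2) A.norm_nonneg[OF a(1)] by simp
      also have "\<dots> \<le> \<parallel>F\<parallel>\<^bsub>dual_space K E\<^esub> * \<parallel>lift r f\<parallel>\<^bsub>E\<^esub>" by (rule E.dual_norm_bound[OF F liftE[OF f(1)]])
      also have "\<dots> \<le> \<parallel>F\<parallel>\<^bsub>dual_space K E\<^esub> * 1"
        using lift(2)[OF f(1)] f(3) by (intro mult_left_mono E.dual_norm_nonneg[OF F]) (simp add: E_simps)
      finally show ?thesis by simp
    qed
    ultimately obtain b where b: "b \<in> carrier B" "\<And>r. \<psi> r b = a r" using thread[OF a(1)] by metis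
    have on_S: "\<Phi> b f = F f" if "f \<in> (\<Union>r. S r)" for f
      using that \<Phi>_lift[OF b(1)] b(2) a(2) by (auto simp: S_def)
    have "\<Phi> b = F"
    proof (rule E.dual_eqI[OF \<Phi>_dual[OF b(1)] F])
      fix f assume f: "f \<in> carrier E"
      let ?G = "\<Phi> b \<ominus>\<^bsub>dual_space K E\<^esub> F"
      have G: "?G \<in> carrier (dual_space K E)"
        using nspace.nspace_dual[OF E.nspace_axioms, THEN nspace.axioms(2)] \<Phi>_dual[OF b(1)] F
        by (intro abelian_group.minus_closed) (simp_all add: normed_space_def Module.module_def)
      note G_apply = E.dual_minus[OF \<Phi>_dual[OF b(1)] F]
      have "?G f = 0"
      proof (rule E.functional_vanishes[OF E.dual_spaceD(1)[OF G] E.dual_norm_bound[OF G] _ _ f])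
        show "(\<Union>r. S r) \<subseteq> carrier E" using SH by (auto simp: E_simps)
        then show "?G y = 0" if "y \<in> (\<Union>r. S r)" for y using that on_S[OF that] G_apply[of y] by auto
        show "\<exists>y\<in>\<Union>r. S r. \<parallel>f \<ominus>\<^bsub>E\<^esub> y\<parallel>\<^bsub>E\<^esub> < \<epsilon>" if "0 < \<epsilon>" for \<epsilon>
          using E.closure_eq_carrier_iff[of "\<Union>r. S r"] dense SH f that unfolding E_simps(1) by blast
      qed
      then show "\<Phi> b f = F f" using G_apply[OF f] by simp
    qed
    then show ?thesis using b(1) by blast
  qed
  have \<Phi>_image: "\<Phi> ` carrier B = carrier (dual_space K E)" using \<Phi>_dual \<Phi>_surj by blast
  have "predual K B E \<Phi>"
    unfolding predual_def bij_isometry_def bij_betw_def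
    using E_banach \<Phi>_lin \<Phi>_inj \<Phi>_norm \<Phi>_image by simp

  \<comment> \<open>The annihilators as kernels of the coordinate maps\<close>
  moreover have "ideal_exhaustion K B E \<Phi>"
  proof -
    have subSE: "submodule (S r) (scalars K) E" for r
      by (rule E.submoduleI')
        (use SH D.zero_in_submodule[OF subS] D.submoduleE(4,5)[OF subS]
          in \<open>auto simp: E_simps simp del: dual_space_simps\<close>)
    have fdSE: "fin_dim K (E\<lparr>carrier := S r\<rparr>)" for r using fdS[of r] by (simp add: E_def)
    \<comment> \<open>\<open>S r\<close> consists of the lifts of all functionals on
      \<open>A r\<close>, and these separate the points of \<open>A r\<close>.\<close>
    have ann: "annihilator B \<Phi> (S r) = a_kernel B (A r) (\<psi> r)" for r
    proof -
      interpret A: nspace K "A r" by (rule A)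
      have "(\<forall>e\<in>S r. \<Phi> b e = 0) \<longleftrightarrow> \<psi> r b = \<zero>\<^bsub>A r\<^esub>" if b: "b \<in> carrier B" for b
      proof
        assume e: "\<forall>e\<in>S r. \<Phi> b e = 0"
        show "\<psi> r b = \<zero>\<^bsub>A r\<^esub>"
        proof (rule A.dual_separates[OF hom(1)[OF b] A.M.zero_closed])
          fix f assume f: "f \<in> carrier (?DA r)"
          then have "lift r f \<in> S r" by (simp add: S_def)
          then show "f (\<psi> r b) = f \<zero>\<^bsub>A r\<^esub>"
            using e \<Phi>_lift[OF b f] A.functional_zero[OF A.dual_spaceD(1)[OF f]] by auto
        qed
      next
        assume "\<psi> r b = \<zero>\<^bsub>A r\<^esub>"
        then show "\<forall>e\<in>S r. \<Phi> b e = 0"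
          using \<Phi>_lift[OF b] A.functional_zero[OF A.dual_spaceD(1)] by (auto simp: S_def)
      qed
      then show ?thesis by (auto simp: annihilator_def a_kernel_def')
    qed
    have ideal: "ideal (annihilator B \<Phi> (S r)) B" for r
    proof -
      interpret A: unital_algebra K "A r" by (rule Aalg)
      have "ring_hom_ring B (A r) (\<psi> r)"
        using \<psi>_hom[of r] by (intro ring_hom_ringI2 B.ring_axioms A.ring_axioms) (simp add: alg_hom_def)
      then show ?thesis unfolding ann by (rule ring_hom_ring.kernel_is_ideal)
    qed
    have proper: "annihilator B \<Phi> (S r) \<noteq> carrier B" for r
    proof -
      interpret A: unital_banach_algebra K "A r" by (rule sys.unital_banach_algebra)
      have "\<one>\<^bsub>A r\<^esub> \<noteq> \<zero>\<^bsub>A r\<^esub>" using A.mnorm_one A.mnorm_eq_zero_iff[of "\<one>\<^bsub>A r\<^esub>"] by auto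
      then have "\<one>\<^bsub>B\<^esub> \<notin> a_kernel B (A r) (\<psi> r)" using hom(5) by (simp add: a_kernel_def')
      then show ?thesis unfolding ann by blast
    qed
    have nz: "S r \<noteq> {\<zero>\<^bsub>E\<^esub>}" for r
    proof
      assume "S r = {\<zero>\<^bsub>E\<^esub>}"
      then have "annihilator B \<Phi> (S r) = carrier B"
        using E.functional_zero[OF E.dual_spaceD(1)[OF \<Phi>_dual]] by (auto simp: annihilator_def)
      then show False using proper by blast
    qed
    show ?thesis
      unfolding ideal_exhaustion_def
      using subSE fdSE nz S_mono[OF le_SucI[OF le_refl]] dense ideal proper
      by (intro exI[of _ S] conjI allI) simp_all
  qed
  ultimately show ?thesis unfolding has_ideal_exhaustion_def by blast
qed

section \<open>The equivalence\<close>

lemma dual_algebraI: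
  assumes "scalar_field K" "unital_banach_algebra K B" "predual K B E \<Phi>"
  shows "dual_algebra K B E \<Phi>"
proof -
  interpret B: unital_banach_algebra K B by (rule assms)
  have "normed_space K E" using assms(3) by (simp add: predual_def banach_space_def)
  then show ?thesis
    using assms by (intro dual_algebra.intro predual_pair.intro predual_pair_axioms.intro nspace.intro
        B.normed_space_axioms)
qed

theorem theorem2p7:
  fixes K :: "complex set" and B :: "(complex, 'b) normed_module"
  assumes "K = \<real> \<or> K = UNIV" and "unital_banach_algebra K B"
  shows
    "(is_bounded_inverse_limit TYPE(nat \<Rightarrow> complex) K B
        \<longleftrightarrow> has_separating_homs TYPE('b \<Rightarrow> complex) TYPE(nat \<Rightarrow> complex) K B) \<and>
     (has_separating_homs TYPE('b \<Rightarrow> complex) TYPE(nat \<Rightarrow> complex) K B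
        \<longleftrightarrow> has_ideal_exhaustion TYPE('b \<Rightarrow> complex) K B) \<and>
     (is_bounded_inverse_limit TYPE(nat \<Rightarrow> complex) K B \<longrightarrow>
        (\<exists>(E :: (complex, 'b \<Rightarrow> complex) normed_module) \<Phi>.
           predual K B E \<Phi> \<and> separable_space (norm_topology E) \<and>
           separating_homs TYPE(nat \<Rightarrow> complex) K B E \<Phi> \<and> ideal_exhaustion K B E \<Phi>)) \<and>
     (is_bounded_inverse_limit TYPE('a) K B
        \<longrightarrow> is_bounded_inverse_limit TYPE(nat \<Rightarrow> complex) K B) \<and>
     (has_separating_homs TYPE('e) TYPE('f) K B
        \<longrightarrow> has_separating_homs TYPE('b \<Rightarrow> complex) TYPE(nat \<Rightarrow> complex) K B) \<and>
     (has_ideal_exhaustion TYPE('g) K B \<longrightarrow> has_ideal_exhaustion TYPE('b \<Rightarrow> complex) K B)"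
proof -
  have field: "scalar_field K" using assms(1) by (rule scalar_field.intro)
  note B = assms(2)
  note dual = dual_algebraI[OF field B]
  have i_iii: "has_ideal_exhaustion TYPE('b \<Rightarrow> complex) K B"
    if "is_bounded_inverse_limit TYPE(nat \<Rightarrow> complex) K B"
    using that by (rule inverse_limit_imp_ideal_exhaustion[OF field B])
  \<comment> \<open>The primed variants start from data in the free types of the last three
    conjuncts. They are stated separately because a fact inside the proof has fixed types, whereas
    the lemmas are polymorphic.\<close>
  have i_iii': "has_ideal_exhaustion TYPE('b \<Rightarrow> complex) K B" if "is_bounded_inverse_limit TYPE('a) K B"
    using that by (rule inverse_limit_imp_ideal_exhaustion[OF field B])
  have iii_i: "is_bounded_inverse_limit TYPE(nat \<Rightarrow> complex) K B" if "has_ideal_exhaustion TYPE('b \<Rightarrow> complex) K B"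
    using that dual_algebra.ideal_exhaustion_imp_inverse_limit[OF dual]
    unfolding has_ideal_exhaustion_def by blast
  have iii_i': "is_bounded_inverse_limit TYPE(nat \<Rightarrow> complex) K B" if "has_ideal_exhaustion TYPE('g) K B"
    using that dual_algebra.ideal_exhaustion_imp_inverse_limit[OF dual]
    unfolding has_ideal_exhaustion_def by blast
  have iii_ii: "has_separating_homs TYPE('b \<Rightarrow> complex) TYPE(nat \<Rightarrow> complex) K B"
    if "has_ideal_exhaustion TYPE('b \<Rightarrow> complex) K B"
    using that dual_algebra.ideal_exhaustion_imp_separating_homs[OF dual]
    unfolding has_ideal_exhaustion_def has_separating_homs_def by blast
  have ii_i: "is_bounded_inverse_limit TYPE(nat \<Rightarrow> complex) K B"
    if "has_separating_homs TYPE('b \<Rightarrow> complex) TYPE(nat \<Rightarrow> complex) K B"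
    using that dual_algebra.separating_homs_imp_ideal_exhaustion[OF dual]
      dual_algebra.ideal_exhaustion_imp_inverse_limit[OF dual]
    unfolding has_separating_homs_def by blast
  \<comment> \<open>The passage through the inverse limit forgets the type of the given predual,
    after which \<open>i_iii\<close> provides one made of functionals on \<open>B\<close>. The same
    detour serves \<open>iii_i'\<close>.\<close>
  have ii_i': "is_bounded_inverse_limit TYPE(nat \<Rightarrow> complex) K B"
    if "has_separating_homs TYPE('e) TYPE('f) K B"
    using that dual_algebra.separating_homs_imp_ideal_exhaustion[OF dual]
      dual_algebra.ideal_exhaustion_imp_inverse_limit[OF dual]
    unfolding has_separating_homs_def by blast
  \<comment> \<open>A predual with an ideal exhaustion is separable and carries separating
    homomorphisms as well, so a single \<open>E\<close> meets all demands.\<close>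
  have sep: "\<exists>(E :: (complex, 'b \<Rightarrow> complex) normed_module) \<Phi>.
           predual K B E \<Phi> \<and> separable_space (norm_topology E) \<and>
           separating_homs TYPE(nat \<Rightarrow> complex) K B E \<Phi> \<and> ideal_exhaustion K B E \<Phi>"
    if iii: "has_ideal_exhaustion TYPE('b \<Rightarrow> complex) K B"
  proof -
    obtain E :: "(complex, 'b \<Rightarrow> complex) normed_module" and \<Phi>
      where E: "predual K B E \<Phi>" "ideal_exhaustion K B E \<Phi>"
      using iii unfolding has_ideal_exhaustion_def by blast
    interpret dual_algebra K B E \<Phi> by (rule dual[OF E(1)])
    obtain S :: "nat \<Rightarrow> ('b \<Rightarrow> complex) set" where "\<And>r. submodule (S r) (scalars K) E"
      "\<And>r. fin_dim K (E\<lparr>carrier := S r\<rparr>)" "norm_topology E closure_of (\<Union>r. S r) = carrier E"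
      by (rule ideal_exhaustionE[OF E(2)]) (rule that)
    then have "separable_space (norm_topology E)" by (rule E.separable_fd_exhaustion)
    then show ?thesis using E ideal_exhaustion_imp_separating_homs[OF E(2)] by blast
  qed
  show ?thesis using i_iii i_iii' iii_i iii_i' iii_ii ii_i ii_i' sep by blast
qed

end
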